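(* Let $\mathbb T=\mathbb R/2\pi\mathbb Z$, let $u_0\in\mathcal P(\mathbb T)$ be a Borel probability measure on $\mathbb T$, and let $u$ be the solution of the periodic Dyson equation $\partial_tu+\partial_x(uH[u])=0$ in $(0,+\infty)\times\mathbb T$ with initial condition $u_0$. Then there exists a time $t>0$ such that $\min_{x\in\mathbb T}u(t,x)>0$, and $$\Big\|u(t,\cdot)-\frac1{2\pi}\Big\|_{L^\infty(\mathbb T)}\longrightarrow0\quad\text{as }t\to+\infty .$$
   Context: $\mathcal P(\mathbb T)$ carries the topology of weak convergence. The periodic Hilbert transform is $H[u](x)=\frac1{2\pi}\,\mathrm{p.v.}\int_{\mathbb T}\cot\!\big(\frac{x-y}2\big)(u(y)-u(x))\,dy$. The minimum of a bounded function defined almost everywhere is understood as its essential infimum (the usual minimum of the continuous representative when there is one). Notion of solution (viscosity solutions of the integrated equation). The solution with initial condition $u_0\in\mathcal P(\mathbb T)$ is the unique $u\in C([0,+\infty),\mathcal P(\mathbb T))$ with $u(0)=u_0$ for which there is a function $F:[0,+\infty)\times\mathbb R\to\mathbb R$ such that: for each $t$, $F(t,\cdot)$ is nondecreasing and right-continuous, $F(t,x+2\pi)=F(t,x)+1$, and the Stieltjes measure $dF(t,\cdot)$ is the $2\pi$-periodic lift of $u(t)$; $F(t,x)\to F(0,x)$ as $t\to0^+$ at every continuity point $x$ of $F(0,\cdot)$; and $F$ is a viscosity solution of $\partial_tF+\partial_xF\,H[\partial_xF]=0$ in $(0,+\infty)\times\mathbb R$. The last condition means: for every smooth $\varphi:(0,+\infty)\times\mathbb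 R\to\mathbb R$ with $\varphi(t,x+2\pi)=\varphi(t,x)+1$ (so that $\partial_x\varphi$ is $2\pi$-periodic in $x$), at every point $(t_0,x_0)$ that is a global maximum of $F^*-\varphi$, strict up to translations of $x$ by $2\pi\mathbb Z$, one has $\partial_t\varphi+\partial_x\varphi\,H[\partial_x\varphi]\le0$ at $(t_0,x_0)$, and at every such global minimum of $F_*-\varphi$ one has $\partial_t\varphi+\partial_x\varphi\,H[\partial_x\varphi]\ge0$, where $F^*,F_*$ are the upper and lower semicontinuous envelopes of $F$. It is known that this solution exists and is unique, and that for $t>0$ the measure $u(t)$ has a bounded density, denoted $u(t,\cdot)$. *)

theory Defs
  imports "HOL-Probability.Probability"
begin

section \<open>The torus and probability measures on it\<close>

definition torus_rel :: "real \<Rightarrow> real \<Rightarrow> bool" where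
  "torus_rel x y \<longleftrightarrow> (\<exists>k::int. x - y = 2 * pi * of_int k)"

lemma equivp_torus_rel: "equivp torus_rel"
proof (rule equivpI)
  show "reflp torus_rel"
    unfolding reflp_def torus_rel_def by (auto intro: exI[of _ 0])
  show "symp torus_rel"
  proof (rule sympI)
    fix x y assume "torus_rel x y"
    then obtain k :: int where "x - y = 2 * pi * of_int k" unfolding torus_rel_def by blast
    then have "y - x = 2 * pi * of_int (- k)" by simp
    then show "torus_rel y x" unfolding torus_rel_def by blast
  qed
  show "transp torus_rel"
  proof (rule transpI)
    fix x y z assume "torus_rel x y" "torus_rel y z"
    then obtain k l :: int where "x - y = 2 * pi * of_int k" "y - z = 2 * pi * of_int l"
      unfolding torus_rel_def by blast
    then have "x - z = 2 * pi * of_int (k + l)" by (simp add: algebra_simps)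
    then show "torus_rel x z" unfolding torus_rel_def by blast
  qed
qed

quotient_type torus = real / torus_rel
  morphisms rep_torus to_torus
  by (rule equivp_torus_rel)

text \<open>The quotient topology.\<close>

instantiation torus :: topological_space
begin

definition open_torus :: "torus set \<Rightarrow> bool" where
  "open_torus U \<longleftrightarrow> open (to_torus -` U)"

instance
proof
  show "open (UNIV :: torus set)" by (simp add: open_torus_def)
  show "open (S \<inter> T)" if "open S" "open T" for S T :: "torus set"
    using that by (simp add: open_torus_def vimage_Int open_Int)
  show "open (\<Union>K)" if "\<forall>S\<in>K. open S" for K :: "torus set set"
    using that by (auto simp: open_torus_def vimage_Union intro!: open_UN)
qed

end

definition torus_lebesgue :: "torus measure" where
  "torus_lebesgue = distr (restrict_space lborel {0..<2 * pi}) borel to_torus"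

definition torus_probs :: "torus measure set" where
  "torus_probs = {\<mu>. prob_space \<mu> \<and> sets \<mu> = sets borel}"

text \<open>The topology of weak convergence: the coarsest topology for which integration against
  each continuous function on the (compact) torus is continuous.\<close>

definition weak_topology :: "torus measure topology" where
  "weak_topology = topology_generated_by
     {{\<mu> \<in> torus_probs. (\<integral>\<theta>. f \<theta> \<partial>\<mu>) \<in> U} | (f :: torus \<Rightarrow> real) (U :: real set).
        continuous_on UNIV f \<and> open U}"

text \<open>\<open>\<nu>\<close> is the \<open>2 * pi\<close>-periodic lift of \<open>\<mu>\<close>. Having this for every starting point \<open>a\<close> of the
  period, and not just for one, is what makes \<open>\<nu>\<close> invariant under translation by \<open>2 * pi\<close>.\<close>

definition periodic_lift :: "torus measure \<Rightarrow> real measure \<Rightarrow> bool" where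
  "periodic_lift \<mu> \<nu> \<longleftrightarrow> sets \<nu> = sets borel \<and>
     (\<forall>a. distr (restrict_space \<nu> {a..<a + 2 * pi}) borel to_torus = \<mu>)"

text \<open>The density \<open>u(t,\<cdot>)\<close> of a measure \<open>u(t)\<close>. If \<open>\<mu>\<close> has no density, \<^const>\<open>RN_deriv\<close> is
  identically \<open>0\<close>.\<close>

definition torus_density :: "torus measure \<Rightarrow> torus \<Rightarrow> real" where
  "torus_density \<mu> \<theta> = enn2real (RN_deriv torus_lebesgue \<mu> \<theta>)"

definition ess_min :: "(torus \<Rightarrow> real) \<Rightarrow> ereal" where
  "ess_min f = - esssup torus_lebesgue (\<lambda>\<theta>. - ereal (f \<theta>))"

definition Linf_norm :: "(torus \<Rightarrow> real) \<Rightarrow> ereal" where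
  "Linf_norm f = esssup torus_lebesgue (\<lambda>\<theta>. ereal \<bar>f \<theta>\<bar>)"

section \<open>The periodic Hilbert transform\<close>

text \<open>Functions on the torus are represented here by \<open>2 * pi\<close>-periodic functions on the line, so
  that the integral can be taken over the period centred at the singularity \<open>x\<close>.\<close>

definition hilbert :: "(real \<Rightarrow> real) \<Rightarrow> real \<Rightarrow> real" where
  "hilbert v x = 1 / (2 * pi) *
     Lim (at_right 0) (\<lambda>\<epsilon>. LBINT y:{y. \<epsilon> < \<bar>y - x\<bar> \<and> \<bar>y - x\<bar> \<le> pi}.
       cot ((x - y) / 2) * (v y - v x))"

section \<open>Viscosity solutions of the integrated equation\<close>

primrec Ck_on :: "nat \<Rightarrow> (real \<times> real) set \<Rightarrow> (real \<times> real \<Rightarrow> real) \<Rightarrow> bool" where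
  "Ck_on 0 S f \<longleftrightarrow> continuous_on S f"
| "Ck_on (Suc k) S f \<longleftrightarrow>
     (\<exists>g h. (\<forall>z\<in>S. (f has_derivative (\<lambda>(a, b). a * g z + b * h z)) (at z)) \<and>
            Ck_on k S g \<and> Ck_on k S h)"

definition smooth_on :: "(real \<times> real) set \<Rightarrow> (real \<times> real \<Rightarrow> real) \<Rightarrow> bool" where
  "smooth_on S f \<longleftrightarrow> (\<forall>k. Ck_on k S f)"

definition test_function :: "(real \<Rightarrow> real \<Rightarrow> real) \<Rightarrow> bool" where
  "test_function \<phi> \<longleftrightarrow> smooth_on ({0<..} \<times> UNIV) (\<lambda>(t, x). \<phi> t x) \<and>
     (\<forall>t>0. \<forall>x. \<phi> t (x + 2 * pi) = \<phi> t x + 1)"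

text \<open>The filter \<^term>\<open>nhds (t, x)\<close> includes the point \<open>(t, x)\<close> itself, so these are the
  semicontinuous envelopes \<open>F\<^sup>*\<close> and \<open>F\<^sub>*\<close>. They are only used for \<open>t > 0\<close>, where the values of
  \<open>F\<close> at nonpositive times do not matter.\<close>

definition usc_env :: "(real \<Rightarrow> real \<Rightarrow> real) \<Rightarrow> real \<Rightarrow> real \<Rightarrow> ereal" where
  "usc_env F t x = Limsup (nhds (t, x)) (\<lambda>(s, y). ereal (F s y))"

definition lsc_env :: "(real \<Rightarrow> real \<Rightarrow> real) \<Rightarrow> real \<Rightarrow> real \<Rightarrow> ereal" where
  "lsc_env F t x = Liminf (nhds (t, x)) (\<lambda>(s, y). ereal (F s y))"

definition strict_global_max :: "(real \<Rightarrow> real \<Rightarrow> ereal) \<Rightarrow> real \<Rightarrow> real \<Rightarrow> bool" where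
  "strict_global_max G t\<^sub>0 x\<^sub>0 \<longleftrightarrow> t\<^sub>0 > 0 \<and>
     (\<forall>t>0. \<forall>x. G t x \<le> G t\<^sub>0 x\<^sub>0 \<and>
        (G t x = G t\<^sub>0 x\<^sub>0 \<longrightarrow> t = t\<^sub>0 \<and> (\<exists>k::int. x = x\<^sub>0 + 2 * pi * of_int k)))"

definition strict_global_min :: "(real \<Rightarrow> real \<Rightarrow> ereal) \<Rightarrow> real \<Rightarrow> real \<Rightarrow> bool" where
  "strict_global_min G t\<^sub>0 x\<^sub>0 \<longleftrightarrow> t\<^sub>0 > 0 \<and>
     (\<forall>t>0. \<forall>x. G t\<^sub>0 x\<^sub>0 \<le> G t x \<and>
        (G t x = G t\<^sub>0 x\<^sub>0 \<longrightarrow> t = t\<^sub>0 \<and> (\<exists>k::int. x = x\<^sub>0 + 2 * pi * of_int k)))"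

definition dyson_op :: "(real \<Rightarrow> real \<Rightarrow> real) \<Rightarrow> real \<Rightarrow> real \<Rightarrow> real" where
  "dyson_op \<phi> t x = deriv (\<lambda>s. \<phi> s x) t + deriv (\<phi> t) x * hilbert (deriv (\<phi> t)) x"

text \<open>The envelopes are required to be real-valued, i.e. \<open>F\<close> is locally bounded for \<open>t > 0\<close>, as is
  implicit in the notion of viscosity solution. Otherwise, adding to \<open>F\<close> a function of \<open>t\<close> that
  is unbounded above and below near a single time would make both test conditions vacuous.\<close>

definition viscosity_solution :: "(real \<Rightarrow> real \<Rightarrow> real) \<Rightarrow> bool" where
  "viscosity_solution F \<longleftrightarrow>
     (\<forall>t>0. \<forall>x. \<bar>usc_env F t x\<bar> \<noteq> \<infinity> \<and> \<bar>lsc_env F t x\<bar> \<noteq> \<infinity>) \<and>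
     (\<forall>\<phi>. test_function \<phi> \<longrightarrow>
       (\<forall>t\<^sub>0 x\<^sub>0. strict_global_max (\<lambda>t x. usc_env F t x - ereal (\<phi> t x)) t\<^sub>0 x\<^sub>0 \<longrightarrow>
          dyson_op \<phi> t\<^sub>0 x\<^sub>0 \<le> 0) \<and>
       (\<forall>t\<^sub>0 x\<^sub>0. strict_global_min (\<lambda>t x. lsc_env F t x - ereal (\<phi> t x)) t\<^sub>0 x\<^sub>0 \<longrightarrow>
          dyson_op \<phi> t\<^sub>0 x\<^sub>0 \<ge> 0))"

definition integrated_solution :: "(real \<Rightarrow> torus measure) \<Rightarrow> (real \<Rightarrow> real \<Rightarrow> real) \<Rightarrow> bool" where
  "integrated_solution u F \<longleftrightarrow>
     (\<forall>t\<ge>0. mono (F t) \<and> (\<forall>x. continuous (at_right x) (F t)) \<and>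
            (\<forall>x. F t (x + 2 * pi) = F t x + 1) \<and>
            periodic_lift (u t) (interval_measure (F t))) \<and>
     (\<forall>x. isCont (F 0) x \<longrightarrow> ((\<lambda>t. F t x) \<longlongrightarrow> F 0 x) (at_right 0)) \<and>
     viscosity_solution F"

text \<open>The values \<open>u t\<close> for \<open>t < 0\<close> are irrelevant.\<close>

definition dyson_solution :: "torus measure \<Rightarrow> (real \<Rightarrow> torus measure) \<Rightarrow> bool" where
  "dyson_solution u\<^sub>0 u \<longleftrightarrow>
     continuous_map (top_of_set {0..}) weak_topology u \<and> u 0 = u\<^sub>0 \<and>
     (\<exists>F. integrated_solution u F)"

end

theory Submission
  imports Defs "HOL-Complex_Analysis.Complex_Analysis"
begin

text \<open>
Let \<open>f = u + \<i> H[u]\<close> be the boundary value of a function that is holomorphic in the upper half plane.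
Then \<open>\<partial>\<^sub>t u + \<partial>\<^sub>x (u H[u])\<close> is the real part of \<open>\<partial>\<^sub>t f - \<i> f \<partial>\<^sub>z f\<close>, so the Dyson equation is the trace on the
real line of the complex Burgers equation \<open>\<partial>\<^sub>t f = \<i> f \<partial>\<^sub>z f\<close>. That equation is solved by characteristics:
\<open>f(t, z) = f\<^sub>0(\<zeta>)\<close> where \<open>\<zeta> = z + \<i> t f\<^sub>0(\<zeta>)\<close>.

The characteristic equation contains the theorem. Its imaginary part says that \<open>\<zeta>\<close> has
height \<open>b = Im z + t u \<ge> t u\<close>. At height \<open>b\<close> the Poisson average of every probability measure
on the circle lies between \<open>b / (b + 2) / (2 pi)\<close> and \<open>1 / (2 pi) + 1 / (pi b)\<close>. Hence
\<open>2 pi u \<ge> t u / (t u + 2)\<close>, and because \<open>u > 0\<close> one may divide by \<open>u\<close> to get \<open>u \<ge> 1 / (2 pi) - 2 / t\<close>.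
The upper bound on the Poisson average then gives \<open>u \<le> 1 / (2 pi) + 2 / t\<close>
(\<open>density_bounds\<close>). These bounds do not depend on the initial measure.

The given solution is only a viscosity solution, and its initial measure may be singular.
Finite sums of atoms, seen from a positive height above the real line, give exact solutions that are smooth
(\<open>potential_Ck_on\<close>) and whose Hilbert transform is an imaginary part
(\<open>hilbert_Re_eq_Im\<close>). The primitive in \<open>x\<close> of such a solution, slightly perturbed into a strict
super- or subsolution, is a test function, so the definition of viscosity
solution compares \<open>F\<close> with it directly (\<open>usc_env_le_profile\<close>, \<open>profile_le_lsc_env\<close>); doubling of
variables is avoided because one of the two functions compared is smooth. The initial
distribution function is approximated in the sense of the Levy metric, that is, up to a small horizontal and a
small vertical shift (\<open>initial_approximation\<close>, \<open>initial_layer\<close>). Both shifts are carried along by the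
smooth solution, whose increments obey the bounds above, and they disappear in the limit: for \<open>t > 0\<close>
the increments of \<open>F t\<close> differ from those of the uniform distribution by at most \<open>2 / t\<close> times the length
of the interval (\<open>integrated_solution_increment\<close>). Hence \<open>u(t)\<close> has a density within \<open>2 / t\<close>
of \<open>1 / (2 pi)\<close>, which is positive once \<open>t > 4 pi\<close>.
\<close>

section \<open>Holomorphic extensions of probability measures on the circle\<close>

lemma cosh_sub_one_le: "cosh b - 1 \<le> b * sinh b / 2" if "0 \<le> b" for b :: real
proof -
  have "((\<lambda>x. x * sinh x / 2 - cosh x + 1) has_real_derivative ((x * cosh x - sinh x) / 2)) (at x)" for x :: real
    by (auto intro!: derivative_eq_intros simp: field_simps)
  moreover have "x * cosh x - sinh x \<ge> 0" if "x \<ge> 0" for x :: real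
  proof -
    have "((\<lambda>x. x * cosh x - sinh x) has_real_derivative (x * sinh x)) (at x)" for x :: real
      by (auto intro!: derivative_eq_intros simp: field_simps)
    then have "0 * cosh 0 - sinh 0 \<le> x * cosh x - sinh x"
      by (intro DERIV_nonneg_imp_nondecreasing[OF that])
        (metis mult_nonneg_nonneg sinh_real_nonneg_iff)
    then show ?thesis by simp
  qed
  ultimately have "0 * sinh 0 / 2 - cosh 0 + 1 \<le> b * sinh b / 2 - cosh b + 1"
    by (intro DERIV_nonneg_imp_nondecreasing[OF that]) (metis divide_nonneg_pos zero_less_numeral)
  then show ?thesis by simp
qed

lemma le_sinh: "x \<le> sinh x" if "0 \<le> x" for x :: real
proof -
  have "((\<lambda>x. sinh x - x) has_real_derivative (cosh x - 1)) (at x)" for x :: real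
    by (auto intro!: derivative_eq_intros)
  then have "sinh 0 - 0 \<le> sinh x - x"
    by (intro DERIV_nonneg_imp_nondecreasing[OF that]) (metis cosh_real_ge_1 diff_ge_0_iff_ge)
  then show ?thesis by simp
qed

text \<open>The quotient \<open>sinh x / x\<close> is increasing; the form without division covers \<open>x = 0\<close>.\<close>

lemma sinh_quotient_mono: "x * sinh y \<ge> y * sinh x" if "0 \<le> x" "x \<le> y" for x y :: real
proof -
  have d: "((\<lambda>y. x * sinh y - y * sinh x) has_real_derivative (x * cosh y - sinh x)) (at y)" for y :: real
    by (auto intro!: derivative_eq_intros)
  have e: "x * cosh y - sinh x \<ge> 0" if "x \<le> y" for y
  proof -
    have "((\<lambda>x. x * cosh x - sinh x) has_real_derivative (x * sinh x)) (at x)" for x :: real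
      by (auto intro!: derivative_eq_intros simp: field_simps)
    then have "0 * cosh 0 - sinh 0 \<le> x * cosh x - sinh x"
      by (intro DERIV_nonneg_imp_nondecreasing[OF \<open>0 \<le> x\<close>])
        (metis mult_nonneg_nonneg sinh_real_nonneg_iff)
    moreover have "x * cosh x \<le> x * cosh y"
      using that \<open>0 \<le> x\<close> by (intro mult_left_mono) (auto simp: cosh_real_nonneg_le_iff)
    ultimately show ?thesis by simp
  qed
  have "x * sinh x - x * sinh x \<le> x * sinh y - y * sinh x"
    by (rule DERIV_nonneg_imp_nondecreasing[OF \<open>x \<le> y\<close>]) (use d e in blast)
  then show ?thesis by simp
qed

text \<open>The contraction property of the Poisson kernel (a Schwarz--Pick inequality) in elementary form:
  \<open>2 (cosh (b - c) - cos a)\<close> is, up to a common factor, the squared distance of two points \<open>exp (\<i> z)\<close>,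
  \<open>exp (\<i> w)\<close> with \<open>a = Re (z - w)\<close>, \<open>b = Im z\<close>, \<open>c = Im w\<close>. The horizontal part only needs
  \<open>1 - cos a \<le> a\<^sup>2 / 2\<close>; for the vertical part, \<open>b - c \<le> b\<close> makes the monotonicity of \<open>sinh x / x\<close> applicable.\<close>

lemma cosh_diff_le:
  fixes a b c :: real
  assumes "0 < b" "0 < c"
  shows "2 * (cosh (b - c) - cos a) * (b * c) \<le> (a\<^sup>2 + (b - c)\<^sup>2) * (sinh b * sinh c)"
proof -
  have *: "2 * (cosh (b - c) - 1) * (b * c) \<le> (b - c)\<^sup>2 * (sinh b * sinh c)"
    if "0 < c" "c \<le> b" for b c :: real
  proof -
    define d where "d = b - c"
    have d: "0 \<le> d" "d \<le> b" using that by (auto simp: d_def)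
    have "2 * (cosh d - 1) * (b * c) \<le> (d * sinh d) * (b * c)"
      using cosh_sub_one_le[OF d(1)] that d by (intro mult_right_mono) auto
    also have "\<dots> = d * (b * sinh d) * c" by simp
    also have "\<dots> \<le> d * (d * sinh b) * sinh c"
      by (rule mult_mono[OF mult_left_mono])
        (use sinh_quotient_mono[OF d] le_sinh[of c] that d in \<open>auto simp: sinh_real_nonneg_iff\<close>)
    finally show ?thesis by (simp add: d_def power2_eq_square mult_ac)
  qed
  have 1: "2 * (cosh (b - c) - 1) * (b * c) \<le> (b - c)\<^sup>2 * (sinh b * sinh c)"
  proof (cases "c \<le> b")
    case True then show ?thesis using * assms by blast
  next
    case False
    then have "2 * (cosh (c - b) - 1) * (c * b) \<le> (c - b)\<^sup>2 * (sinh c * sinh b)"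
      using *[of b c] assms by auto
    then show ?thesis
      by (metis cosh_minus minus_diff_eq mult.commute power2_minus)
  qed
  have c: "1 - cos a \<le> a\<^sup>2 / 2"
  proof -
    have "1 - cos a = 2 * (sin (a / 2))\<^sup>2" using cos_double_sin[of "a/2"] by simp
    moreover have "(sin (a / 2))\<^sup>2 \<le> (a / 2)\<^sup>2"
      by (metis abs_le_square_iff abs_sin_x_le_abs_x)
    ultimately show ?thesis by (simp add: power_divide)
  qed
  have "2 * (1 - cos a) * (b * c) \<le> a\<^sup>2 * (sinh b * sinh c)"
    using c le_sinh[of b] le_sinh[of c] assms
    by (intro mult_mono) (auto simp: sinh_real_nonneg_iff)
  with 1 show ?thesis by (simp add: algebra_simps)
qed

text \<open>What is needed of the holomorphic extension \<open>f0\<close> of \<open>u + \<i> H[u]\<close> when \<open>u\<close> is a probability measure on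
  the circle, together with a primitive \<open>P0\<close>, whose real part is then a distribution function. The bounds \<open>f0_lower\<close>
  and \<open>f0_near\<close> are those of the Poisson kernel at height \<open>Im z\<close>. The two-point estimate is the
  Schwarz--Pick inequality for maps from the upper half plane to the right half plane, with the geometric
  mean of the two quotients replaced by their arithmetic mean: in this form all axioms are preserved by
  convex combinations, so that it suffices to check a single atom.\<close>

locale herglotz =
  fixes f0 P0 :: "complex \<Rightarrow> complex"
  assumes P0_deriv: "\<And>z. 0 < Im z \<Longrightarrow> (P0 has_field_derivative f0 z) (at z)"
    and f0_periodic: "\<And>z. 0 < Im z \<Longrightarrow> f0 (z + 2 * pi) = f0 z"
    and P0_periodic: "\<And>z. 0 < Im z \<Longrightarrow> P0 (z + 2 * pi) = P0 z + 1"
    and f0_lower: "\<And>z. 0 < Im z \<Longrightarrow> Im z / (Im z + 2) / (2 * pi) \<le> Re (f0 z)"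
    and f0_near: "\<And>z. 0 < Im z \<Longrightarrow> norm (f0 z - 1 / (2 * pi)) \<le> 1 / (pi * Im z)"
    and f0_two_point: "\<And>z w. 0 < Im z \<Longrightarrow> 0 < Im w \<Longrightarrow>
      norm (f0 z - f0 w) \<le> norm (z - w) * ((Re (f0 z) / Im z + Re (f0 w) / Im w) / 2)"

text \<open>The extension \<open>\<i> cot (z / 2) / (2 pi)\<close> of a unit atom at \<open>0\<close>, in the variable \<open>exp (\<i> z)\<close>.\<close>

definition atom_kernel :: "complex \<Rightarrow> complex" where
  "atom_kernel z = (1 + exp (\<i> * z)) / (1 - exp (\<i> * z)) / (2 * pi)"

text \<open>The logarithm stays on its principal branch, because \<open>exp (\<i> z)\<close> lies in the unit disc.\<close>

definition atom_primitive :: "complex \<Rightarrow> complex" where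
  "atom_primitive z = (z + 2 * \<i> * Ln (1 - exp (\<i> * z))) / (2 * pi)"

lemma norm_exp_i_less_1: "0 < Im z \<Longrightarrow> norm (exp (\<i> * z)) < 1"
  by simp

lemma one_minus_exp_i:
  assumes "0 < Im z"
  shows "1 - exp (\<i> * z) \<noteq> 0" "0 < Re (1 - exp (\<i> * z))" "1 - exp (\<i> * z) \<notin> \<real>\<^sub>\<le>\<^sub>0"
proof -
  have "Re (exp (\<i> * z)) < 1"
    using norm_exp_i_less_1[OF assms] complex_Re_le_cmod[of "exp (\<i> * z)"] by linarith
  then show "0 < Re (1 - exp (\<i> * z))" by simp
  then show "1 - exp (\<i> * z) \<noteq> 0" "1 - exp (\<i> * z) \<notin> \<real>\<^sub>\<le>\<^sub>0"
    by (auto simp: complex_nonpos_Reals_iff)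
qed

lemma Re_atom_kernel:
  assumes "0 < Im z"
  shows "2 * pi * Re (atom_kernel z) = (1 - (norm (exp (\<i> * z)))\<^sup>2) / (norm (1 - exp (\<i> * z)))\<^sup>2"
proof -
  define q where "q = exp (\<i> * z)"
  have q: "1 - q \<noteq> 0" using one_minus_exp_i[OF assms] q_def by simp
  have "(1 + q) / (1 - q) = (1 + q) * cnj (1 - q) / (norm (1 - q))\<^sup>2"
    using complex_div_cnj by blast
  then have "Re ((1 + q) / (1 - q)) = Re ((1 + q) * cnj (1 - q)) / (norm (1 - q))\<^sup>2"
    by (metis Re_divide_of_real of_real_power)
  also have "Re ((1 + q) * cnj (1 - q)) = 1 - (norm q)\<^sup>2"
    unfolding cmod_power2 by (simp add: algebra_simps power2_eq_square)
  finally show ?thesis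
    unfolding atom_kernel_def q_def[symmetric]
    by (metis Re_divide_of_real nonzero_mult_div_cancel_left of_real_mult of_real_numeral
        pi_neq_zero times_divide_eq_right mult_eq_0_iff zero_neq_numeral)
qed

lemma Re_atom_kernel_pos: "0 < Im z \<Longrightarrow> 0 < Re (atom_kernel z)"
proof -
  assume a: "0 < Im z"
  have "0 < 2 * pi * Re (atom_kernel z)"
    unfolding Re_atom_kernel[OF a] using norm_exp_i_less_1[OF a] one_minus_exp_i(1)[OF a]
    by (intro divide_pos_pos) (auto simp: power_less_one_iff abs_square_less_1)
  then show ?thesis by (simp add: zero_less_mult_iff)
qed

text \<open>Both sides are explicit in \<open>p = exp (\<i> z)\<close> and \<open>q = exp (\<i> w)\<close>. The inequality
  with the geometric mean of the two quotients on the right is \<open>cosh_diff_le\<close>; the arithmetic mean is larger.\<close>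

lemma atom_kernel_two_point:
  assumes "0 < Im z" "0 < Im w"
  shows "norm (atom_kernel z - atom_kernel w) \<le>
    norm (z - w) * ((Re (atom_kernel z) / Im z + Re (atom_kernel w) / Im w) / 2)"
proof -
  define p q where "p = exp (\<i> * z)" and "q = exp (\<i> * w)"
  define P Q where "P = (1 - (norm p)\<^sup>2)" and "Q = (1 - (norm q)\<^sup>2)"
  define m n where "m = norm (1 - p)" and "n = norm (1 - q)"
  define b c where "b = Im z" and "c = Im w"
  have bc: "0 < b" "0 < c" using assms by (auto simp: b_def c_def)
  have np: "norm p = exp (- b)" "norm q = exp (- c)" by (auto simp: p_def q_def b_def c_def)
  have mn: "0 < m" "0 < n"
    using one_minus_exp_i(1) assms by (auto simp: m_def n_def p_def q_def)
  have PQ: "P = 2 * exp (-b) * sinh b" "Q = 2 * exp (-c) * sinh c"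
    by (auto simp: P_def Q_def np sinh_def power2_eq_square exp_minus field_simps)
  have PQ0: "0 < P" "0 < Q" using bc by (auto simp: PQ)
  have pq2: "(norm (p - q))\<^sup>2 = 2 * exp (-b) * exp (-c) * (cosh (b - c) - cos (Re z - Re w))"
  proof -
    have "p = of_real (exp (-b)) * cis (Re z)" "q = of_real (exp (-c)) * cis (Re w)"
      unfolding p_def q_def b_def c_def by (simp_all add: exp_eq_polar)
    then have "(norm (p - q))\<^sup>2 = (exp (-b) * cos (Re z) - exp (-c) * cos (Re w))\<^sup>2
        + (exp (-b) * sin (Re z) - exp (-c) * sin (Re w))\<^sup>2"
      by (simp add: cmod_power2)
    also have "\<dots> = (exp (-b))\<^sup>2 * ((cos (Re z))\<^sup>2 + (sin (Re z))\<^sup>2) + (exp (-c))\<^sup>2 * ((cos (Re w))\<^sup>2 + (sin (Re w))\<^sup>2)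
       - 2 * exp (-b) * exp (-c) * cos (Re z - Re w)"
      unfolding cos_diff by algebra
    also have "\<dots> = (exp (-b))\<^sup>2 + (exp (-c))\<^sup>2 - 2 * exp (-b) * exp (-c) * cos (Re z - Re w)"
      by (simp only: sin_cos_squared_add2 mult_1_right)
    also have "(exp (-b))\<^sup>2 + (exp (-c))\<^sup>2 = 2 * exp (-b) * exp (-c) * cosh (b - c)"
      by (simp add: cosh_def power2_eq_square exp_minus exp_diff field_simps)
    finally show ?thesis by (simp add: algebra_simps)
  qed
  have key: "4 * (norm (p - q))\<^sup>2 * (b * c) \<le> (norm (z - w))\<^sup>2 * (P * Q)"
  proof -
    have "4 * (norm (p - q))\<^sup>2 * (b * c)
        = 4 * exp (-b) * exp (-c) * (2 * (cosh (b - c) - cos (Re z - Re w)) * (b * c))"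
      by (simp add: pq2)
    also have "\<dots> \<le> 4 * exp (-b) * exp (-c) * (((Re z - Re w)\<^sup>2 + (b - c)\<^sup>2) * (sinh b * sinh c))"
      by (intro mult_left_mono cosh_diff_le bc) auto
    also have "\<dots> = (norm (z - w))\<^sup>2 * (P * Q)"
      by (simp add: PQ cmod_power2 b_def c_def)
    finally show ?thesis .
  qed
  have "(2 * norm (p - q) / (m * n))\<^sup>2 \<le> (norm (z - w))\<^sup>2 * ((P / m\<^sup>2 / b) * (Q / n\<^sup>2 / c))"
    using key mn bc by (simp add: power_divide power_mult_distrib field_simps)
  also have "\<dots> \<le> (norm (z - w))\<^sup>2 * ((P / m\<^sup>2 / b + Q / n\<^sup>2 / c) / 2)\<^sup>2"
  proof (intro mult_left_mono)
    show "P / m\<^sup>2 / b * (Q / n\<^sup>2 / c) \<le> ((P / m\<^sup>2 / b + Q / n\<^sup>2 / c) / 2)\<^sup>2"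
      using zero_le_power2[of "P / m\<^sup>2 / b - Q / n\<^sup>2 / c"]
      by (simp only: power2_eq_square) argo
  qed auto
  also have "\<dots> = (norm (z - w) * ((P / m\<^sup>2 / b + Q / n\<^sup>2 / c) / 2))\<^sup>2"
    by (simp only: power_mult_distrib)
  finally have 1: "2 * norm (p - q) / (m * n) \<le> norm (z - w) * ((P / m\<^sup>2 / b + Q / n\<^sup>2 / c) / 2)"
    by (rule power2_le_imp_le) (use PQ0 bc in auto)
  have "atom_kernel z - atom_kernel w = ((1 + p) / (1 - p) - (1 + q) / (1 - q)) / (2 * pi)"
    by (simp add: atom_kernel_def p_def q_def diff_divide_distrib)
  also have "(1 + p) / (1 - p) - (1 + q) / (1 - q) = 2 * (p - q) / ((1 - p) * (1 - q))"
    using mn by (simp add: m_def n_def field_simps)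
  finally have 2: "norm (atom_kernel z - atom_kernel w) = (2 * norm (p - q) / (m * n)) / (2 * pi)"
    by (simp add: m_def n_def norm_divide norm_mult del: right_diff_distrib_numeral)
  have 3: "Re (atom_kernel z) = P / m\<^sup>2 / (2 * pi)" "Re (atom_kernel w) = Q / n\<^sup>2 / (2 * pi)"
    using Re_atom_kernel[OF assms(1)] Re_atom_kernel[OF assms(2)]
    by (subst eq_divide_eq, simp add: P_def Q_def p_def q_def m_def n_def mult_ac)+
  have "norm (atom_kernel z - atom_kernel w) \<le> (norm (z - w) * ((P / m\<^sup>2 / b + Q / n\<^sup>2 / c) / 2)) / (2 * pi)"
    unfolding 2 by (intro divide_right_mono 1) auto
  also have "\<dots> = norm (z - w) * ((Re (atom_kernel z) / Im z + Re (atom_kernel w) / Im w) / 2)"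
    unfolding 3 using bc by (simp add: b_def[symmetric] c_def[symmetric] field_simps)
  finally show ?thesis .
qed

lemma herglotz_atom: "herglotz atom_kernel atom_primitive"
proof
  fix z :: complex assume z: "0 < Im z"
  define q where "q = exp (\<i> * z)"
  note q = one_minus_exp_i[OF z]
  have r: "norm q = exp (- Im z)" by (simp add: q_def)
  have "1 + Im z \<le> exp (Im z)" by simp
  then have r': "norm q \<le> 1 / (1 + Im z)"
    using z by (simp add: r exp_minus field_simps)
  have r1: "norm q < 1" using norm_exp_i_less_1[OF z] q_def by simp
  have n1: "norm (1 - q) \<ge> 1 - norm q" by (metis norm_one norm_triangle_ineq2)
  have n2: "norm (1 - q) \<le> 1 + norm q" by (metis norm_one norm_triangle_ineq4)
  show "(atom_primitive has_field_derivative atom_kernel z) (at z)"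
    unfolding atom_primitive_def[abs_def] atom_kernel_def
    by (rule derivative_eq_intros refl q(3) | use q(1) in \<open>simp add: field_simps\<close>)+
  have per: "exp (\<i> * (z + 2 * pi)) = exp (\<i> * z)"
    by (simp add: ring_distribs exp_add) (metis exp_two_pi_i' mult.commute mult.left_commute)
  then show "atom_kernel (z + 2 * pi) = atom_kernel z" by (simp add: atom_kernel_def)
  show "atom_primitive (z + 2 * pi) = atom_primitive z + 1"
    unfolding atom_primitive_def per by (simp add: add_divide_distrib)
  have "Im z / (Im z + 2) \<le> (1 - norm q) / (1 + norm q)"
  proof -
    have "Im z * (1 + norm q) \<le> (1 - norm q) * (Im z + 2)"
      using r' z by (simp add: field_simps)
    then show ?thesis using z by (simp add: field_simps add_pos_nonneg)
  qed
  also have "\<dots> = (1 - (norm q)\<^sup>2) / (1 + norm q)\<^sup>2"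
  proof -
    have "1 - (norm q)\<^sup>2 = (1 - norm q) * (1 + norm q)" by (simp add: power2_eq_square algebra_simps)
    moreover have "1 + norm q \<noteq> 0" using norm_ge_zero[of q] by linarith
    ultimately show ?thesis by (simp add: power2_eq_square)
  qed
  also have "\<dots> \<le> (1 - (norm q)\<^sup>2) / (norm (1 - q))\<^sup>2"
    using r1 n1 n2 by (intro divide_left_mono power_mono mult_pos_pos)
       (auto simp: abs_square_le_1 add_pos_nonneg)
  also have "\<dots> = 2 * pi * Re (atom_kernel z)" using Re_atom_kernel[OF z] q_def by simp
  finally show "Im z / (Im z + 2) / (2 * pi) \<le> Re (atom_kernel z)"
    by (subst pos_divide_le_eq) (simp_all add: mult_ac)
  have "atom_kernel z - 1 / (2 * pi) = q / (1 - q) / pi"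
    using q by (simp add: atom_kernel_def q_def field_simps)
  then have "norm (atom_kernel z - 1 / (2 * pi)) = norm q / norm (1 - q) / pi"
    by (simp add: norm_divide norm_mult)
  also have "\<dots> \<le> 1 / Im z / pi"
  proof (intro divide_right_mono)
    have "norm q * Im z \<le> 1 - norm q" using r' z by (simp add: field_simps)
    then show "norm q / norm (1 - q) \<le> 1 / Im z"
      using n1 r1 z by (simp add: divide_le_eq le_divide_eq)
  qed auto
  finally show "norm (atom_kernel z - 1 / (2 * pi)) \<le> 1 / (pi * Im z)"
    by (simp add: mult.commute)
  fix w :: complex assume w: "0 < Im w"
  show "norm (atom_kernel z - atom_kernel w) \<le>
    norm (z - w) * ((Re (atom_kernel z) / Im z + Re (atom_kernel w) / Im w) / 2)"
    by (rule atom_kernel_two_point[OF z w])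
qed

lemma herglotz_combination:
  fixes c y :: "'i \<Rightarrow> real" and f P :: "complex \<Rightarrow> complex"
  assumes "finite I" "\<And>i. i \<in> I \<Longrightarrow> 0 \<le> c i" "sum c I = 1" "herglotz f P"
  shows "herglotz (\<lambda>z. \<Sum>i\<in>I. c i * f (z - y i)) (\<lambda>z. (\<Sum>i\<in>I. c i * P (z - y i)) + A)"
proof -
  interpret h: herglotz f P by fact
  have sc: "(\<Sum>i\<in>I. complex_of_real (c i)) = 1"
    using assms(3) by (metis of_real_1 of_real_sum)
  show ?thesis
  proof
    fix z :: complex assume z: "0 < Im z"
    have zi: "0 < Im (z - y i)" for i using z by simp
    have d: "((\<lambda>z. c i * P (z - y i)) has_field_derivative c i * f (z - y i)) (at z)" for i
      using DERIV_shift[of P "f (z - y i)" z "- y i"] h.P0_deriv[OF zi[of i]] 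
      by (auto intro!: derivative_eq_intros)
    show "((\<lambda>z. (\<Sum>i\<in>I. c i * P (z - y i)) + A) has_field_derivative (\<Sum>i\<in>I. c i * f (z - y i))) (at z)"
      using DERIV_add[OF DERIV_sum[of I, OF d] DERIV_const[of A]] by simp
    have e: "z + 2 * pi - y i = (z - y i) + 2 * pi" for i by simp
    show "(\<Sum>i\<in>I. c i * f (z + 2 * pi - y i)) = (\<Sum>i\<in>I. c i * f (z - y i))"
      unfolding e by (intro sum.cong refl) (simp add: h.f0_periodic[OF zi] del: of_real_mult)
    have "(\<Sum>i\<in>I. c i * P (z + 2 * pi - y i)) = (\<Sum>i\<in>I. c i * P (z - y i) + c i)"
      unfolding e
      by (intro sum.cong refl) (subst h.P0_periodic[OF zi], simp add: algebra_simps)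
    then show "(\<Sum>i\<in>I. c i * P (z + 2 * pi - y i)) + A = (\<Sum>i\<in>I. c i * P (z - y i)) + A + 1"
      by (simp add: sum.distrib sc)
    have "Im z / (Im z + 2) / (2 * pi) = (\<Sum>i\<in>I. c i * (Im z / (Im z + 2) / (2 * pi)))"
      using assms(3) by (simp only: sum_distrib_right[symmetric])
    also have "\<dots> \<le> (\<Sum>i\<in>I. c i * Re (f (z - y i)))"
      using h.f0_lower[OF zi] by (intro sum_mono mult_left_mono assms) auto
    finally show "Im z / (Im z + 2) / (2 * pi) \<le> Re (\<Sum>i\<in>I. c i * f (z - y i))" by simp
    have "(\<Sum>i\<in>I. c i * f (z - y i)) - 1 / (2 * pi) = (\<Sum>i\<in>I. c i * (f (z - y i) - 1 / (2 * pi)))"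
      by (simp add: ring_distribs sum_subtractf sc sum_divide_distrib[symmetric])
    also have "norm \<dots> \<le> (\<Sum>i\<in>I. c i * (1 / (pi * Im z)))"
    proof (rule sum_norm_le)
      fix i assume "i \<in> I"
      then show "norm (complex_of_real (c i) * (f (z - y i) - 1 / (2 * pi))) \<le> c i * (1 / (pi * Im z))"
        using h.f0_near[OF zi[of i]] assms(2)[of i]
        by (simp only: norm_mult norm_of_real abs_of_nonneg) (intro mult_left_mono, auto)
    qed
    also have "\<dots> = 1 / (pi * Im z)" using assms(3) by (simp only: sum_distrib_right[symmetric])
    finally show "norm ((\<Sum>i\<in>I. c i * f (z - y i)) - 1 / (2 * pi)) \<le> 1 / (pi * Im z)" .
    fix w :: complex assume w: "0 < Im w"
    have wi: "0 < Im (w - y i)" for i using w by simp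
    have "(\<Sum>i\<in>I. c i * f (z - y i)) - (\<Sum>i\<in>I. c i * f (w - y i)) = (\<Sum>i\<in>I. c i * (f (z - y i) - f (w - y i)))"
      by (simp add: sum_subtractf ring_distribs)
    also have "norm \<dots> \<le> (\<Sum>i\<in>I. c i * (norm (z - w) * ((Re (f (z - y i)) / Im z + Re (f (w - y i)) / Im w) / 2)))"
    proof (rule sum_norm_le)
      fix i assume "i \<in> I"
      then show "norm (complex_of_real (c i) * (f (z - y i) - f (w - y i)))
          \<le> c i * (norm (z - w) * ((Re (f (z - y i)) / Im z + Re (f (w - y i)) / Im w) / 2))"
        using h.f0_two_point[OF zi[of i] wi[of i]] assms(2)[of i]
        by (simp only: norm_mult norm_of_real abs_of_nonneg) (intro mult_left_mono, auto)
    qed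
    also have "\<dots> = norm (z - w) * (((\<Sum>i\<in>I. c i * Re (f (z - y i))) / Im z + (\<Sum>i\<in>I. c i * Re (f (w - y i))) / Im w) / 2)"
      by (simp add: sum_distrib_left sum_divide_distrib sum.distrib[symmetric] algebra_simps add_divide_distrib)
    finally show "norm ((\<Sum>i\<in>I. c i * f (z - y i)) - (\<Sum>i\<in>I. c i * f (w - y i))) \<le> norm (z - w) *
        ((Re (\<Sum>i\<in>I. c i * f (z - y i)) / Im z + Re (\<Sum>i\<in>I. c i * f (w - y i)) / Im w) / 2)"
      by simp
  qed
qed

section \<open>Characteristics of the complex Burgers equation\<close>

text \<open>Caratheodory's form of differentiability, for a linear map times a factor that is merely continuous
  at the point. This is how the implicit equation for characteristics is differentiated: the factor
  contains the unknown function itself, for which only continuity is known beforehand.\<close>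

lemma has_derivative_from_factor:
  fixes f :: "'a::real_normed_vector \<Rightarrow> 'b::real_normed_algebra"
  assumes L: "bounded_linear L"
    and eq: "\<forall>\<^sub>F y in at x. f y - f x = L (y - x) * A y"
    and A: "isCont A x"
  shows "(f has_derivative (\<lambda>h. L h * A x)) (at x)"
proof -
  from L obtain K where K: "0 < K" "\<And>h. norm (L h) \<le> norm h * K"
    using bounded_linear.pos_bounded by metis
  have bl: "bounded_linear (\<lambda>h. L h * A x)"
    using bounded_linear_compose[OF bounded_linear_mult_left L] by simp
  have "((\<lambda>y. norm ((f y - f x) - L (y - x) * A x) / norm (y - x)) \<longlongrightarrow> 0) (at x)"
  proof (rule tendsto_sandwich[OF _ _ tendsto_const])
    show "\<forall>\<^sub>F y in at x. 0 \<le> norm ((f y - f x) - L (y - x) * A x) / norm (y - x)" by simp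
    show "\<forall>\<^sub>F y in at x. norm ((f y - f x) - L (y - x) * A x) / norm (y - x) \<le> K * norm (A y - A x)"
      using eq eventually_neq_at_within[of x x]
    proof eventually_elim
      case (elim y)
      have "norm ((f y - f x) - L (y - x) * A x) = norm (L (y - x) * (A y - A x))"
        using elim by (simp add: algebra_simps)
      also have "\<dots> \<le> norm (L (y - x)) * norm (A y - A x)" by (rule norm_mult_ineq)
      also have "\<dots> \<le> (norm (y - x) * K) * norm (A y - A x)" by (intro mult_right_mono K) auto
      finally show ?case using elim(2) by (simp add: divide_le_eq mult_ac)
    qed
    have "((\<lambda>y. norm (A y - A x)) \<longlongrightarrow> 0) (at x)"
      using A unfolding isCont_def by (intro tendsto_norm_zero) (simp add: LIM_zero)
    then show "((\<lambda>y. K * norm (A y - A x)) \<longlongrightarrow> 0) (at x)"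
      by (rule tendsto_mult_right_zero)
  qed
  with bl show ?thesis by (simp add: has_derivative_iff_norm)
qed

abbreviation upper_half_plane :: "complex set" where
  "upper_half_plane \<equiv> {z. 0 < Im z}"

lemma open_upper_half_plane: "open upper_half_plane"
  by (rule open_halfspace_Im_gt)

context herglotz
begin

lemma P0_holomorphic: "P0 holomorphic_on upper_half_plane"
  using P0_deriv open_upper_half_plane by (auto simp: holomorphic_on_open)

lemma f0_holomorphic: "f0 holomorphic_on upper_half_plane"
proof -
  have "deriv P0 holomorphic_on upper_half_plane"
    by (intro holomorphic_deriv P0_holomorphic open_upper_half_plane)
  then show ?thesis
    by (rule holomorphic_transform) (simp add: DERIV_imp_deriv P0_deriv)
qed

lemma f0_deriv: "0 < Im z \<Longrightarrow> (f0 has_field_derivative deriv f0 z) (at z)"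
  using holomorphic_derivI[OF f0_holomorphic open_upper_half_plane] by simp

lemma Re_f0_pos: "0 < Im z \<Longrightarrow> 0 < Re (f0 z)"
  using f0_lower[of z] by (smt (verit) divide_pos_pos pi_gt_zero)

definition f0_bound :: "real \<Rightarrow> real" where
  "f0_bound h = 1 / (2 * pi) + 1 / (pi * h)"

lemma f0_bound_pos: "0 < h \<Longrightarrow> 0 < f0_bound h"
  unfolding f0_bound_def by (intro add_pos_pos divide_pos_pos) auto

lemma norm_f0_le:
  assumes "0 < h" "h \<le> Im z"
  shows "norm (f0 z) \<le> f0_bound h"
proof -
  have "norm (f0 z) \<le> norm (1 / (2 * complex_of_real pi)) + norm (f0 z - 1 / (2 * pi))"
    using norm_triangle_sub[of "f0 z" "1 / (2 * complex_of_real pi)"] by simp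
  also have "norm (f0 z - 1 / (2 * pi)) \<le> 1 / (pi * Im z)"
    using f0_near[of z] assms by simp
  also have "1 / (pi * Im z) \<le> 1 / (pi * h)"
    using assms by (intro divide_left_mono mult_left_mono mult_pos_pos) auto
  also have "norm (1 / (2 * complex_of_real pi)) = 1 / (2 * pi)"
    by (simp add: norm_divide norm_mult)
  finally show ?thesis by (simp add: f0_bound_def)
qed

text \<open>The infinitesimal version of the two-point estimate.\<close>

lemma norm_deriv_f0_le:
  assumes "0 < Im z"
  shows "norm (deriv f0 z) \<le> Re (f0 z) / Im z"
proof -
  have c: "isCont f0 z" using DERIV_isCont[OF f0_deriv[OF assms]] .
  have "((\<lambda>w. norm ((f0 w - f0 z) / (w - z))) \<longlongrightarrow> norm (deriv f0 z)) (at z)"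
    using f0_deriv[OF assms] unfolding has_field_derivative_iff by (rule tendsto_norm)
  moreover have "((\<lambda>w. (Re (f0 w) / Im w + Re (f0 z) / Im z) / 2)
      \<longlongrightarrow> (Re (f0 z) / Im z + Re (f0 z) / Im z) / 2) (at z)"
    using c assms unfolding isCont_def by (intro tendsto_intros) auto
  moreover have "\<forall>\<^sub>F w in at z. norm ((f0 w - f0 z) / (w - z)) \<le> (Re (f0 w) / Im w + Re (f0 z) / Im z) / 2"
  proof -
    have "\<forall>\<^sub>F w in at z. w \<in> upper_half_plane"
      using eventually_at_in_open'[OF open_upper_half_plane] assms by blast
    then show ?thesis using eventually_neq_at_within[of z z]
    proof eventually_elim
      case (elim w)
      then show ?case using f0_two_point[of w z] assms
        by (simp add: norm_divide divide_le_eq mult.commute)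
    qed
  qed
  ultimately have "norm (deriv f0 z) \<le> (Re (f0 z) / Im z + Re (f0 z) / Im z) / 2"
    by (intro tendsto_le[OF trivial_limit_at])
  then show ?thesis by simp
qed

text \<open>Brouwer's fixed point theorem: since \<open>f0\<close> has positive real part, the map \<open>w \<mapsto> z + \<i> t f0 w\<close>
  takes values at height at least \<open>Im z\<close>, where \<open>f0\<close> is bounded.\<close>

lemma characteristic_exists:
  fixes t :: real
  assumes t: "0 \<le> t" and z: "0 < Im z"
  shows "\<exists>\<zeta>. 0 < Im \<zeta> \<and> \<zeta> = z + \<i> * t * f0 \<zeta>"
proof -
  define B where "B = f0_bound (Im z)"
  define S where "S = cball z (t * B) \<inter> {w. Im z \<le> Im w}"
  have B: "0 < B" using f0_bound_pos z B_def by simp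
  have "closed {w. Im z \<le> Im w}" using closed_halfspace_Im_ge[of "Im z"] by simp
  then have cS: "compact S" unfolding S_def by (intro compact_Int_closed compact_cball)
  have "convex {w. Im z \<le> Im w}" using convex_halfspace_Im_ge[of "Im z"] by simp
  then have vS: "convex S" unfolding S_def by (intro convex_Int convex_cball)
  have "z \<in> S" using B t by (simp add: S_def)
  then have nS: "S \<noteq> {}" by blast
  have SH: "S \<subseteq> upper_half_plane" using z by (auto simp: S_def)
  have cont: "continuous_on S (\<lambda>w. z + \<i> * t * f0 w)"
    by (intro continuous_intros continuous_on_subset[OF holomorphic_on_imp_continuous_on[OF f0_holomorphic] SH])
  have "(\<lambda>w. z + \<i> * t * f0 w) \<in> S \<rightarrow> S"
  proof
    fix w assume w: "w \<in> S"
    then have "0 < Im w" "Im z \<le> Im w" using z by (auto simp: S_def)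
    then have "0 \<le> Re (f0 w)" "norm (f0 w) \<le> B"
      using Re_f0_pos[of w] norm_f0_le[OF z] by (auto simp: B_def less_imp_le)
    then show "z + \<i> * t * f0 w \<in> S"
      using t by (auto simp: S_def dist_norm norm_mult intro!: mult_left_mono)
  qed
  then obtain \<zeta> where "\<zeta> \<in> S" "z + \<i> * t * f0 \<zeta> = \<zeta>"
    using brouwer[OF cS vS nS cont] by (metis image_subset_iff_funcset)
  then show ?thesis using SH by (intro exI[of _ \<zeta>]) auto
qed

text \<open>Uniqueness and continuity of characteristics at once. For two characteristic points, the factor
  in the two-point estimate is the mean of two quotients of the form \<open>t u / b\<close>, where \<open>b = Im z + t u\<close>
  is strictly larger than \<open>t u\<close>; so the map is a strict contraction between them.\<close>

lemma characteristic_stable: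
  fixes h T :: real
  assumes T: "0 < h" "0 < T"
  obtains d L where "0 < d" "0 < L"
    "\<And>(s::real) (t::real) z w \<zeta> \<omega>. \<lbrakk>0 \<le> t; t \<le> T; 0 \<le> s; s \<le> T; \<bar>t - s\<bar> \<le> d; h \<le> Im z; h \<le> Im w;
      0 < Im \<zeta>; \<zeta> = z + \<i> * t * f0 \<zeta>; 0 < Im \<omega>; \<omega> = w + \<i> * s * f0 \<omega>\<rbrakk>
      \<Longrightarrow> norm (\<zeta> - \<omega>) \<le> L * (norm (z - w) + \<bar>t - s\<bar>)"
proof -
  define B where "B = f0_bound h"
  have B: "0 < B" using f0_bound_pos T B_def by simp
  define \<theta> where "\<theta> = T * B / (h + T * B)"
  have hTB: "0 < h + T * B" using T B by (intro add_pos_pos mult_pos_pos)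
  have th: "\<theta> < 1" using T B hTB by (simp add: \<theta>_def)
  define d where "d = (1 - \<theta>) * h / B"
  define L where "L = 2 * (1 + B) / (1 - \<theta>)"
  show ?thesis
  proof (rule that[of d L])
    show "0 < d" using th T B by (simp add: d_def)
    show "0 < L" using th B by (simp add: L_def)
    fix s t :: real and z w \<zeta> \<omega> :: complex
    assume a: "0 \<le> t" "t \<le> T" "0 \<le> s" "s \<le> T" "\<bar>t - s\<bar> \<le> d" "h \<le> Im z" "h \<le> Im w"
      and \<zeta>: "0 < Im \<zeta>" "\<zeta> = z + \<i> * t * f0 \<zeta>" and \<omega>: "0 < Im \<omega>" "\<omega> = w + \<i> * s * f0 \<omega>"
    \<comment> \<open>The quotient \<open>r u / (Im y + r u)\<close> is largest for the largest \<open>r u\<close> and the smallest \<open>Im y\<close>.\<close>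
    have r: "r * Re (f0 \<xi>) / Im \<xi> \<le> \<theta> \<and> h \<le> Im \<xi> \<and> Re (f0 \<xi>) / Im \<xi> \<le> B / h \<and> norm (f0 \<xi>) \<le> B"
      if "0 \<le> r" "r \<le> T" "h \<le> Im y" "0 < Im \<xi>" "\<xi> = y + \<i> * r * f0 \<xi>" for r y \<xi>
    proof -
      define u where "u = Re (f0 \<xi>)"
      have "Im \<xi> = Im (y + \<i> * r * f0 \<xi>)" using that(5) by simp
      then have I: "Im \<xi> = Im y + r * u" by (simp add: u_def)
      have u: "0 < u" using Re_f0_pos[OF that(4)] u_def by simp
      then have hI: "h \<le> Im \<xi>" using I that by (smt (verit) mult_nonneg_nonneg)
      then have nB: "norm (f0 \<xi>) \<le> B" unfolding B_def using norm_f0_le T by blast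
      then have uB: "u \<le> B" using complex_Re_le_cmod[of "f0 \<xi>"] u_def by linarith
      have "r * u \<le> T * B" using that u uB by (intro mult_mono) auto
      then have "r * u * h \<le> T * B * Im y"
        by (rule mult_mono) (use T B that u in auto)
      then have "r * u / (Im y + r * u) \<le> \<theta>"
        using I that(4) hTB unfolding \<theta>_def by (simp add: divide_le_eq le_divide_eq algebra_simps)
      moreover have "u / Im \<xi> \<le> B / h" using uB hI T B u by (intro frac_le) auto
      ultimately show ?thesis using I hI nB by (simp add: u_def)
    qed
    note r1 = r[OF a(1,2,6) \<zeta>] and r2 = r[OF a(3,4,7) \<omega>]
    \<comment> \<open>The quotient at \<open>\<omega>\<close> is controlled for the time \<open>s\<close>, not \<open>t\<close>; the radius \<open>d\<close> is chosen so that
    the difference costs at most \<open>1 - \<theta>\<close>.\<close>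
    have "t * (Re (f0 \<omega>) / Im \<omega>) = s * Re (f0 \<omega>) / Im \<omega> + (t - s) * (Re (f0 \<omega>) / Im \<omega>)"
      by (simp add: left_diff_distrib diff_divide_distrib)
    also have "\<dots> \<le> \<theta> + d * (B / h)"
      using r2 a(5) Re_f0_pos[OF \<omega>(1)] \<omega>(1) T B by (intro add_mono mult_mono) (auto simp: d_def)
    also have "d * (B / h) = 1 - \<theta>" using T B by (simp add: d_def)
    finally have t2: "t * (Re (f0 \<omega>) / Im \<omega>) \<le> 1" by simp
    have "\<zeta> - \<omega> = (z - w) + \<i> * (t - s) * f0 \<omega> + \<i> * t * (f0 \<zeta> - f0 \<omega>)"
      by (subst \<zeta>(2), subst \<omega>(2)) (simp add: algebra_simps)
    also have "norm \<dots> \<le> norm (z - w) + norm (\<i> * (t - s) * f0 \<omega>) + norm (\<i> * t * (f0 \<zeta> - f0 \<omega>))"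
      by norm
    also have "norm (\<i> * (t - s) * f0 \<omega>) \<le> \<bar>t - s\<bar> * B"
      using r2 by (auto simp: norm_mult intro!: mult_left_mono simp flip: of_real_diff)
    also have "norm (\<i> * t * (f0 \<zeta> - f0 \<omega>)) \<le> t * (norm (\<zeta> - \<omega>) * ((Re (f0 \<zeta>) / Im \<zeta> + Re (f0 \<omega>) / Im \<omega>) / 2))"
      using mult_left_mono[OF f0_two_point[OF \<zeta>(1) \<omega>(1)] a(1)] a(1) by (simp add: norm_mult mult.assoc)
    also have "\<dots> = norm (\<zeta> - \<omega>) * ((t * Re (f0 \<zeta>) / Im \<zeta> + t * (Re (f0 \<omega>) / Im \<omega>)) / 2)"
      by (simp add: algebra_simps)
    also have "\<dots> \<le> norm (\<zeta> - \<omega>) * ((\<theta> + 1) / 2)"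
      using r1 t2 by (intro mult_left_mono divide_right_mono add_mono) auto
    finally have "norm (\<zeta> - \<omega>) * ((1 - \<theta>) / 2) \<le> norm (z - w) + \<bar>t - s\<bar> * B"
      by (simp add: algebra_simps) argo
    also have "\<dots> \<le> (1 + B) * (norm (z - w) + \<bar>t - s\<bar>)" using B by (simp add: algebra_simps)
    finally show "norm (\<zeta> - \<omega>) \<le> L * (norm (z - w) + \<bar>t - s\<bar>)"
      using th by (simp add: L_def field_simps)
  qed
qed

definition characteristic :: "real \<Rightarrow> complex \<Rightarrow> complex" where
  "characteristic t z = (SOME \<zeta>. 0 < Im \<zeta> \<and> \<zeta> = z + \<i> * t * f0 \<zeta>)"

lemma characteristic:
  assumes "0 \<le> t" "0 < Im z"
  shows "0 < Im (characteristic t z)"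
    and characteristic_eq: "characteristic t z = z + \<i> * t * f0 (characteristic t z)"
  using someI_ex[OF characteristic_exists[OF assms]] unfolding characteristic_def by blast+

lemma characteristic_unique:
  assumes "0 \<le> t" "0 < Im z" "0 < Im \<zeta>" "\<zeta> = z + \<i> * t * f0 \<zeta>"
  shows "characteristic t z = \<zeta>"
proof -
  obtain d L where dL: "0 < d" "0 < L"
    "\<And>(s::real) (t'::real) z' w \<zeta> \<omega>. \<lbrakk>0 \<le> t'; t' \<le> t + 1; 0 \<le> s; s \<le> t + 1; \<bar>t' - s\<bar> \<le> d; Im z \<le> Im z'; Im z \<le> Im w;
      0 < Im \<zeta>; \<zeta> = z' + \<i> * t' * f0 \<zeta>; 0 < Im \<omega>; \<omega> = w + \<i> * s * f0 \<omega>\<rbrakk>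
      \<Longrightarrow> norm (\<zeta> - \<omega>) \<le> L * (norm (z' - w) + \<bar>t' - s\<bar>)"
    using characteristic_stable[of "Im z" "t + 1"] assms by (metis add_nonneg_pos zero_less_one)
  have "norm (characteristic t z - \<zeta>) \<le> L * (norm (z - z) + \<bar>t - t\<bar>)"
    using characteristic[OF assms(1,2)] assms dL(1) by (intro dL(3)[of t t z z]) auto
  then show ?thesis by simp
qed

lemma Im_characteristic:
  assumes "0 \<le> t" "0 < Im z"
  shows "Im (characteristic t z) = Im z + t * Re (f0 (characteristic t z))"
  using arg_cong[OF characteristic_eq[OF assms], of Im] by simp

lemma Im_characteristic_ge:
  assumes "0 \<le> t" "0 < Im z"
  shows "Im z \<le> Im (characteristic t z)"
  using Im_characteristic[OF assms] Re_f0_pos[OF characteristic(1)[OF assms]] assms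
  by (smt (verit) mult_nonneg_nonneg)

lemma characteristic_periodic:
  assumes "0 \<le> t" "0 < Im z"
  shows "characteristic t (z + 2 * pi) = characteristic t z + 2 * pi"
proof (rule characteristic_unique)
  note c = characteristic[OF assms]
  show "characteristic t z + 2 * pi = z + 2 * pi + \<i> * t * f0 (characteristic t z + 2 * pi)"
    using c f0_periodic[OF c(1)] by simp
qed (use assms characteristic[OF assms] in auto)

lemma isCont_characteristic:
  assumes "0 < t" "0 < Im z"
  shows "isCont (\<lambda>p. characteristic (fst p) (snd p)) (t, z)"
proof -
  obtain d L where dL: "0 < d" "0 < L"
    "\<And>(s::real) (t'::real) z' w \<zeta> \<omega>. \<lbrakk>0 \<le> t'; t' \<le> 2 * t; 0 \<le> s; s \<le> 2 * t; \<bar>t' - s\<bar> \<le> d; Im z / 2 \<le> Im z'; Im z / 2 \<le> Im w;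
      0 < Im \<zeta>; \<zeta> = z' + \<i> * t' * f0 \<zeta>; 0 < Im \<omega>; \<omega> = w + \<i> * s * f0 \<omega>\<rbrakk>
      \<Longrightarrow> norm (\<zeta> - \<omega>) \<le> L * (norm (z' - w) + \<bar>t' - s\<bar>)"
    using characteristic_stable[of "Im z / 2" "2 * t"] assms by (metis half_gt_zero mult_pos_pos zero_less_numeral)
  have op: "open ({0<..<2 * t} \<times> {w. Im z / 2 < Im w})"
    by (intro open_Times open_greaterThanLessThan open_halfspace_Im_gt)
  have "\<forall>\<^sub>F p in at (t, z). p \<in> {0<..<2 * t} \<times> {w. Im z / 2 < Im w}"
    using assms by (intro eventually_at_in_open'[OF op]) auto
  moreover have "\<forall>\<^sub>F p in at (t, z). dist (fst p) t < d"
  proof -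
    have "((\<lambda>p. fst p) \<longlongrightarrow> fst (t, z)) (at (t, z))" by (intro tendsto_intros)
    then show ?thesis using dL(1) tendstoD by fastforce
  qed
  ultimately have "\<forall>\<^sub>F p in at (t, z). norm (characteristic (fst p) (snd p) - characteristic t z)
      \<le> L * (norm (snd p - z) + \<bar>fst p - t\<bar>)"
  proof eventually_elim
    case (elim p)
    obtain t' z' where p: "p = (t', z')" by fastforce
    have "0 < Im z'" using elim assms by (auto simp: p)
    then have "norm (characteristic t' z' - characteristic t z) \<le> L * (norm (z' - z) + \<bar>t' - t\<bar>)"
      using elim assms characteristic[of t' z'] characteristic[of t z]
      by (intro dL(3)[of t' t z' z]) (auto simp: p dist_real_def)
    then show ?case by (simp add: p)
  qed
  moreover have "((\<lambda>p. L * (norm (snd p - z) + \<bar>fst p - t\<bar>)) \<longlongrightarrow> L * (norm (snd (t, z) - z) + \<bar>fst (t, z) - t\<bar>)) (at (t, z))"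
    by (intro tendsto_intros)
  then have "((\<lambda>p. L * (norm (snd p - z) + \<bar>fst p - t\<bar>)) \<longlongrightarrow> 0) (at (t, z))" by simp
  ultimately have "((\<lambda>p. characteristic (fst p) (snd p) - characteristic t z) \<longlongrightarrow> 0) (at (t, z))"
    by (rule Lim_null_comparison)
  from LIM_zero_cancel[OF this] show ?thesis by (simp add: isCont_def)
qed

text \<open>The derivative of the characteristic with respect to \<open>z\<close>.\<close>

definition dilation :: "real \<Rightarrow> complex \<Rightarrow> complex" where
  "dilation t z = 1 / (1 - \<i> * t * deriv f0 (characteristic t z))"

lemma dilation_denominator:
  assumes "0 \<le> t" "0 < Im z"
  shows "1 - \<i> * t * deriv f0 (characteristic t z) \<noteq> 0"
proof
  define \<zeta> where "\<zeta> = characteristic t z"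
  have I: "0 < Im \<zeta>" "Im \<zeta> = Im z + t * Re (f0 \<zeta>)"
    using characteristic(1)[OF assms] Im_characteristic[OF assms] \<zeta>_def by auto
  assume "1 - \<i> * t * deriv f0 (characteristic t z) = 0"
  then have "norm (\<i> * t * deriv f0 \<zeta>) = norm (1 :: complex)" by (simp add: \<zeta>_def)
  then have "1 = t * norm (deriv f0 \<zeta>)" using assms by (simp add: norm_mult)
  also have "\<dots> \<le> t * (Re (f0 \<zeta>) / Im \<zeta>)"
    using norm_deriv_f0_le[OF I(1)] assms by (intro mult_left_mono) auto
  finally have "Im \<zeta> \<le> t * Re (f0 \<zeta>)" using I(1) by (simp add: le_divide_eq)
  then show False using I(2) assms by simp
qed

text \<open>Implicit differentiation of \<open>\<zeta> = z + \<i> t f0 \<zeta>\<close>.\<close>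

lemma characteristic_has_derivative:
  assumes "0 < t" "0 < Im z"
  shows "((\<lambda>p. characteristic (fst p) (snd p)) has_derivative
    (\<lambda>(a, b). (b + a *\<^sub>R (\<i> * f0 (characteristic t z))) * dilation t z)) (at (t, z))"
proof -
  define \<zeta> where "\<zeta> = characteristic t z"
  have \<zeta>: "0 < Im \<zeta>" using characteristic(1)[of t z] assms \<zeta>_def by simp
  obtain q where q: "\<And>w. f0 w - f0 \<zeta> = q w * (w - \<zeta>)" "isCont q \<zeta>" "q \<zeta> = deriv f0 \<zeta>"
    using f0_deriv[OF \<zeta>] unfolding CARAT_DERIV by blast
  define L where "L = (\<lambda>p :: real \<times> complex. snd p + fst p *\<^sub>R (\<i> * f0 \<zeta>))"
  define A where "A = (\<lambda>p :: real \<times> complex. 1 / (1 - \<i> * complex_of_real (fst p) * q (characteristic (fst p) (snd p))))"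
  have L: "bounded_linear L" unfolding L_def
    by (intro bounded_linear_add bounded_linear_snd bounded_linear_fst[THEN bounded_linear_scaleR_const])
  have cq: "isCont (\<lambda>p. q (characteristic (fst p) (snd p))) (t, z)"
    using isCont_o2[OF isCont_characteristic[OF assms], of q] q(2) by (simp add: \<zeta>_def)
  have ne: "1 - \<i> * complex_of_real (fst (t, z)) * q (characteristic t z) \<noteq> 0"
    using dilation_denominator[of t z] assms by (simp add: q(3) \<zeta>_def[symmetric])
  have cA: "isCont A (t, z)" unfolding A_def
    by (intro continuous_intros cq) (use ne in simp)
  have "((\<lambda>p :: real \<times> complex. 1 - \<i> * complex_of_real (fst p) * q (characteristic (fst p) (snd p))) \<longlongrightarrow> 1 - \<i> * complex_of_real (fst (t, z)) * q (characteristic t z)) (at (t, z))"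
    using cq unfolding isCont_def by (intro tendsto_intros) auto
  then have ev1: "\<forall>\<^sub>F p in at (t, z). 1 - \<i> * complex_of_real (fst p) * q (characteristic (fst p) (snd p)) \<noteq> 0"
    using tendsto_imp_eventually_ne ne by blast
  have op: "open ({0::real<..} \<times> upper_half_plane)"
    by (intro open_Times open_greaterThan open_upper_half_plane)
  have ev2: "\<forall>\<^sub>F p in at (t, z). p \<in> {0<..} \<times> upper_half_plane"
    using assms by (intro eventually_at_in_open'[OF op]) auto
  from ev1 ev2 have "\<forall>\<^sub>F p in at (t, z). characteristic (fst p) (snd p) - characteristic t z
      = L (p - (t, z)) * A p"
  proof eventually_elim
    case (elim p)
    obtain t' z' where p: "p = (t', z')" by fastforce
    define \<omega> where "\<omega> = characteristic t' z'"
    have "\<omega> = z' + \<i> * t' * f0 \<omega>" "\<zeta> = z + \<i> * t * f0 \<zeta>"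
      using elim assms characteristic_eq[of t' z'] characteristic_eq[of t z] by (auto simp: p \<omega>_def \<zeta>_def)
    then have "\<omega> - \<zeta> = (z' - z) + \<i> * (t' - t) * f0 \<zeta> + \<i> * t' * (f0 \<omega> - f0 \<zeta>)"
      by (simp add: algebra_simps)
    then have "(\<omega> - \<zeta>) * (1 - \<i> * t' * q \<omega>) = (z' - z) + (t' - t) *\<^sub>R (\<i> * f0 \<zeta>)"
      by (simp add: q(1) algebra_simps scaleR_conv_of_real)
    then show ?case using elim(1)
      by (simp add: p \<omega>_def[symmetric] \<zeta>_def[symmetric] A_def L_def field_simps)
  qed
  then have "((\<lambda>p. characteristic (fst p) (snd p)) has_derivative (\<lambda>h. L h * A (t, z))) (at (t, z))"
    by (intro has_derivative_from_factor[OF L _ cA]) simp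
  then show ?thesis
    by (simp add: L_def A_def dilation_def \<zeta>_def[symmetric] q(3) case_prod_beta')
qed

end

context herglotz
begin

lemma characteristic_line_has_derivative:
  assumes "0 < fst p" "0 < Im z0"
  shows "((\<lambda>p. characteristic (fst p) (of_real (snd p) + z0)) has_derivative
    (\<lambda>(a, b). (of_real b + of_real a * (\<i> * f0 (characteristic (fst p) (of_real (snd p) + z0))))
       * dilation (fst p) (of_real (snd p) + z0))) (at p)"
proof -
  have 1: "((\<lambda>p::real \<times> real. (fst p, of_real (snd p) + z0)) has_derivative (\<lambda>h. (fst h, of_real (snd h)))) (at p)"
    by (auto intro!: derivative_eq_intros)
  have 2: "0 < Im (of_real (snd p) + z0)" using assms by simp
  show ?thesis
    using has_derivative_compose[OF 1 characteristic_has_derivative[OF assms(1) 2]]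
    by (simp add: case_prod_beta' scaleR_conv_of_real)
qed

text \<open>The functions on the line of height \<open>Im z0\<close> that arise by differentiating holomorphic functions of the
  characteristic point. The class is closed under partial derivatives, which yields smoothness of every
  order by a simple induction, without formulas for higher derivatives.\<close>

inductive jet :: "complex \<Rightarrow> (real \<times> real \<Rightarrow> complex) \<Rightarrow> bool" for z0 where
  jet_holomorphic: "g holomorphic_on upper_half_plane \<Longrightarrow>
    jet z0 (\<lambda>p. g (characteristic (fst p) (of_real (snd p) + z0)))"
| jet_time: "jet z0 (\<lambda>p. of_real (fst p))"
| jet_dilation: "jet z0 (\<lambda>p. dilation (fst p) (of_real (snd p) + z0))"
| jet_add: "jet z0 g \<Longrightarrow> jet z0 h \<Longrightarrow> jet z0 (\<lambda>p. g p + h p)"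
| jet_mult: "jet z0 g \<Longrightarrow> jet z0 h \<Longrightarrow> jet z0 (\<lambda>p. g p * h p)"

lemma jet_const: "jet z0 (\<lambda>p. c)"
  using jet_holomorphic[of "\<lambda>_. c"] by simp

lemma jet_has_derivative:
  assumes z0: "0 < Im z0" and "jet z0 h"
  shows "\<exists>g1 g2. jet z0 g1 \<and> jet z0 g2 \<and>
    (\<forall>p. 0 < fst p \<longrightarrow> (h has_derivative (\<lambda>(a, b). of_real a * g1 p + of_real b * g2 p)) (at p))"
  using assms(2)
proof induction
  let ?\<zeta> = "\<lambda>p. characteristic (fst p) (of_real (snd p) + z0)"
  let ?D = "\<lambda>p. dilation (fst p) (of_real (snd p) + z0)"
  note \<zeta>' = characteristic_line_has_derivative[OF _ z0]
  have \<zeta>H: "?\<zeta> p \<in> upper_half_plane" if "0 < fst p" for p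
    using characteristic(1)[of "fst p" "of_real (snd p) + z0"] z0 that by simp
  have hol: "((\<lambda>p. g (?\<zeta> p)) has_derivative
      (\<lambda>(a, b). of_real a * (deriv g (?\<zeta> p) * ((\<i> * f0 (?\<zeta> p)) * ?D p)) + of_real b * (deriv g (?\<zeta> p) * ?D p))) (at p)"
    if g: "g holomorphic_on upper_half_plane" and p: "0 < fst p" for g p
  proof -
    have "(g has_derivative (\<lambda>h. deriv g (?\<zeta> p) * h)) (at (?\<zeta> p))"
      using holomorphic_derivI[OF g open_upper_half_plane \<zeta>H[OF p]]
      unfolding has_field_derivative_def .
    from has_derivative_compose[OF \<zeta>'[OF p] this] show ?thesis
      by (simp add: case_prod_beta' algebra_simps)
  qed
  have jD: "jet z0 ?D" by (rule jet_dilation)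
  have jf: "jet z0 (\<lambda>p. \<i> * f0 (?\<zeta> p))"
    by (rule jet_holomorphic[of "\<lambda>z. \<i> * f0 z"]) (intro holomorphic_intros f0_holomorphic)
  have jd: "jet z0 (\<lambda>p. deriv g (?\<zeta> p))" if "g holomorphic_on upper_half_plane" for g
    by (intro jet_holomorphic holomorphic_deriv that open_upper_half_plane)
  {
    case (jet_holomorphic g)
    show ?case
      by (rule exI[of _ "\<lambda>p. deriv g (?\<zeta> p) * ((\<i> * f0 (?\<zeta> p)) * ?D p)"],
          rule exI[of _ "\<lambda>p. deriv g (?\<zeta> p) * ?D p"])
        (intro conjI allI impI jet_mult jd jf jD hol jet_holomorphic)
  next
    case jet_time
    have "((\<lambda>p. complex_of_real (fst p)) has_derivative (\<lambda>(a, b). of_real a * 1 + of_real b * 0)) (at p)" for p :: "real \<times> real"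
      by (auto intro!: derivative_eq_intros simp: case_prod_beta')
    then show ?case using jet_const by blast
  next
    case jet_dilation
    let ?h = "deriv f0"
    have dh: "?h holomorphic_on upper_half_plane"
      by (intro holomorphic_deriv f0_holomorphic open_upper_half_plane)
    let ?g1 = "\<lambda>p. ?D p * ?D p * (\<i> * (?h (?\<zeta> p) + of_real (fst p) * (deriv ?h (?\<zeta> p) * ((\<i> * f0 (?\<zeta> p)) * ?D p))))"
    let ?g2 = "\<lambda>p. ?D p * ?D p * (\<i> * (of_real (fst p) * (deriv ?h (?\<zeta> p) * ?D p)))"
    have "(?D has_derivative (\<lambda>(a, b). of_real a * ?g1 p + of_real b * ?g2 p)) (at p)" if p: "0 < fst p" for p
    proof -
      have ne: "1 - \<i> * of_real (fst p) * ?h (?\<zeta> p) \<noteq> 0"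
        using dilation_denominator[of "fst p" "of_real (snd p) + z0"] p z0 by simp
      have t: "((\<lambda>p. complex_of_real (fst p)) has_derivative (\<lambda>h. of_real (fst h))) (at p)"
        by (auto intro!: derivative_eq_intros)
      have N: "((\<lambda>p. 1 - \<i> * (of_real (fst p) * ?h (?\<zeta> p))) has_derivative
        (\<lambda>h. 0 - \<i> * (of_real (fst p) * ((\<lambda>(a, b). of_real a * (deriv ?h (?\<zeta> p) * ((\<i> * f0 (?\<zeta> p)) * ?D p)) + of_real b * (deriv ?h (?\<zeta> p) * ?D p)) h)
           + of_real (fst h) * ?h (?\<zeta> p)))) (at p)"
        by (intro has_derivative_diff has_derivative_const has_derivative_mult_right has_derivative_mult t hol dh p)
      have Dd: "?D = (\<lambda>p. inverse (1 - \<i> * (of_real (fst p) * ?h (?\<zeta> p))))"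
        by (simp add: dilation_def inverse_eq_divide mult.assoc)
      have Dp: "inverse (1 - \<i> * (of_real (fst p) * ?h (?\<zeta> p))) = ?D p"
        by (simp add: dilation_def inverse_eq_divide mult.assoc)
      show ?thesis
        apply (subst Dd)
        apply (rule has_derivative_eq_rhs)
         apply (rule Deriv.has_derivative_inverse[OF _ N])
        using ne apply (simp add: mult.assoc)
        unfolding Dp by (auto simp: fun_eq_iff algebra_simps)
    qed
    moreover have "jet z0 ?g1" "jet z0 ?g2"
      by (intro jet_mult jet_add jet_const jd jf jD dh f0_holomorphic jet_time)+
    ultimately show ?case by blast
  next
    case (jet_add g h)
    then obtain g1 g2 h1 h2 where j: "jet z0 g1" "jet z0 g2" "jet z0 h1" "jet z0 h2"
      and d: "\<And>p. 0 < fst p \<Longrightarrow> (g has_derivative (\<lambda>(a, b). of_real a * g1 p + of_real b * g2 p)) (at p)"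
       "\<And>p. 0 < fst p \<Longrightarrow> (h has_derivative (\<lambda>(a, b). of_real a * h1 p + of_real b * h2 p)) (at p)"
      by blast
    have "((\<lambda>p. g p + h p) has_derivative (\<lambda>(a, b). of_real a * (g1 p + h1 p) + of_real b * (g2 p + h2 p))) (at p)"
      if "0 < fst p" for p
      using has_derivative_add[OF d(1)[OF that] d(2)[OF that]]
      by (simp add: case_prod_beta' algebra_simps)
    then show ?case using j
      by (intro exI[of _ "\<lambda>p. g1 p + h1 p"] exI[of _ "\<lambda>p. g2 p + h2 p"]) (auto intro: jet.jet_add)
  next
    case (jet_mult g h)
    then obtain g1 g2 h1 h2 where j: "jet z0 g1" "jet z0 g2" "jet z0 h1" "jet z0 h2"
      and d: "\<And>p. 0 < fst p \<Longrightarrow> (g has_derivative (\<lambda>(a, b). of_real a * g1 p + of_real b * g2 p)) (at p)"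
       "\<And>p. 0 < fst p \<Longrightarrow> (h has_derivative (\<lambda>(a, b). of_real a * h1 p + of_real b * h2 p)) (at p)"
      by blast
    have "((\<lambda>p. g p * h p) has_derivative (\<lambda>(a, b). of_real a * (g p * h1 p + g1 p * h p)
        + of_real b * (g p * h2 p + g2 p * h p))) (at p)"
      if "0 < fst p" for p
      using has_derivative_mult[OF d(1)[OF that] d(2)[OF that]]
      by (simp add: case_prod_beta' algebra_simps)
    then show ?case using j jet_mult.hyps
      by (intro exI[of _ "\<lambda>p. g p * h1 p + g1 p * h p"] exI[of _ "\<lambda>p. g p * h2 p + g2 p * h p"])
        (auto intro: jet.jet_add jet.jet_mult)
  }
qed

lemma jet_Ck_on:
  assumes z0: "0 < Im z0" and "jet z0 h"
  shows "Ck_on k ({0<..} \<times> UNIV) (\<lambda>p. Re (h p))"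
  using assms(2)
proof (induction k arbitrary: h)
  case 0
  have "isCont h p" if "0 < fst p" for p
    using jet_has_derivative[OF z0 0] that has_derivative_continuous by blast
  then have "continuous_on ({0<..} \<times> UNIV) h"
    by (intro continuous_at_imp_continuous_on) auto
  then show ?case by (auto intro: continuous_intros)
next
  case (Suc k)
  from jet_has_derivative[OF z0 Suc.prems] obtain g1 g2 where j: "jet z0 g1" "jet z0 g2"
    and d: "\<And>p. 0 < fst p \<Longrightarrow> (h has_derivative (\<lambda>(a, b). of_real a * g1 p + of_real b * g2 p)) (at p)"
    by blast
  have "((\<lambda>p. Re (h p)) has_derivative (\<lambda>(a, b). a * Re (g1 p) + b * Re (g2 p))) (at p)"
    if "0 < fst p" for p
    using has_derivative_Re[OF d[OF that]] by (simp add: case_prod_beta')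
  then show ?case unfolding Ck_on.simps
    by (intro exI[of _ "\<lambda>p. Re (g1 p)"] exI[of _ "\<lambda>p. Re (g2 p)"] conjI ballI Suc.IH j) auto
qed

definition velocity :: "real \<Rightarrow> complex \<Rightarrow> complex" where
  "velocity t z = f0 (characteristic t z)"

text \<open>The primitive of the velocity is explicit: the correction \<open>- \<i> t f\<^sup>2 / 2\<close> turns the derivative \<open>f \<partial>\<^sub>z \<zeta>\<close> of \<open>P0 \<zeta>\<close> into \<open>f\<close>. It satisfies
  \<open>\<partial>\<^sub>t P = \<i> f\<^sup>2 / 2\<close>, whose real part is \<open>- Re f * Im f\<close>: the integrated Dyson equation.\<close>

definition potential :: "real \<Rightarrow> complex \<Rightarrow> complex" where
  "potential t z = P0 (characteristic t z) - \<i> * t / 2 * (velocity t z)\<^sup>2"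

lemma potential_has_derivative:
  assumes "0 < fst p" "0 < Im z0"
  shows "((\<lambda>p. potential (fst p) (of_real (snd p) + z0)) has_derivative
    (\<lambda>(a, b). of_real a * (\<i> / 2 * (velocity (fst p) (of_real (snd p) + z0))\<^sup>2)
      + of_real b * velocity (fst p) (of_real (snd p) + z0))) (at p)"
proof -
  let ?\<zeta> = "\<lambda>p. characteristic (fst p) (of_real (snd p) + z0)"
  define \<zeta> where "\<zeta> = ?\<zeta> p"
  have H: "0 < Im \<zeta>" using characteristic(1) assms by (simp add: \<zeta>_def)
  define D where "D = dilation (fst p) (of_real (snd p) + z0)"
  have D: "D * (1 - \<i> * fst p * deriv f0 \<zeta>) = 1"
    using dilation_denominator[of "fst p" "of_real (snd p) + z0"] assms
    by (simp add: D_def \<zeta>_def dilation_def)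
  define L where "L = (\<lambda>(a, b). (of_real b + of_real a * (\<i> * f0 \<zeta>)) * D)"
  have \<zeta>': "(?\<zeta> has_derivative L) (at p)"
    using characteristic_line_has_derivative[OF assms] by (simp add: L_def \<zeta>_def D_def)
  have P: "(P0 has_derivative (\<lambda>h. f0 \<zeta> * h)) (at (?\<zeta> p))"
    using P0_deriv[OF H] by (simp add: has_field_derivative_def \<zeta>_def)
  have F: "(f0 has_derivative (\<lambda>h. deriv f0 \<zeta> * h)) (at (?\<zeta> p))"
    using f0_deriv[OF H] by (simp add: has_field_derivative_def \<zeta>_def)
  have t: "((\<lambda>p. complex_of_real (fst p)) has_derivative (\<lambda>h. of_real (fst h))) (at p)"
    by (auto intro!: derivative_eq_intros)
  have "((\<lambda>p. P0 (?\<zeta> p) - \<i> / 2 * (of_real (fst p) * (f0 (?\<zeta> p) * f0 (?\<zeta> p)))) has_derivative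
    (\<lambda>h. f0 \<zeta> * L h - \<i> / 2 * (of_real (fst p) * (f0 (?\<zeta> p) * (deriv f0 \<zeta> * L h) + (deriv f0 \<zeta> * L h) * f0 (?\<zeta> p))
        + of_real (fst h) * (f0 (?\<zeta> p) * f0 (?\<zeta> p))))) (at p)"
    by (intro has_derivative_diff has_derivative_mult_right has_derivative_mult t
        has_derivative_compose[OF \<zeta>' P] has_derivative_compose[OF \<zeta>' F])
  also have "(\<lambda>h. f0 \<zeta> * L h - \<i> / 2 * (of_real (fst p) * (f0 (?\<zeta> p) * (deriv f0 \<zeta> * L h) + (deriv f0 \<zeta> * L h) * f0 (?\<zeta> p))
        + of_real (fst h) * (f0 (?\<zeta> p) * f0 (?\<zeta> p))))
     = (\<lambda>(a, b). of_real a * (\<i> / 2 * (f0 \<zeta>)\<^sup>2) + of_real b * f0 \<zeta>)"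
  proof (rule ext, clarify)
    fix a b :: real
    have "f0 \<zeta> * L (a, b) - \<i> / 2 * (of_real (fst p) * (f0 \<zeta> * (deriv f0 \<zeta> * L (a, b)) + (deriv f0 \<zeta> * L (a, b)) * f0 \<zeta>)
        + of_real a * (f0 \<zeta> * f0 \<zeta>))
      = f0 \<zeta> * (of_real b + of_real a * (\<i> * f0 \<zeta>)) * (D * (1 - \<i> * fst p * deriv f0 \<zeta>)) - \<i> / 2 * of_real a * (f0 \<zeta> * f0 \<zeta>)"
      by (simp add: L_def algebra_simps)
    also have "\<dots> = of_real a * (\<i> / 2 * (f0 \<zeta>)\<^sup>2) + of_real b * f0 \<zeta>"
      unfolding D by (simp add: algebra_simps power2_eq_square)
    finally show "f0 \<zeta> * L (a, b) - \<i> / 2 * (of_real (fst p) * (f0 (?\<zeta> p) * (deriv f0 \<zeta> * L (a, b)) + (deriv f0 \<zeta> * L (a, b)) * f0 (?\<zeta> p))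
        + of_real (fst (a, b)) * (f0 (?\<zeta> p) * f0 (?\<zeta> p)))
     = of_real a * (\<i> / 2 * (f0 \<zeta>)\<^sup>2) + of_real b * f0 \<zeta>" by (simp add: \<zeta>_def)
  qed
  finally show ?thesis
    by (simp add: potential_def[abs_def] velocity_def \<zeta>_def[symmetric] power2_eq_square mult.assoc)
qed

lemma potential_Ck_on:
  assumes "0 < Im z0"
  shows "Ck_on k ({0<..} \<times> UNIV) (\<lambda>(t, x). Re (potential t (of_real x + z0)) + C)"
proof -
  let ?\<zeta> = "\<lambda>p. characteristic (fst p) (of_real (snd p) + z0)"
  have "jet z0 (\<lambda>p. (P0 (?\<zeta> p) + (- \<i> / 2) * (of_real (fst p) * (f0 (?\<zeta> p) * f0 (?\<zeta> p)))) + of_real C)"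
    by (intro jet_add jet_mult jet_const jet_time jet_holomorphic P0_holomorphic f0_holomorphic)
  from jet_Ck_on[OF assms this] show ?thesis
    by (simp add: potential_def velocity_def case_prod_beta' power2_eq_square algebra_simps)
qed

lemma velocity_holomorphic:
  assumes "0 < t"
  shows "velocity t holomorphic_on upper_half_plane"
proof -
  have "(characteristic t has_field_derivative dilation t z) (at z)" if "0 < Im z" for z
  proof -
    have "((\<lambda>z::complex. (t, z)) has_derivative (\<lambda>h. (0, h))) (at z)"
      by (auto intro!: derivative_eq_intros)
    note has_derivative_compose[OF this characteristic_has_derivative[OF assms that]]
    moreover have "(\<lambda>x. x * dilation t z) = (*) (dilation t z)" by (simp add: fun_eq_iff)
    ultimately show ?thesis by (simp add: has_field_derivative_def)
  qed
  then have "characteristic t holomorphic_on upper_half_plane"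
    using open_upper_half_plane by (auto simp: holomorphic_on_open)
  then show ?thesis unfolding velocity_def[abs_def]
    using characteristic(1)[of t] assms
    by (intro holomorphic_on_compose_gen[OF _ f0_holomorphic, unfolded o_def]) auto
qed

lemma velocity_periodic:
  "0 \<le> t \<Longrightarrow> 0 < Im z \<Longrightarrow> velocity t (z + 2 * pi) = velocity t z"
  using f0_periodic[OF characteristic(1), of t z] characteristic_periodic[of t z]
  by (simp add: velocity_def)

lemma potential_periodic:
  "0 \<le> t \<Longrightarrow> 0 < Im z \<Longrightarrow> potential t (z + 2 * pi) = potential t z + 1"
  using P0_periodic[OF characteristic(1), of t z] velocity_periodic[of t z] characteristic_periodic[of t z]
  by (simp add: potential_def)

lemma velocity_near:
  assumes "0 \<le> t" "0 < Im z"
  shows "norm (velocity t z - 1 / (2 * pi)) \<le> 1 / (pi * Im z)"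
proof -
  have "norm (velocity t z - 1 / (2 * pi)) \<le> 1 / (pi * Im (characteristic t z))"
    unfolding velocity_def by (rule f0_near[OF characteristic(1)[OF assms]])
  also have "\<dots> \<le> 1 / (pi * Im z)"
    using Im_characteristic_ge[OF assms] assms
    by (intro divide_left_mono mult_left_mono mult_pos_pos) auto
  finally show ?thesis .
qed

text \<open>The heart of the matter. The characteristic point has height \<open>b = Im z + t u \<ge> t u\<close>, so the Poisson
  bounds at height \<open>b\<close> become inequalities for \<open>u\<close> itself. Strict positivity of \<open>u\<close> is what allows one to divide by
  \<open>u\<close> in the lower bound.\<close>

lemma density_bounds:
  assumes t: "0 < t" and z: "0 < Im z"
  shows "0 < Re (velocity t z)" "\<bar>Re (velocity t z) - 1 / (2 * pi)\<bar> \<le> 2 / t"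
proof -
  define u where "u = Re (velocity t z)"
  define b where "b = Im (characteristic t z)"
  have b: "0 < b" "b = Im z + t * u"
    using characteristic(1)[of t z] Im_characteristic[of t z] t z by (auto simp: b_def u_def velocity_def)
  show u: "0 < Re (velocity t z)"
    using Re_f0_pos b by (simp add: velocity_def b_def)
  have tu: "0 < t * u" using t u by (simp add: u_def)
  have l: "b / (b + 2) / (2 * pi) \<le> u"
    using f0_lower[of "characteristic t z"] b(1) unfolding b_def u_def velocity_def by blast
  have "\<bar>u - 1 / (2 * pi)\<bar> \<le> norm (velocity t z - 1 / (2 * pi))"
    using abs_Re_le_cmod[of "velocity t z - 1 / (2 * pi)"] by (simp add: u_def)
  also have "\<dots> \<le> 1 / (pi * b)"
    using f0_near[of "characteristic t z"] b(1) unfolding b_def u_def velocity_def by blast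
  finally have n: "\<bar>u - 1 / (2 * pi)\<bar> \<le> 1 / (pi * b)" .
  have "t * u / (t * u + 2) \<le> b / (b + 2)"
    using tu b z by (simp add: divide_le_eq le_divide_eq algebra_simps)
  then have "t * u / (t * u + 2) \<le> u * (2 * pi)"
    using l by (subst (asm) pos_divide_le_eq) auto
  then have "u * t \<le> u * ((2 * pi) * (t * u + 2))"
    using tu by (simp add: divide_le_eq algebra_simps)
  then have "t \<le> (2 * pi) * (t * u + 2)" using u by (simp add: u_def)
  also have "(2 * pi) * (t * u + 2) = (2 * pi) * t * (u + 2 / t)" using t by (simp add: field_simps)
  finally have "1 \<le> (2 * pi) * (u + 2 / t)" using t
    by (simp add: mult.assoc mult.left_commute[of _ t])
  then have lower: "1 / (2 * pi) - u \<le> 2 / t" by (simp add: divide_le_eq algebra_simps)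
  have upper: "u - 1 / (2 * pi) \<le> 2 / t"
  proof (cases "1 / (2 * pi) \<le> u")
    case True
    have "t * (1 / (2 * pi)) \<le> b" using b z True t by (smt (verit) mult_left_mono)
    then have "t / 2 \<le> pi * b" by (simp add: divide_le_eq mult_ac)
    then have "1 / (pi * b) \<le> 1 / (t / 2)" using t by (intro divide_left_mono) auto
    then show ?thesis using n by simp
  next
    case False then show ?thesis using t by (smt (verit) divide_pos_pos)
  qed
  show "\<bar>Re (velocity t z) - 1 / (2 * pi)\<bar> \<le> 2 / t"
    using lower upper by (simp add: u_def)
qed

text \<open>The characteristic point moves by at most \<open>t\<close> times the bound of \<open>f0\<close>.\<close>

lemma potential_near_initial:
  assumes t: "0 \<le> t" and h: "0 < h" "h \<le> Im z"
  shows "norm (potential t z - P0 z) \<le> 2 * t * (f0_bound h)\<^sup>2"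
proof -
  define B where "B = f0_bound h"
  define \<zeta> where "\<zeta> = characteristic t z"
  have z: "0 < Im z" using h by simp
  have I: "h \<le> Im \<zeta>" using Im_characteristic_ge[OF t z] h by (simp add: \<zeta>_def)
  have f: "norm (f0 \<zeta>) \<le> B" using norm_f0_le[OF h(1) I] by (simp add: B_def)
  have \<zeta>: "\<zeta> - z = \<i> * t * f0 \<zeta>" by (metis add_diff_cancel_left' \<zeta>_def characteristic_eq[OF t z])
  have d: "norm (\<zeta> - z) \<le> t * B" unfolding \<zeta> using f t by (simp add: norm_mult mult_left_mono)
  have "norm (P0 \<zeta> - P0 z) \<le> B * norm (\<zeta> - z)"
  proof (rule field_differentiable_bound[of "{w. h \<le> Im w}" P0 f0])
    show "convex {w. h \<le> Im w}" using convex_halfspace_Im_ge[of h] by simp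
    show "(P0 has_field_derivative f0 w) (at w within {w. h \<le> Im w})" if "w \<in> {w. h \<le> Im w}" for w
      using P0_deriv[of w] h that by (auto intro: has_field_derivative_at_within)
  qed (use I h norm_f0_le[OF h(1)] in \<open>auto simp: B_def\<close>)
  also have "\<dots> \<le> B * (t * B)" using d f0_bound_pos[OF h(1)] by (intro mult_left_mono) (auto simp: B_def)
  finally have 1: "norm (P0 \<zeta> - P0 z) \<le> t * B\<^sup>2" by (simp add: power2_eq_square mult_ac)
  have "norm (\<i> * t / 2 * (f0 \<zeta>)\<^sup>2) = t / 2 * (norm (f0 \<zeta>))\<^sup>2"
    using t by (simp add: norm_mult norm_divide norm_power)
  also have "\<dots> \<le> t * B\<^sup>2"
    using f t by (intro mult_mono power_mono) auto
  finally have "norm ((P0 \<zeta> - P0 z) - \<i> * t / 2 * (f0 \<zeta>)\<^sup>2) \<le> t * B\<^sup>2 + t * B\<^sup>2"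
    using 1 norm_triangle_ineq4 by (smt (verit))
  then show ?thesis
    by (simp add: potential_def velocity_def \<zeta>_def[symmetric] B_def algebra_simps)
qed

end

section \<open>The Hilbert transform of a holomorphic boundary value\<close>

lemma complex_cot_near_i:
  fixes s R :: real
  assumes "0 < R"
  shows "norm (cot (- (of_real s + \<i> * of_real R) / 2) - \<i>) \<le> 2 / (exp R - 1)"
proof -
  define \<theta> where "\<theta> = - (of_real s + \<i> * of_real R) / (2 :: complex)"
  define p where "p = exp (- (2 * \<i> * \<theta>))"
  have p: "norm p = exp (- R)" by (simp add: p_def \<theta>_def)
  have p1: "norm p < 1" using assms p by simp
  then have ne: "1 - p \<noteq> 0" by auto
  have e: "exp (- (\<i> * \<theta>)) = exp (\<i> * \<theta>) * p"
    by (simp add: p_def flip: exp_add)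
  have "cot \<theta> = \<i> * ((1 + p) / (1 - p))"
  proof -
    have "sin \<theta> = (exp (\<i> * \<theta>) - exp (\<i> * \<theta>) * p) * (1 / (2 * \<i>))"
      by (simp add: sin_exp_eq e)
    also have "1 / (2 * \<i>) = - \<i> / 2" by (simp add: field_simps)
    finally have c: "cos \<theta> = exp (\<i> * \<theta>) * (1 + p) / 2" "sin \<theta> = - \<i> * (exp (\<i> * \<theta>) * (1 - p)) / 2"
      by (simp_all add: cos_exp_eq e algebra_simps)
    have "exp (\<i> * \<theta>) \<noteq> 0" by simp
    then show ?thesis unfolding cot_def c using ne by (simp add: field_simps)
  qed
  also have "\<dots> - \<i> = 2 * \<i> * p / (1 - p)" using ne by (simp add: field_simps)
  finally have "norm (cot \<theta> - \<i>) = 2 * norm p / norm (1 - p)"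
    by (simp add: norm_mult norm_divide)
  also have "\<dots> \<le> 2 * norm p / (1 - norm p)"
    using p1 norm_triangle_ineq2[of 1 p] by (intro divide_left_mono mult_pos_pos) auto
  also have "\<dots> = 2 / (exp R - 1)" using assms by (simp add: p exp_minus field_simps)
  finally show ?thesis by (simp add: \<theta>_def)
qed

text \<open>For a continuous integrand the principal value is the ordinary integral.\<close>

lemma truncated_integral_tendsto:
  fixes r :: "real \<Rightarrow> real"
  assumes c: "continuous_on {x - pi..x + pi} r" and i: "(r has_integral J) {x - pi..x + pi}"
  shows "((\<lambda>\<epsilon>. LBINT y:{y. \<epsilon> < \<bar>y - x\<bar> \<and> \<bar>y - x\<bar> \<le> pi}. r y) \<longlongrightarrow> J) (at_right 0)"
proof -
  have si: "set_integrable lborel {x - pi..x + pi} r"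
    using c by (rule borel_integrable_atLeastAtMost')
  have J: "(LBINT y:{x - pi..x + pi}. r y) = J"
    using set_borel_integral_eq_integral(2)[OF si] i by (simp add: integral_unique)
  obtain M where M: "\<And>y. y \<in> {x - pi..x + pi} \<Longrightarrow> norm (r y) \<le> M"
    using compact_continuous_image[OF c compact_Icc] compact_imp_bounded bounded_iff
    by (metis imageI)
  have b: "\<bar>(LBINT y:{y. \<epsilon> < \<bar>y - x\<bar> \<and> \<bar>y - x\<bar> \<le> pi}. r y) - J\<bar> \<le> 2 * M * \<epsilon>"
    if e: "0 < \<epsilon>" "\<epsilon> < pi" for \<epsilon>
  proof -
    let ?A = "{y. \<epsilon> < \<bar>y - x\<bar> \<and> \<bar>y - x\<bar> \<le> pi}" and ?B = "{x - \<epsilon>..x + \<epsilon>}"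
    have AB: "?A \<union> ?B = {x - pi..x + pi}" "?A \<inter> ?B = {}" using e by (auto simp: abs_if)
    have A: "?A = {x - pi..x + pi} - ?B" using e by (auto simp: abs_if)
    have sA: "set_integrable lborel ?A r" unfolding A
      by (rule set_integrable_subset[OF si]) auto
    have sB: "set_integrable lborel ?B r"
      by (rule set_integrable_subset[OF si]) (use e in auto)
    have "J = (LBINT y:?A. r y) + (LBINT y:?B. r y)"
      unfolding J[symmetric] AB(1)[symmetric] by (rule set_integral_Un[OF AB(2) sA sB])
    moreover have "\<bar>LBINT y:?B. r y\<bar> \<le> M * ((x + \<epsilon>) - (x - \<epsilon>))"
    proof -
      have "norm (integral ?B r) \<le> M * ((x + \<epsilon>) - (x - \<epsilon>))"
        by (rule integral_bound) (use e M in \<open>auto intro: continuous_on_subset[OF c]\<close>)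
      then show ?thesis using set_borel_integral_eq_integral(2)[OF sB] by simp
    qed
    ultimately show ?thesis by simp
  qed
  have "((\<lambda>\<epsilon>. (LBINT y:{y. \<epsilon> < \<bar>y - x\<bar> \<and> \<bar>y - x\<bar> \<le> pi}. r y) - J) \<longlongrightarrow> 0) (at_right 0)"
  proof (rule Lim_null_comparison)
    show "\<forall>\<^sub>F \<epsilon> in at_right 0. norm ((LBINT y:{y. \<epsilon> < \<bar>y - x\<bar> \<and> \<bar>y - x\<bar> \<le> pi}. r y) - J) \<le> 2 * M * \<epsilon>"
      using eventually_at_right_real[OF pi_gt_zero] by eventually_elim (use b in auto)
    have "((\<lambda>\<epsilon>. 2 * M * \<epsilon>) \<longlongrightarrow> 2 * M * 0) (at_right 0)" by (intro tendsto_intros)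
    then show "((\<lambda>\<epsilon>. 2 * M * \<epsilon>) \<longlongrightarrow> 0) (at_right 0)" by simp
  qed
  then show ?thesis by (rule LIM_zero_cancel)
qed

text \<open>The integrand of the Hilbert transform is the real part of \<open>g w = cot ((x - w) / 2) (f w - f x)\<close>, which has
  a removable singularity at \<open>x\<close> and is periodic. By Cauchy's theorem its integral over a period does
  not change when the path is moved upwards, the two vertical sides cancelling; far up, the cotangent tends
  to \<open>\<i>\<close> and \<open>f\<close> to \<open>c\<close>, so the integral is \<open>2 pi \<i> (c - f x)\<close>. Cauchy's theorem is used in
  the form of a primitive \<open>P\<close> of \<open>g\<close> on a convex strip.\<close>

lemma hilbert_Re_eq_Im:
  fixes f :: "complex \<Rightarrow> complex" and x d :: real
  assumes d: "0 < d" and hol: "f holomorphic_on {z. - d < Im z}"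
    and per: "\<And>z. - d < Im z \<Longrightarrow> f (z + 2 * pi) = f z"
    and lim: "\<And>e. 0 < e \<Longrightarrow> \<exists>R. \<forall>z. R \<le> Im z \<longrightarrow> norm (f z - c) \<le> e"
  shows "hilbert (\<lambda>x. Re (f (of_real x))) x = Im (f (of_real x)) - Im c"
proof -
  define X where "X = complex_of_real x"
  \<comment> \<open>This strip contains a full period around \<open>x\<close>, and \<open>x\<close> is the only zero of \<open>sin ((w - x) / 2)\<close> in it.\<close>
  define S where "S = {z. - d < Im z} \<inter> ({z. x - 2 * pi < Re z} \<inter> {z. Re z < x + 2 * pi})"
  have oS: "open S" unfolding S_def
    by (intro open_Int open_halfspace_Im_gt open_halfspace_Re_gt open_halfspace_Re_lt)
  have cS: "convex S" unfolding S_def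
    by (intro convex_Int convex_halfspace_Im_gt convex_halfspace_Re_gt convex_halfspace_Re_lt)
  have holS: "f holomorphic_on S" by (rule holomorphic_on_subset[OF hol]) (auto simp: S_def)
  define A where "A = (\<lambda>w. if w = X then deriv f X else (f w - f X) / (w - X))"
  define sn where "sn = (\<lambda>w. sin ((w - X) / 2))"
  define B where "B = (\<lambda>w. if w = X then deriv sn X else (sn w - sn X) / (w - X))"
  define g where "g = (\<lambda>w. - (cos ((w - X) / 2) * A w / B w))"
  have Ah: "A holomorphic_on S" unfolding A_def by (rule pole_lemma_open[OF holS oS])
  have Bh: "B holomorphic_on S" unfolding B_def
    by (rule pole_lemma_open[OF _ oS]) (auto simp: sn_def intro!: holomorphic_intros)
  have snX: "sn X = 0" by (simp add: sn_def)
  have "(sn has_field_derivative 1 / 2) (at X)"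
    unfolding sn_def by (auto intro!: derivative_eq_intros)
  then have dsn: "deriv sn X = 1 / 2" by (rule DERIV_imp_deriv)
  have sn0: "sn w \<noteq> 0" if "w \<in> S" "w \<noteq> X" for w
  proof
    assume "sn w = 0"
    then obtain n :: int where "(w - X) / 2 = of_real (of_int n * pi)"
      unfolding sn_def sin_eq_0 by blast
    then have w: "w = X + of_real (2 * (of_int n * pi))" by (simp add: field_simps)
    then have n: "pi * (- 1) < pi * of_int n" "pi * of_int n < pi * 1"
      using that(1) by (auto simp: S_def X_def)
    then have "- 1 < real_of_int n" "real_of_int n < 1"
      unfolding mult_less_cancel_left_pos[OF pi_gt_zero] by auto
    then have "n = 0" by linarith
    then show False using that(2) w by simp
  qed
  have B0: "B w \<noteq> 0" if "w \<in> S" for w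
    using sn0[OF that] dsn snX by (auto simp: B_def)
  have gh: "g holomorphic_on S" unfolding g_def
    by (intro holomorphic_intros Ah Bh B0) auto
  have g_eq: "g w = cot ((X - w) / 2) * (f w - f X)" if "w \<in> S" "w \<noteq> X" for w
  proof -
    have "sin ((X - w) / 2) = - sn w" "cos ((X - w) / 2) = cos ((w - X) / 2)"
      by (metis sn_def minus_diff_eq minus_divide_left sin_minus,
          metis minus_diff_eq minus_divide_left cos_minus)
    then show ?thesis using that snX sn0[OF that]
      by (simp add: g_def A_def B_def cot_def)
  qed
  obtain P where P: "\<And>w. w \<in> S \<Longrightarrow> (P has_field_derivative g w) (at w)"
    using holomorphic_convex_primitive'[OF cS oS gh] at_within_open[OF _ oS] by metis
  have line: "of_real (x + s) + \<i> * of_real b \<in> S" if "\<bar>s\<bar> < 2 * pi" "0 \<le> b" for s b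
    using that d by (auto simp: S_def)
  have abs_lt: "\<bar>s\<bar> < 2 * pi" if "- pi \<le> s" "s \<le> pi" for s
    using that pi_gt_zero by linarith
  let ?l = "\<lambda>b s. complex_of_real (x + s) + \<i> * of_real b"
  have FTC: "((\<lambda>s. g (?l b s)) has_integral P (?l b pi) - P (?l b (- pi))) {- pi..pi}"
    if b: "0 \<le> b" for b
  proof (rule fundamental_theorem_of_calculus)
    fix s assume s: "s \<in> {- pi..pi}"
    have "\<bar>s\<bar> < 2 * pi" using s abs_lt by auto
    note L = P[OF line[OF this b]]
    have "((\<lambda>s. ?l b s) has_vector_derivative 1) (at s within {- pi..pi})"
      by (auto intro!: derivative_eq_intros simp: has_vector_derivative_def scaleR_conv_of_real fun_eq_iff)
    from field_vector_diff_chain_within[OF this has_field_derivative_at_within[OF L]]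
    show "((\<lambda>s. P (?l b s)) has_vector_derivative g (?l b s)) (at s within {- pi..pi})"
      by (simp add: o_def)
  qed simp
  define I where "I = P (?l 0 pi) - P (?l 0 (- pi))"
  \<comment> \<open>Periodicity of \<open>g\<close> makes \<open>w \<mapsto> P (w + 2 pi) - P w\<close> constant on the left half of the strip.\<close>
  have const: "P (?l b pi) - P (?l b (- pi)) = I" if b: "0 \<le> b" for b
  proof -
    define S' where "S' = {z. - d < Im z} \<inter> ({z. x - 2 * pi < Re z} \<inter> {z. Re z < x})"
    have cS': "convex S'" unfolding S'_def
      by (intro convex_Int convex_halfspace_Im_gt convex_halfspace_Re_gt convex_halfspace_Re_lt)
    have "((\<lambda>w. P (w + 2 * pi) - P w) has_field_derivative 0) (at w within S')" if w: "w \<in> S'" for w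
    proof -
      have wS: "w \<in> S" "w + 2 * pi \<in> S" "w \<noteq> X" "w + 2 * pi \<noteq> X"
        using w by (auto simp: S_def S'_def X_def complex_eq_iff)
      have half: "(X - (w + 2 * pi)) / 2 = (X - w) / 2 - pi" by (simp add: field_simps)
      have "cot ((X - (w + 2 * pi)) / 2) = cot ((X - w) / 2)"
        unfolding half by (simp add: cot_def sin_diff cos_diff flip: sin_of_real cos_of_real)
      then have "g (w + 2 * pi) = g w"
        using g_eq wS per[of w] w by (simp add: S'_def)
      then have "((\<lambda>w. P (w + 2 * pi) - P w) has_field_derivative g w - g w) (at w)"
        using P[OF wS(2)] P[OF wS(1)]
        by (intro DERIV_diff) (auto simp: DERIV_shift)
      then show ?thesis by (auto intro: has_field_derivative_at_within)
    qed
    from has_field_derivative_zero_constant[OF cS' this]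
    obtain k where k: "\<And>w. w \<in> S' \<Longrightarrow> P (w + 2 * pi) - P w = k" by blast
    have e: "?l b pi = ?l b (- pi) + 2 * pi" for b by simp
    have "?l b (- pi) \<in> S'" if "0 \<le> b" for b using that d by (auto simp: S'_def)
    from k[OF this[of b]] k[OF this[of 0]] show ?thesis unfolding I_def e using b by simp
  qed
  have I: "I = 2 * pi * (\<i> * (c - f X))"
  proof -
    have "norm (I - 2 * pi * (\<i> * (c - f X))) \<le> 2 * pi * e" if e: "0 < e" for e
    proof -
      define K where "K = norm (c - f X) + 1"
      have K: "0 < K" by (simp add: K_def add_nonneg_pos)
      define e1 where "e1 = min 1 (e / 4)"
      have e1: "0 < e1" "e1 \<le> 1" "e1 \<le> e / 4" using e by (auto simp: e1_def)
      obtain R where R: "\<And>z. R \<le> Im z \<Longrightarrow> norm (f z - c) \<le> e1" using lim[OF e1(1)] by blast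
      define e2 where "e2 = min 1 (e / (2 * K))"
      have e2: "0 < e2" "e2 \<le> 1" "e2 * K \<le> e / 2" using e K
        by (auto simp: e2_def min_def field_simps)
      define b where "b = max (max R 1) (2 / e2)"
      have b: "R \<le> b" "1 \<le> b" "2 / e2 \<le> b" by (auto simp: b_def)
      have "b \<le> exp b - 1" using exp_ge_add_one_self[of b] by linarith
      then have "2 / (exp b - 1) \<le> 2 / b"
        using b by (intro divide_left_mono mult_pos_pos) auto
      also have "\<dots> \<le> e2" using b e2 by (simp add: divide_le_eq mult.commute)
      finally have eb: "2 / (exp b - 1) \<le> e2" .
      have bd: "norm (g (?l b s) - \<i> * (c - f X)) \<le> e" if s: "s \<in> {- pi..pi}" for s
      proof -
        define w where "w = ?l b s"
        have wS: "w \<in> S" unfolding w_def using s b abs_lt by (intro line) auto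
        have "Im w = b" by (simp add: w_def)
        then have wX: "w \<noteq> X" using b by (auto simp: X_def)
        have nf: "norm (f w - c) \<le> e1" using R[of w] \<open>Im w = b\<close> b by simp
        have "(X - w) / 2 = - (of_real s + \<i> * of_real b) / 2" by (simp add: w_def X_def)
        then have nc: "norm (cot ((X - w) / 2) - \<i>) \<le> e2"
          using complex_cot_near_i[of b s] b eb by (smt (verit))
        have "g w - \<i> * (c - f X) = (cot ((X - w) / 2) - \<i>) * ((f w - c) + (c - f X)) + \<i> * (f w - c)"
          by (simp add: g_eq[OF wS wX] algebra_simps)
        also have "norm \<dots> \<le> norm (cot ((X - w) / 2) - \<i>) * norm ((f w - c) + (c - f X)) + norm (f w - c)"
          by (metis norm_triangle_ineq norm_mult norm_ii mult_1)
        also have "\<dots> \<le> e2 * K + e1"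
          using nc nf e1 e2 norm_triangle_ineq[of "f w - c" "c - f X"]
          by (intro add_mono mult_mono) (auto simp: K_def)
        also have "\<dots> \<le> e" using e1 e2 e by simp
        finally show ?thesis by (simp add: w_def)
      qed
      have "((\<lambda>s. g (?l b s) - \<i> * (c - f X)) has_integral I - (pi - (- pi)) *\<^sub>R (\<i> * (c - f X))) {- pi..pi}"
        using has_integral_diff[OF FTC[of b] has_integral_const_real[of "\<i> * (c - f X)" "- pi" pi]] const[of b] b
        by simp
      then have "norm (I - (pi - (- pi)) *\<^sub>R (\<i> * (c - f X))) \<le> e * measure lborel (cbox (- pi) pi)"
        using bd e by (intro has_integral_bound) auto
      then show ?thesis by (simp add: scaleR_conv_of_real mult.commute algebra_simps)
    qed
    note bound = this
    have "norm (I - 2 * pi * (\<i> * (c - f X))) \<le> 0"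
    proof (rule field_le_epsilon)
      fix e :: real assume "0 < e"
      then show "norm (I - 2 * pi * (\<i> * (c - f X))) \<le> 0 + e"
        using bound[of "e / (2 * pi)"] by simp
    qed
    then show ?thesis by simp
  qed
  define r where "r = (\<lambda>y. Re (g (of_real y)))"
  have "((\<lambda>y. g (of_real y)) has_integral P (of_real (x + pi)) - P (of_real (x - pi))) {x - pi..x + pi}"
  proof (rule fundamental_theorem_of_calculus)
    fix y assume y: "y \<in> {x - pi..x + pi}"
    have "of_real y \<in> S" using line[of "y - x" 0] abs_lt[of "y - x"] y by auto
    note L = P[OF this]
    have "(complex_of_real has_vector_derivative 1) (at y within {x - pi..x + pi})"
      by (auto intro!: derivative_eq_intros simp: has_vector_derivative_def scaleR_conv_of_real fun_eq_iff)
    from field_vector_diff_chain_within[OF this has_field_derivative_at_within[OF L]]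
    show "((\<lambda>y. P (of_real y)) has_vector_derivative g (of_real y)) (at y within {x - pi..x + pi})"
      by (simp add: o_def)
  qed simp
  then have "((\<lambda>y. g (of_real y)) has_integral I) {x - pi..x + pi}"
    by (simp add: I_def)
  from has_integral_linear[OF this bounded_linear_Re]
  have ri: "(r has_integral Re I) {x - pi..x + pi}" by (simp add: r_def o_def)
  have rc: "continuous_on {x - pi..x + pi} r"
  proof -
    have "of_real ` {x - pi..x + pi} \<subseteq> S"
      using line[of "y - x" 0 for y] abs_lt[of "y - x" for y] by force
    then have "continuous_on {x - pi..x + pi} (\<lambda>y. g (of_real y))"
      by (intro continuous_on_compose2[OF holomorphic_on_imp_continuous_on[OF gh]] continuous_intros)
    then show ?thesis unfolding r_def by (intro continuous_intros)
  qed
  have r_eq: "cot ((x - y) / 2) * (Re (f (of_real y)) - Re (f (of_real x))) = r y"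
    if "0 < \<bar>y - x\<bar>" "\<bar>y - x\<bar> \<le> pi" for y
  proof -
    have "\<bar>y - x\<bar> < 2 * pi" using that pi_gt_zero by linarith
    then have "of_real y \<in> S" using line[of "y - x" 0] by simp
    moreover have "complex_of_real y \<noteq> X" using that by (auto simp: X_def)
    moreover have "cot ((X - of_real y) / 2) = complex_of_real (cot ((x - y) / 2))"
      by (simp add: X_def cot_def flip: sin_of_real cos_of_real)
    ultimately show ?thesis by (simp add: r_def g_eq X_def)
  qed
  have "((\<lambda>\<epsilon>. LBINT y:{y. \<epsilon> < \<bar>y - x\<bar> \<and> \<bar>y - x\<bar> \<le> pi}.
      cot ((x - y) / 2) * (Re (f (of_real y)) - Re (f (of_real x)))) \<longlongrightarrow> Re I) (at_right 0)"
  proof (rule Lim_transform_eventually[OF truncated_integral_tendsto[OF rc ri]])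
    have "\<forall>\<^sub>F \<epsilon> in at_right (0::real). 0 < \<epsilon>" by (rule eventually_at_right_less)
    then show "\<forall>\<^sub>F \<epsilon> in at_right 0. (LBINT y:{y. \<epsilon> < \<bar>y - x\<bar> \<and> \<bar>y - x\<bar> \<le> pi}. r y) =
        (LBINT y:{y. \<epsilon> < \<bar>y - x\<bar> \<and> \<bar>y - x\<bar> \<le> pi}.
          cot ((x - y) / 2) * (Re (f (of_real y)) - Re (f (of_real x))))"
    proof eventually_elim
      case (elim \<epsilon>)
      show ?case by (rule set_lebesgue_integral_cong) (use elim in \<open>auto simp: r_eq\<close>)
    qed
  qed
  then have "hilbert (\<lambda>x. Re (f (of_real x))) x = 1 / (2 * pi) * Re I"
    unfolding hilbert_def by (subst tendsto_Lim[OF trivial_limit_at_right_real]) auto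
  also have "\<dots> = Im (f (of_real x)) - Im c"
    unfolding I by (simp add: X_def)
  finally show ?thesis .
qed

section \<open>Penalisation and semicontinuous envelopes\<close>

lemma upper_semicontinuous_attains_max:
  fixes D :: "'a::topological_space \<Rightarrow> real"
  assumes K: "compact K" "K \<noteq> {}"
    and usc: "\<And>p c. p \<in> K \<Longrightarrow> D p < c \<Longrightarrow> \<forall>\<^sub>F q in nhds p. D q < c"
  shows "\<exists>p\<in>K. \<forall>q\<in>K. D q \<le> D p"
proof (rule ccontr)
  assume "\<not> ?thesis"
  then have bigger: "\<exists>q\<in>K. D p < D q" if "p \<in> K" for p
    using that by (meson not_le)
  define U where "U = (\<lambda>q. \<Union>{V. open V \<and> (\<forall>p\<in>V. D p < D q)})"
  have opU: "open (U q)" for q by (auto simp: U_def)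
  have UD: "D p < D q" if "p \<in> U q" for p q using that by (auto simp: U_def)
  have cover: "K \<subseteq> (\<Union>q\<in>K. U q)"
  proof
    fix p assume p: "p \<in> K"
    then obtain q where q: "q \<in> K" "D p < D q" using bigger by blast
    then obtain V where "open V" "p \<in> V" "\<forall>p\<in>V. D p < D q"
      using usc[OF p q(2)] unfolding eventually_nhds by blast
    then show "p \<in> (\<Union>q\<in>K. U q)" using q by (auto simp: U_def)
  qed
  obtain C where C: "C \<subseteq> K" "finite C" "K \<subseteq> (\<Union>q\<in>C. U q)"
    by (rule compactE_image[OF K(1) opU cover])
  then have "C \<noteq> {}" using K(2) by auto
  then have "Max (D ` C) \<in> D ` C" using C(2) by (intro Max_in) auto
  then obtain q where q: "q \<in> C" "D q = Max (D ` C)" by auto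
  then obtain q' where q': "q' \<in> C" "q \<in> U q'" using C by blast
  then have "D q < D q'" by (intro UD)
  also have "D q' \<le> D q" using q q' C(2) by simp
  finally show False by simp
qed

lemma Ck_on_power_series:
  assumes "\<And>x. summable (\<lambda>n. a n * x ^ n)"
  shows "Ck_on k S (\<lambda>(t, x). \<Sum>n. a n * t ^ n)"
  using assms
proof (induction k arbitrary: a)
  case 0
  have "isCont (\<lambda>t. \<Sum>n. a n * t ^ n) t" for t
    using termdiffs_strong_converges_everywhere[OF 0] by (rule DERIV_isCont)
  then have "continuous_on UNIV (\<lambda>t. \<Sum>n. a n * t ^ n)"
    by (intro continuous_at_imp_continuous_on) auto
  then have "continuous_on S (\<lambda>p. (\<lambda>t. \<Sum>n. a n * t ^ n) (fst p))"
    by (rule continuous_on_compose2) (auto intro: continuous_intros)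
  then show ?case by (simp add: case_prod_beta')
next
  case (Suc k)
  have d: "((\<lambda>(t, x). \<Sum>n. a n * t ^ n) has_derivative
      (\<lambda>(u, v). u * (\<lambda>(t, x). \<Sum>n. diffs a n * t ^ n) p + v * (\<lambda>(t, x). \<Sum>n. 0 * t ^ n) p)) (at p)" for p :: "real \<times> real"
  proof -
    have "((\<lambda>t. \<Sum>n. a n * t ^ n) has_derivative (\<lambda>h. (\<Sum>n. diffs a n * fst p ^ n) * h)) (at (fst p))"
      using termdiffs_strong_converges_everywhere[OF Suc.prems] by (simp add: has_field_derivative_def)
    moreover have "(fst has_derivative fst) (at p)" by (auto intro: derivative_intros)
    ultimately have "((\<lambda>p. \<Sum>n. a n * fst p ^ n) has_derivative (\<lambda>h. (\<Sum>n. diffs a n * fst p ^ n) * fst h)) (at p)"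
      using has_derivative_compose[of fst fst p UNIV] by simp
    then show ?thesis by (simp add: case_prod_beta' mult.commute)
  qed
  have "Ck_on k S (\<lambda>(t, x). \<Sum>n. diffs a n * t ^ n)"
    by (rule Suc.IH) (rule termdiff_converges_all[OF Suc.prems])
  moreover have "Ck_on k S (\<lambda>(t, x). \<Sum>n. 0 * t ^ n)" by (rule Suc.IH) simp
  ultimately show ?case unfolding Ck_on.simps using d by blast
qed

lemma Ck_on_add: "Ck_on k S f \<Longrightarrow> Ck_on k S g \<Longrightarrow> Ck_on k S (\<lambda>z. f z + g z)"
proof (induction k arbitrary: f g)
  case 0
  then show ?case by (auto intro: continuous_intros)
next
  case (Suc k)
  then obtain f1 f2 g1 g2 where
    f: "\<forall>z\<in>S. (f has_derivative (\<lambda>(a, b). a * f1 z + b * f2 z)) (at z)" "Ck_on k S f1" "Ck_on k S f2" and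
    g: "\<forall>z\<in>S. (g has_derivative (\<lambda>(a, b). a * g1 z + b * g2 z)) (at z)" "Ck_on k S g1" "Ck_on k S g2"
    by auto
  have "((\<lambda>z. f z + g z) has_derivative (\<lambda>(a, b). a * (f1 z + g1 z) + b * (f2 z + g2 z))) (at z)"
    if "z \<in> S" for z
    using has_derivative_add[OF f(1)[rule_format, OF that] g(1)[rule_format, OF that]]
    by (simp add: case_prod_beta' algebra_simps)
  then show ?case unfolding Ck_on.simps
    by (intro exI[of _ "\<lambda>z. f1 z + g1 z"] exI[of _ "\<lambda>z. f2 z + g2 z"] conjI ballI Suc.IH f g) auto
qed

lemma Ck_on_scale: "Ck_on k S f \<Longrightarrow> Ck_on k S (\<lambda>z. r * f z)"
proof (induction k arbitrary: f)
  case 0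
  then show ?case by (auto intro: continuous_intros)
next
  case (Suc k)
  then obtain f1 f2 where
    f: "\<forall>z\<in>S. (f has_derivative (\<lambda>(a, b). a * f1 z + b * f2 z)) (at z)" "Ck_on k S f1" "Ck_on k S f2"
    by auto
  have "((\<lambda>z. r * f z) has_derivative (\<lambda>(a, b). a * (r * f1 z) + b * (r * f2 z))) (at z)"
    if "z \<in> S" for z
    using has_derivative_mult_right[OF f(1)[rule_format, OF that], of r]
    by (simp add: case_prod_beta' algebra_simps)
  then show ?case unfolding Ck_on.simps
    by (intro exI[of _ "\<lambda>z. r * f1 z"] exI[of _ "\<lambda>z. r * f2 z"] conjI ballI Suc.IH f) auto
qed

lemma Ck_on_time_power: "Ck_on k S (\<lambda>(t, x). r * (t - t0) ^ n)"
proof (induction k arbitrary: r n)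
  case 0
  show ?case by (auto intro!: continuous_intros simp: case_prod_beta')
next
  case (Suc k)
  have "((\<lambda>(t, x). r * (t - t0) ^ n) has_derivative
    (\<lambda>(a, b). a * (\<lambda>(t, x). (r * n) * (t - t0) ^ (n - 1)) p + b * (\<lambda>(t, x). 0 * (t - t0) ^ 0) p)) (at p)" for p :: "real \<times> real"
    unfolding case_prod_beta' by (auto intro!: derivative_eq_intros simp: fun_eq_iff)
  then show ?case using Suc.IH unfolding Ck_on.simps by blast
qed

lemma Ck_on_sin: "Ck_on k S (\<lambda>(t, x). sin (x + c))"
proof (induction k arbitrary: c)
  case 0
  show ?case by (auto intro!: continuous_intros simp: case_prod_beta')
next
  case (Suc k)
  have "sin (y + (c + pi / 2)) = cos (y + c)" for y
    unfolding add.assoc[symmetric] by (simp add: sin_add[of "y + c" "pi / 2"])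
  then have "((\<lambda>(t, x). sin (x + c)) has_derivative
    (\<lambda>(a, b). a * (\<lambda>(t, x). 0 * (t - 0) ^ 0) p + b * (\<lambda>(t, x). sin (x + (c + pi / 2))) p)) (at p)" for p :: "real \<times> real"
    unfolding case_prod_beta' by (auto intro!: derivative_eq_intros simp: fun_eq_iff)
  then show ?case using Suc.IH Ck_on_time_power[of k S 0 0 0] unfolding Ck_on.simps by blast
qed

text \<open>A smooth function of time that is small up to a given time and eventually exceeds a prescribed
  sequence. It is the power series \<open>\<Sum> (t / m)\<^bsup>p m\<^esup>\<close> over large \<open>m\<close>, with exponents \<open>p m\<close> that increase so fast
  that from \<open>t = m + 1\<close> on the term for \<open>m\<close> alone beats the value prescribed for \<open>m + 1\<close>; for a fixed \<open>t\<close> all but finitely many of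
  the quotients are at most \<open>1 / 2\<close>, so the series converges everywhere.\<close>

lemma entire_majorant:
  fixes B :: "nat \<Rightarrow> real" and s e :: real
  assumes s: "0 < s" and e: "0 < e"
  obtains a :: "nat \<Rightarrow> real" and N
  where "\<And>k. 0 \<le> a k" "\<And>x. summable (\<lambda>k. a k * x ^ k)" "(\<Sum>k. a k * s ^ k) \<le> e"
    "\<And>n t. N \<le> n \<Longrightarrow> real n \<le> t \<Longrightarrow> B n \<le> (\<Sum>k. a k * t ^ k)"
    "\<And>t. 0 < t \<Longrightarrow> 0 < (\<Sum>k. diffs a k * t ^ k)"
proof -
  obtain N0 :: nat where N0: "(1 / 2 :: real) ^ N0 < e / 2"
    using real_arch_pow_inv[of "e / 2" "1 / 2"] e by auto
  obtain N1 :: nat where N1: "2 * s \<le> real N1" using real_arch_simple by blast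
  define N where "N = N0 + N1 + 1"
  have N: "0 < N" "2 * s \<le> real N" using N1 by (auto simp: N_def)
  define m where "m = (\<lambda>j. real (N + j))"
  have m: "0 < m j" "2 * s \<le> m j" "real N \<le> m j" "real j \<le> m j" "m j < real (N + j + 1)" for j
    using N by (auto simp: m_def)
  have "\<exists>r. B (N + j + 1) < (real (N + j + 1) / m j) ^ r" for j
    using m[of j] by (intro real_arch_pow) (simp add: less_divide_eq)
  then obtain r where r: "\<And>j. B (N + j + 1) < (real (N + j + 1) / m j) ^ r j" by metis
  define p where "p = (\<lambda>j. N + (\<Sum>i\<le>j. r i + 1))"
  have p: "strict_mono p" unfolding p_def by (intro strict_monoI_Suc) simp
  have pr: "r j \<le> p j" for j
    unfolding p_def using member_le_sum[of j "{..j}" "\<lambda>i. r i + 1"] by simp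
  have pj: "N + j \<le> p j" for j
  proof -
    have "j + 1 = (\<Sum>i\<le>j. 1)" by simp
    also have "\<dots> \<le> (\<Sum>i\<le>j. r i + 1)" by (intro sum_mono) auto
    finally show ?thesis by (simp add: p_def)
  qed
  have injp: "inv p (p j) = j" for j using p by (simp add: strict_mono_imp_inj_on)
  define a where "a = (\<lambda>k. if k \<in> range p then (1 / m (inv p k)) ^ k else 0)"
  have ap: "a (p j) * x ^ p j = (x / m j) ^ p j" for j x
    by (simp add: a_def injp power_divide)
  have a0: "a k * x ^ k = 0" if "k \<notin> range p" for k x using that by (simp add: a_def)
  have a_nonneg: "0 \<le> a k" for k by (auto simp: a_def intro!: zero_le_power divide_nonneg_pos m)
  have sp: "summable (\<lambda>j. (x / m j) ^ p j)" for x
  proof (rule summable_comparison_test')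
    show "summable (\<lambda>j. (1 / 2 :: real) ^ j)" by (rule summable_geometric) simp
    fix j assume j: "nat \<lceil>2 * \<bar>x\<bar>\<rceil> \<le> j"
    then have "2 * \<bar>x\<bar> \<le> real j" by linarith
    then have "\<bar>x\<bar> / m j \<le> 1 / 2" using m[of j] by (simp add: divide_le_eq)
    then have "(\<bar>x\<bar> / m j) ^ p j \<le> (1 / 2) ^ p j" using m[of j] by (intro power_mono) auto
    also have "\<dots> \<le> (1 / 2) ^ j" using pj[of j] by (intro power_decreasing) auto
    finally show "norm ((x / m j) ^ p j) \<le> (1 / 2) ^ j"
      using m[of j] by (simp add: power_abs)
  qed
  have summ: "summable (\<lambda>k. a k * x ^ k)" for x
    using summable_mono_reindex[OF p, of "\<lambda>k. a k * x ^ k"] a0 sp[of x] by (simp add: ap)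
  have suma: "(\<Sum>k. a k * x ^ k) = (\<Sum>j. (x / m j) ^ p j)" for x
    using suminf_mono_reindex[OF p, of "\<lambda>k. a k * x ^ k"] a0 by (simp add: ap)
  show ?thesis
  proof (rule that[of a "N + 1"])
    show "0 \<le> a k" for k by (rule a_nonneg)
    show "summable (\<lambda>k. a k * x ^ k)" for x by (rule summ)
    have "(\<Sum>k. a k * s ^ k) \<le> (\<Sum>j. (1 / 2) ^ N0 * (1 / 2) ^ j)"
      unfolding suma
    proof (rule suminf_le)
      fix j
      have "s / m j \<le> 1 / 2" using m[of j] by (simp add: divide_le_eq)
      then have "(s / m j) ^ p j \<le> (1 / 2) ^ p j" using m[of j] s by (intro power_mono) auto
      also have "\<dots> \<le> (1 / 2) ^ (N0 + j)" using pj[of j] by (intro power_decreasing) (auto simp: N_def)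
      finally show "(s / m j) ^ p j \<le> (1 / 2) ^ N0 * (1 / 2) ^ j" by (simp add: power_add)
    next
      show "summable (\<lambda>j. (1 / 2 :: real) ^ N0 * (1 / 2) ^ j)"
        by (intro summable_mult summable_geometric) simp
    qed (rule sp)
    also have "\<dots> = (1 / 2) ^ N0 * 2"
      using suminf_geometric[of "1 / 2 :: real"] by (simp add: suminf_mult summable_geometric)
    finally show "(\<Sum>k. a k * s ^ k) \<le> e" using N0 by simp
    show "B n \<le> (\<Sum>k. a k * t ^ k)" if n: "N + 1 \<le> n" "real n \<le> t" for n t
    proof -
      define j where "j = n - (N + 1)"
      have nj: "n = N + j + 1" using n by (simp add: j_def)
      have "B n \<le> (real n / m j) ^ r j" using r[of j] by (simp add: nj)
      also have "\<dots> \<le> (real n / m j) ^ p j"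
        using m[of j] pr[of j] by (intro power_increasing) (auto simp: nj le_divide_eq)
      also have "\<dots> \<le> (t / m j) ^ p j"
        using m[of j] n by (intro power_mono divide_right_mono) auto
      also have "\<dots> = sum (\<lambda>j. (t / m j) ^ p j) {j}" by simp
      also have "\<dots> \<le> (\<Sum>j. (t / m j) ^ p j)"
        using m n by (intro sum_le_suminf sp) (auto intro!: zero_le_power divide_nonneg_pos)
      finally show ?thesis by (simp add: suma)
    qed
    show "0 < (\<Sum>k. diffs a k * t ^ k)" if t: "0 < t" for t
    proof -
      have "0 < diffs a (p 0 - 1)"
        using pj[of 0] N m[of 0] a_def by (simp add: diffs_def) (simp add: a_def injp)
      then have "0 < diffs a (p 0 - 1) * t ^ (p 0 - 1)" using t by simp
      also have "\<dots> = sum (\<lambda>k. diffs a k * t ^ k) {p 0 - 1}" by simp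
      also have "\<dots> \<le> (\<Sum>k. diffs a k * t ^ k)"
        using a_nonneg t by (intro sum_le_suminf termdiff_converges_all summ)
          (auto simp: diffs_def intro!: mult_nonneg_nonneg)
      finally show ?thesis .
    qed
  qed
qed

text \<open>Test functions must touch \<open>F\<close> globally in time, while no bound on the drift of \<open>F\<close> in time is known
  beforehand. Subtracting an entire function that outgrows \<open>D\<close> restricts the
  search for a maximum to a compact set. Its derivative is positive, which will make the
  touching function a strict super- or subsolution.\<close>

lemma penalised_maximum:
  fixes D :: "real \<times> real \<Rightarrow> real"
  assumes usc: "\<And>p c. 0 < fst p \<Longrightarrow> D p < c \<Longrightarrow> \<forall>\<^sub>F q in nhds p. D q < c"
    and per: "\<And>t x. 0 < t \<Longrightarrow> D (t, x + 2 * pi) = D (t, x)"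
    and init: "0 < \<tau>" "\<And>t x. 0 < t \<Longrightarrow> t < \<tau> \<Longrightarrow> D (t, x) \<le> 0"
    and pos: "0 < t1" "0 < D (t1, x1)"
  obtains pen pen' :: "real \<Rightarrow> real" and t0 x0
  where "\<And>k S. Ck_on k S (\<lambda>(t, x). pen t)"
    "\<And>t. (pen has_real_derivative pen' t) (at t)" "\<And>t. 0 < t \<Longrightarrow> 0 < pen' t"
    "0 < t0" "\<And>t x. 0 < t \<Longrightarrow> D (t, x) - pen t \<le> D (t0, x0) - pen t0"
proof -
  have per_int: "D (t, x + 2 * pi * of_int k) = D (t, x)" if "0 < t" for t x and k :: int
  proof (induction k rule: int_induct[where k = 0])
    case (step1 i)
    then show ?case using per[OF that, of "x + 2 * pi * of_int i"] by (simp add: algebra_simps)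
  next
    case (step2 i)
    then show ?case using per[OF that, of "x + 2 * pi * of_int (i - 1)"] by (simp add: algebra_simps)
  qed simp
  have reduce: "\<exists>y\<in>{0..2 * pi}. D (t, x) = D (t, y)" if "0 < t" for t x
  proof -
    define k where "k = \<lfloor>x / (2 * pi)\<rfloor>"
    have "of_int k \<le> x / (2 * pi)" "x / (2 * pi) < of_int k + 1" by (auto simp: k_def)
    then have "0 \<le> x - 2 * pi * of_int k" "x - 2 * pi * of_int k \<le> 2 * pi"
      by (auto simp: le_divide_eq divide_less_eq algebra_simps)
    then show ?thesis using per_int[OF that, of "x - 2 * pi * of_int k" k]
      by (intro bexI[of _ "x - 2 * pi * of_int k"]) auto
  qed
  have "\<exists>M. \<forall>t\<in>{real n..real n + 1}. \<forall>x. D (t, x) \<le> M" if "0 < n" for n :: nat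
  proof -
    have "\<exists>p\<in>{real n..real n + 1} \<times> {0..2 * pi}. \<forall>q\<in>{real n..real n + 1} \<times> {0..2 * pi}. D q \<le> D p"
      by (rule upper_semicontinuous_attains_max)
        (use that in \<open>auto intro!: compact_Times usc\<close>)
    then obtain p where p: "\<And>q. q \<in> {real n..real n + 1} \<times> {0..2 * pi} \<Longrightarrow> D q \<le> D p" by blast
    have "D (t, x) \<le> D p" if "t \<in> {real n..real n + 1}" for t x
      using reduce[of t x] that \<open>0 < n\<close> p by fastforce
    then show ?thesis by blast
  qed
  then have "\<forall>n. \<exists>M. 0 < n \<longrightarrow> (\<forall>t\<in>{real n..real n + 1}. \<forall>x. D (t, x) \<le> M)" by blast
  from choice[OF this] obtain B
    where B: "\<And>n t x. 0 < n \<Longrightarrow> t \<in> {real n..real n + 1} \<Longrightarrow> D (t, x) \<le> B n" by blast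
  have half: "0 < D (t1, x1) / 2" using pos(2) by simp
  obtain a N where a: "\<And>k. 0 \<le> a k" "\<And>x. summable (\<lambda>k. a k * x ^ k)"
    "(\<Sum>k. a k * t1 ^ k) \<le> D (t1, x1) / 2"
    "\<And>n t. N \<le> n \<Longrightarrow> real n \<le> t \<Longrightarrow> B n \<le> (\<Sum>k. a k * t ^ k)"
    "\<And>t. 0 < t \<Longrightarrow> 0 < (\<Sum>k. diffs a k * t ^ k)"
    by (rule entire_majorant[OF pos(1) half, of B]) (rule that; blast)
  define pen where "pen = (\<lambda>t. \<Sum>k. a k * t ^ k)"
  define pen' where "pen' = (\<lambda>t. \<Sum>k. diffs a k * t ^ k)"
  have d: "(pen has_real_derivative pen' t) (at t)" for t
    unfolding pen_def pen'_def by (rule termdiffs_strong_converges_everywhere[OF a(2)])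
  have pen0: "0 \<le> pen t" if "0 < t" for t
    unfolding pen_def using that a(1) by (intro suminf_nonneg a(2)) auto
  define T where "T = max (real (N + 1)) t1"
  have large: "D (t, x) \<le> pen t" if "T \<le> t" for t x
  proof -
    define n where "n = nat \<lfloor>t\<rfloor>"
    have "real (N + 1) \<le> t" using that by (simp add: T_def)
    then have n: "0 < n" "N \<le> n" "t \<in> {real n..real n + 1}"
      unfolding n_def by (auto simp: le_nat_floor)
    then show ?thesis using order_trans[OF B[OF n(1,3)] a(4)[OF n(2)]] n(3) by (simp add: pen_def)
  qed
  define \<tau>' where "\<tau>' = min \<tau> t1"
  have \<tau>': "0 < \<tau>'" "\<tau>' \<le> t1" "t1 \<le> T" using init pos by (auto simp: \<tau>'_def T_def)
  let ?K = "{\<tau>'..T} \<times> {0..2 * pi}"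
  have "\<exists>p\<in>?K. \<forall>q\<in>?K. (\<lambda>p. D p - pen (fst p)) q \<le> (\<lambda>p. D p - pen (fst p)) p"
  proof (rule upper_semicontinuous_attains_max)
    show "compact ?K" by (intro compact_Times) auto
    show "?K \<noteq> {}" using \<tau>' by auto
    fix p c assume p: "p \<in> ?K" and c: "D p - pen (fst p) < c"
    define \<epsilon> where "\<epsilon> = (c - (D p - pen (fst p))) / 2"
    have \<epsilon>: "0 < \<epsilon>" using c by (simp add: \<epsilon>_def)
    have "0 < fst p" using p \<tau>' by auto
    then have 1: "\<forall>\<^sub>F q in nhds p. D q < D p + \<epsilon>" using \<epsilon> by (intro usc) auto
    have "isCont (\<lambda>q. pen (fst q)) p"
      by (rule isCont_o2[OF _ DERIV_isCont[OF d]]) (intro continuous_intros)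
    then have "((\<lambda>q. pen (fst q)) \<longlongrightarrow> pen (fst p)) (nhds p)"
      unfolding isCont_def by (subst (asm) tendsto_at_iff_tendsto_nhds)
    then have 2: "\<forall>\<^sub>F q in nhds p. pen (fst p) - \<epsilon> < pen (fst q)"
      using \<epsilon> by (intro order_tendstoD(1)) auto
    show "\<forall>\<^sub>F q in nhds p. D q - pen (fst q) < c"
      using 1 2 by eventually_elim (simp add: \<epsilon>_def field_simps)
  qed
  then obtain p where p: "p \<in> ?K" "\<And>q. q \<in> ?K \<Longrightarrow> D q - pen (fst q) \<le> D p - pen (fst p)" by blast
  obtain t0 x0 where tx: "p = (t0, x0)" by (cases p)
  have p0: "(t0, x0) \<in> ?K" using p(1) tx by simp
  have mx: "D (t, x) - pen t \<le> D (t0, x0) - pen t0" if "(t, x) \<in> ?K" for t x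
    using p(2)[OF that] tx by simp
  have mx': "D (t, x) - pen t \<le> D (t0, x0) - pen t0" if "\<tau>' \<le> t" "t \<le> T" for t x
  proof -
    have "0 < t" using that \<tau>' by simp
    from reduce[OF this, of x] obtain y where "y \<in> {0..2 * pi}" "D (t, x) = D (t, y)" by blast
    then show ?thesis using mx[of t y] that by auto
  qed
  have pos0: "0 \<le> D (t0, x0) - pen t0"
    using mx'[of t1 x1] \<tau>' a(3) pos by (simp add: pen_def)
  show ?thesis
  proof (rule that[of pen pen' t0 x0])
    show "Ck_on k S (\<lambda>(t, x). pen t)" for k S unfolding pen_def by (rule Ck_on_power_series[OF a(2)])
    show "0 < pen' t" if "0 < t" for t using a(5)[OF that] by (simp add: pen'_def)
    show "0 < t0" using p0 \<tau>' by auto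
    show "D (t, x) - pen t \<le> D (t0, x0) - pen t0" if t: "0 < t" for t x
    proof -
      consider "t < \<tau>'" | "\<tau>' \<le> t" "t \<le> T" | "T < t" by linarith
      then show ?thesis
      proof cases
        case 1 then show ?thesis using init(2)[of t x] pen0[OF t] t pos0 by (simp add: \<tau>'_def)
      next
        case 2 then show ?thesis by (rule mx')
      next
        case 3 then show ?thesis using large[of t x] pos0 by simp
      qed
    qed
  qed (rule d)
qed

text \<open>The increment is a parameter because the lemma will also be applied to \<open>- F\<close>, where it is \<open>- 1\<close>.\<close>

lemma usc_env_periodic:
  assumes F: "\<And>t x. 0 \<le> t \<Longrightarrow> F t (x + 2 * pi) = F t x + c" and t: "0 < t"
  shows "usc_env F t (x + 2 * pi) = usc_env F t x + ereal c"
proof -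
  have f: "filtermap (\<lambda>p. p - (0, - 2 * pi)) (nhds (t, x)) = nhds (t, x + 2 * pi)"
    by (subst filtermap_nhds_shift) simp
  have inj: "inj (\<lambda>p. p - (0, - 2 * pi) :: real \<times> real)" by (simp add: inj_def)
  have "usc_env F t (x + 2 * pi) = Limsup (nhds (t, x)) (\<lambda>p. ereal (F (fst p) (snd p + 2 * pi)))"
    unfolding usc_env_def f[symmetric] Limsup_filtermap_eq[OF inj] by (simp add: case_prod_beta')
  also have "\<dots> = Limsup (nhds (t, x)) (\<lambda>p. ereal (F (fst p) (snd p)) + ereal c)"
  proof (rule Limsup_eq)
    have "open ({0::real<..} \<times> (UNIV :: real set))" by (intro open_Times) auto
    then have "\<forall>\<^sub>F p in nhds (t, x). p \<in> {0<..} \<times> UNIV"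
      using t by (intro eventually_nhds_in_open) auto
    then show "\<forall>\<^sub>F p in nhds (t, x). ereal (F (fst p) (snd p + 2 * pi)) = ereal (F (fst p) (snd p)) + ereal c"
      by eventually_elim (auto simp: F)
  qed
  also have "\<dots> = Limsup (nhds (t, x)) (\<lambda>p. ereal (F (fst p) (snd p))) + ereal c"
    by (rule Limsup_add_ereal_right) simp_all
  finally show ?thesis by (simp add: usc_env_def case_prod_beta')
qed

lemma usc_env_upper_semicontinuous:
  assumes "usc_env F t x < c"
  shows "\<forall>\<^sub>F p in nhds (t, x). usc_env F (fst p) (snd p) < c"
proof -
  obtain c' where c': "usc_env F t x < c'" "c' < c" using assms dense by blast
  then have "\<forall>\<^sub>F p in nhds (t, x). ereal (F (fst p) (snd p)) < c'"
    unfolding usc_env_def using Limsup_lessD by (auto simp: case_prod_beta')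
  then have "\<forall>\<^sub>F p in nhds (t, x). \<forall>\<^sub>F q in nhds p. ereal (F (fst q) (snd q)) < c'"
    by (simp add: eventually_eventually)
  then show ?thesis
  proof eventually_elim
    case (elim p)
    then have "usc_env F (fst p) (snd p) \<le> c'"
      unfolding usc_env_def by (intro Limsup_bounded) (auto simp: case_prod_beta' elim: eventually_mono)
    then show ?case using c' by simp
  qed
qed

lemma le_usc_env: "ereal (F t x) \<le> usc_env F t x"
proof (rule ccontr)
  assume "\<not> ?thesis"
  then have "usc_env F t x < ereal (F t x)" by simp
  then have "\<forall>\<^sub>F p in nhds (t, x). (\<lambda>(s, y). ereal (F s y)) p < ereal (F t x)"
    unfolding usc_env_def by (rule Limsup_lessD)
  from eventually_nhds_x_imp_x[OF this] show False by simp
qed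

lemma lsc_env_eq_usc_env: "lsc_env F t x = - usc_env (\<lambda>t x. - F t x) t x"
  unfolding lsc_env_def usc_env_def
  using ereal_Limsup_uminus[of "nhds (t, x)" "\<lambda>(s, y). ereal (F s y)"]
  by (simp add: case_prod_beta')

section \<open>Comparison of viscosity solutions with smooth solutions\<close>

context herglotz
begin

text \<open>The exact solutions of the integrated equation with which \<open>F\<close> is compared. The imaginary part of \<open>z0\<close>
  smooths the initial data; the real part of \<open>z0\<close> and \<open>C\<close> shift the graph horizontally and vertically.\<close>

definition profile :: "complex \<Rightarrow> real \<Rightarrow> real \<Rightarrow> real \<Rightarrow> real" where
  "profile z0 C t x = Re (potential t (of_real x + z0)) + C"

lemma profile_has_derivative:
  assumes "0 < t" "0 < Im z0"
  shows "((\<lambda>p. profile z0 C (fst p) (snd p)) has_derivative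
    (\<lambda>(a, b). a * - (Re (velocity t (of_real x + z0)) * Im (velocity t (of_real x + z0)))
      + b * Re (velocity t (of_real x + z0)))) (at (t, x))"
proof -
  have "((\<lambda>p. potential (fst p) (of_real (snd p) + z0)) has_derivative
    (\<lambda>(a, b). of_real a * (\<i> / 2 * (velocity t (of_real x + z0))\<^sup>2)
      + of_real b * velocity t (of_real x + z0))) (at (t, x))"
    using potential_has_derivative[of "(t, x)" z0] assms by simp
  from has_derivative_add_const[OF has_derivative_Re[OF this], of C] show ?thesis
    by (simp add: profile_def case_prod_beta' power2_eq_square algebra_simps)
qed

lemma profile_dt:
  assumes "0 < t" "0 < Im z0"
  shows "((\<lambda>t. profile z0 C t x) has_real_derivative
    - (Re (velocity t (of_real x + z0)) * Im (velocity t (of_real x + z0)))) (at t)"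
proof -
  have "((\<lambda>s. (s, x)) has_derivative (\<lambda>h. (h, 0))) (at t)" by (auto intro!: derivative_eq_intros)
  note has_derivative_compose[OF this profile_has_derivative[OF assms, where C = C]]
  moreover have "(\<lambda>h. - (h * c)) = (*) (- c)" for c :: real by (simp add: fun_eq_iff)
  ultimately show ?thesis unfolding has_field_derivative_def by simp
qed

lemma profile_dx:
  assumes "0 < t" "0 < Im z0"
  shows "(profile z0 C t has_real_derivative Re (velocity t (of_real x + z0))) (at x)"
proof -
  have "((\<lambda>y. (t, y)) has_derivative (\<lambda>h. (0, h))) (at x)" by (auto intro!: derivative_eq_intros)
  from has_derivative_compose[OF this profile_has_derivative[OF assms]] show ?thesis
    unfolding has_field_derivative_def by (simp add: mult_commute_abs)
qed

lemma profile_periodic: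
  assumes "0 \<le> t" "0 < Im z0"
  shows "profile z0 C t (x + 2 * pi) = profile z0 C t x + 1"
  using potential_periodic[of t "of_real x + z0"] assms
  by (simp add: profile_def algebra_simps)

text \<open>The sine is treated together with the velocity, as the boundary value of \<open>- \<i> r exp (\<i> (z - x0))\<close>, which vanishes at
  \<open>\<i> \<infinity>\<close>. Its contribution at \<open>x0\<close> is \<open>- r\<close>.\<close>

lemma hilbert_velocity:
  assumes t: "0 < t" and z0: "0 < Im z0"
  shows "hilbert (\<lambda>x. Re (velocity t (of_real x + z0)) + r * sin (x - x0)) x0
    = Im (velocity t (of_real x0 + z0)) - r"
proof -
  define f where "f = (\<lambda>w. velocity t (w + z0) + of_real r * (- \<i> * exp (\<i> * (w - of_real x0))))"
  have "hilbert (\<lambda>x. Re (f (of_real x))) x0 = Im (f (of_real x0)) - Im (1 / (2 * pi))"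
  proof (rule hilbert_Re_eq_Im[of "Im z0"])
    show "f holomorphic_on {z. - Im z0 < Im z}"
      unfolding f_def
      by (intro holomorphic_intros holomorphic_on_compose_gen[OF _ velocity_holomorphic[OF t], unfolded o_def]) auto
    fix z assume z: "- Im z0 < Im z"
    have "exp (\<i> * (z + 2 * pi - of_real x0)) = exp (\<i> * (z - of_real x0))"
      by (simp add: ring_distribs exp_add exp_diff) (metis exp_two_pi_i' mult.commute mult.left_commute)
    moreover have "velocity t (z + 2 * pi + z0) = velocity t (z + z0)"
      using velocity_periodic[of t "z + z0"] z t by (simp add: algebra_simps)
    ultimately show "f (z + 2 * pi) = f z" by (simp add: f_def)
  next
    fix e :: real assume e: "0 < e"
    define R where "R = max 1 (max (2 / (pi * e)) (2 * \<bar>r\<bar> / e))"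
    have R: "1 \<le> R" "2 / (pi * e) \<le> R" "2 * \<bar>r\<bar> / e \<le> R" by (auto simp: R_def)
    have "norm (f z - 1 / (2 * pi)) \<le> e" if z: "R \<le> Im z" for z
    proof -
      have 1: "norm (velocity t (z + z0) - 1 / (2 * pi)) \<le> 1 / (pi * Im (z + z0))"
        using z R z0 t by (intro velocity_near) auto
      also have "\<dots> \<le> 1 / (pi * R)"
        using z R z0 by (intro divide_left_mono mult_left_mono mult_pos_pos) auto
      also have "\<dots> \<le> e / 2" using R e by (simp add: field_simps)
      finally have 1: "norm (velocity t (z + z0) - 1 / (2 * pi)) \<le> e / 2" .
      have "exp R * exp (- Im z) \<le> 1" using z by (simp flip: exp_add)
      moreover have "R \<le> exp R" using exp_ge_add_one_self[of R] by linarith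
      ultimately have "R * exp (- Im z) \<le> 1"
        by (meson exp_ge_zero mult_right_mono order_trans)
      moreover have "2 * \<bar>r\<bar> * exp (- Im z) \<le> e * R * exp (- Im z)"
        using R e by (intro mult_right_mono) (auto simp: divide_le_eq mult.commute)
      moreover have "e * R * exp (- Im z) \<le> e"
        using e mult_left_mono[OF \<open>R * exp (- Im z) \<le> 1\<close>, of e] by (simp add: mult.assoc)
      ultimately have 2: "\<bar>r\<bar> * exp (- Im z) \<le> e / 2" by linarith
      have "f z - 1 / (2 * pi) = (velocity t (z + z0) - 1 / (2 * pi)) + of_real r * (- \<i> * exp (\<i> * (z - of_real x0)))"
        by (simp add: f_def)
      also have "norm \<dots> \<le> norm (velocity t (z + z0) - 1 / (2 * pi)) + norm (of_real r * (- \<i> * exp (\<i> * (z - of_real x0))))"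
        by (rule norm_triangle_ineq)
      also have "norm (of_real r * (- \<i> * exp (\<i> * (z - of_real x0)))) = \<bar>r\<bar> * exp (- Im z)"
        by (simp add: norm_mult)
      finally show ?thesis using 1 2 by simp
    qed
    then show "\<exists>R. \<forall>z. R \<le> Im z \<longrightarrow> norm (f z - 1 / (2 * pi)) \<le> e" by blast
  qed (rule z0)
  moreover have "Re (f (of_real x)) = Re (velocity t (of_real x + z0)) + r * sin (x - x0)" for x
  proof -
    have "exp (\<i> * (of_real x - of_real x0)) = cis (x - x0)" by (simp add: cis_conv_exp)
    then show ?thesis by (simp add: f_def)
  qed
  moreover have "Im (f (of_real x0)) = Im (velocity t (of_real x0 + z0)) - r" by (simp add: f_def)
  ultimately show ?thesis by simp
qed

text \<open>The perturbation by \<open>\<kappa>\<close> makes a maximum strict, up to translation by the period. It has zero gradient at the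
  contact point, so it enters the operator only through the Hilbert transform, with a factor \<open>\<kappa>\<close> that can be taken
  small compared with the gain \<open>pen' t0\<close>.\<close>

lemma perturbed_profile:
  fixes pen :: "real \<Rightarrow> real" and z0 :: complex and C :: real
  defines "\<phi> \<equiv> \<lambda>\<sigma> \<kappa> t0 x0 t x. profile z0 C t x + \<sigma> * (pen t + \<kappa> * ((t - t0)\<^sup>2 + (1 - cos (x - x0))))"
  assumes z0: "0 < Im z0"
    and smooth: "\<And>k S. Ck_on k S (\<lambda>(t, x). pen t)"
    and pen: "\<And>t. (pen has_real_derivative pen' t) (at t)"
  shows perturbed_profile_test: "test_function (\<phi> \<sigma> \<kappa> t0 x0)"
    and dyson_op_perturbed_profile: "0 < t0 \<Longrightarrow>
      dyson_op (\<phi> \<sigma> \<kappa> t0 x0) t0 x0 = \<sigma> * (pen' t0 - \<kappa> * Re (velocity t0 (of_real x0 + z0)))"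
proof -
  show "test_function (\<phi> \<sigma> \<kappa> t0 x0)"
    unfolding test_function_def smooth_on_def
  proof (intro conjI allI impI)
    fix k
    let ?S = "{0::real<..} \<times> (UNIV :: real set)"
    have "(\<lambda>(t, x). \<phi> \<sigma> \<kappa> t0 x0 t x) = (\<lambda>p. (\<lambda>(t, x). Re (potential t (of_real x + z0)) + C) p
      + \<sigma> * ((\<lambda>(t, x). pen t) p + \<kappa> * ((\<lambda>(t, x). 1 * (t - t0) ^ 2) p
        + ((\<lambda>(t, x). 1 * (t - t0) ^ 0) p + (- 1) * (\<lambda>(t, x). sin (x + (pi / 2 - x0))) p))))"
    proof
      fix p :: "real \<times> real"
      have "sin (snd p + (pi / 2 - x0)) = cos (snd p - x0)"
        using sin_cos_eq[of "snd p + (pi / 2 - x0)"] cos_minus[of "snd p - x0"] by simp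
      then show "(\<lambda>(t, x). \<phi> \<sigma> \<kappa> t0 x0 t x) p = (\<lambda>(t, x). Re (potential t (of_real x + z0)) + C) p
      + \<sigma> * ((\<lambda>(t, x). pen t) p + \<kappa> * ((\<lambda>(t, x). 1 * (t - t0) ^ 2) p
        + ((\<lambda>(t, x). 1 * (t - t0) ^ 0) p + (- 1) * (\<lambda>(t, x). sin (x + (pi / 2 - x0))) p)))"
        by (simp add: \<phi>_def case_prod_beta' profile_def)
    qed
    moreover have "Ck_on k ?S \<dots>"
      by (intro Ck_on_add Ck_on_scale potential_Ck_on z0 smooth Ck_on_time_power Ck_on_sin)
    ultimately show "Ck_on k ?S (\<lambda>(t, x). \<phi> \<sigma> \<kappa> t0 x0 t x)" by (simp only:)
  next
    fix t x :: real assume "0 < t"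
    moreover have "cos (x + 2 * pi - x0) = cos (x - x0)"
      using cos_periodic[of "x - x0"] by (simp add: algebra_simps)
    ultimately show "\<phi> \<sigma> \<kappa> t0 x0 t (x + 2 * pi) = \<phi> \<sigma> \<kappa> t0 x0 t x + 1"
      using profile_periodic[of t z0 C x] z0 by (simp add: \<phi>_def)
  qed
  assume t0: "0 < t0"
  define v where "v = velocity t0 (of_real x0 + z0)"
  have "((\<lambda>s. \<phi> \<sigma> \<kappa> t0 x0 s x0) has_real_derivative - (Re v * Im v) + \<sigma> * pen' t0) (at t0)"
    unfolding \<phi>_def v_def
    by (auto intro!: derivative_eq_intros profile_dt t0 z0 pen)
  then have dt: "deriv (\<lambda>s. \<phi> \<sigma> \<kappa> t0 x0 s x0) t0 = - (Re v * Im v) + \<sigma> * pen' t0"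
    by (rule DERIV_imp_deriv)
  have "(\<phi> \<sigma> \<kappa> t0 x0 t0 has_real_derivative Re (velocity t0 (of_real x + z0)) + \<sigma> * \<kappa> * sin (x - x0)) (at x)" for x
    unfolding \<phi>_def
    by (auto intro!: derivative_eq_intros profile_dx t0 z0)
  then have dx: "deriv (\<phi> \<sigma> \<kappa> t0 x0 t0) = (\<lambda>x. Re (velocity t0 (of_real x + z0)) + \<sigma> * \<kappa> * sin (x - x0))"
    by (intro ext DERIV_imp_deriv)
  show "dyson_op (\<phi> \<sigma> \<kappa> t0 x0) t0 x0 = \<sigma> * (pen' t0 - \<kappa> * Re (velocity t0 (of_real x0 + z0)))"
    unfolding dyson_op_def dt dx hilbert_velocity[OF t0 z0]
    by (simp add: v_def algebra_simps)
qed

text \<open>The comparison argument, common to sub- and supersolutions: \<open>D\<close> is \<open>F\<^sup>* - profile\<close> for \<open>\<sigma> = 1\<close>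
  and \<open>profile - F\<^sub>*\<close> for \<open>\<sigma> = - 1\<close>. If \<open>D\<close> were positive somewhere, then at its penalised maximum the
  perturbed profile would violate the viscosity inequality, because \<open>\<sigma> * dyson_op \<phi> = pen' t0 - \<kappa> * v > 0\<close>.\<close>

lemma no_positive_excess:
  fixes D :: "real \<times> real \<Rightarrow> real"
  assumes z0: "0 < Im z0" and \<sigma>: "\<sigma> = 1 \<or> \<sigma> = - 1"
    and usc: "\<And>p c. 0 < fst p \<Longrightarrow> D p < c \<Longrightarrow> \<forall>\<^sub>F q in nhds p. D q < c"
    and per: "\<And>t x. 0 < t \<Longrightarrow> D (t, x + 2 * pi) = D (t, x)"
    and init: "0 < \<tau>" "\<And>t x. 0 < t \<Longrightarrow> t < \<tau> \<Longrightarrow> D (t, x) \<le> 0"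
    and contact: "\<And>\<phi> t0 x0 M. test_function \<phi> \<Longrightarrow> 0 < t0 \<Longrightarrow>
      M = (\<lambda>t x. D (t, x) - \<sigma> * (\<phi> t x - profile z0 C t x)) \<Longrightarrow>
      (\<And>t x. 0 < t \<Longrightarrow> M t x \<le> M t0 x0) \<Longrightarrow>
      (\<And>t x. 0 < t \<Longrightarrow> M t x = M t0 x0 \<Longrightarrow> t = t0 \<and> (\<exists>k::int. x = x0 + 2 * pi * of_int k)) \<Longrightarrow>
      \<sigma> * dyson_op \<phi> t0 x0 \<le> 0"
    and t: "0 < t"
  shows "D (t, x) \<le> 0"
proof (rule ccontr)
  assume "\<not> D (t, x) \<le> 0"
  then have pos: "0 < D (t, x)" by simp
  obtain pen pen' t0 x0
    where smooth: "\<And>k S. Ck_on k S (\<lambda>(t, x). pen t)"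
      and pen: "\<And>t. (pen has_real_derivative pen' t) (at t)" "\<And>t. 0 < t \<Longrightarrow> 0 < pen' t"
      and t0: "0 < t0" and mx: "\<And>t x. 0 < t \<Longrightarrow> D (t, x) - pen t \<le> D (t0, x0) - pen t0"
    by (rule penalised_maximum[of D \<tau> t x]) (use usc per init t pos in \<open>auto simp del: split_paired_All\<close>)
  define v where "v = Re (velocity t0 (of_real x0 + z0))"
  have v: "0 < v" unfolding v_def using t0 z0 by (intro density_bounds) auto
  \<comment> \<open>Any positive \<open>\<kappa>\<close> with \<open>\<kappa> * v < pen' t0\<close> serves.\<close>
  define \<kappa> where "\<kappa> = pen' t0 / (1 + v)"
  have \<kappa>: "0 < \<kappa>" "\<kappa> * v < pen' t0"
    using pen(2)[OF t0] v by (auto simp: \<kappa>_def field_simps)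
  define \<phi> where "\<phi> = (\<lambda>t x. profile z0 C t x + \<sigma> * (pen t + \<kappa> * ((t - t0)\<^sup>2 + (1 - cos (x - x0)))))"
  define M where "M = (\<lambda>t x. D (t, x) - \<sigma> * (\<phi> t x - profile z0 C t x))"
  have \<sigma>2: "\<sigma> * (\<sigma> * r) = r" for r using \<sigma> by auto
  have M: "M t x = D (t, x) - pen t - \<kappa> * ((t - t0)\<^sup>2 + (1 - cos (x - x0)))" for t x
    by (simp add: M_def \<phi>_def \<sigma>2)
  have pen_nonneg: "0 \<le> (t - t0)\<^sup>2 + (1 - cos (x - x0))" for t x
    by (intro add_nonneg_nonneg) auto
  have "\<sigma> * dyson_op \<phi> t0 x0 \<le> 0"
  proof (rule contact[OF _ t0 M_def])
    show "test_function \<phi>" unfolding \<phi>_def by (rule perturbed_profile_test[OF z0 smooth pen(1)])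
    show "M t x \<le> M t0 x0" if "0 < t" for t x
      using mx[OF that, of x] mult_nonneg_nonneg[OF less_imp_le[OF \<kappa>(1)] pen_nonneg[of t x]]
      by (simp add: M)
    show "t = t0 \<and> (\<exists>k::int. x = x0 + 2 * pi * of_int k)" if "0 < t" "M t x = M t0 x0" for t x
    proof -
      have "\<kappa> * ((t - t0)\<^sup>2 + (1 - cos (x - x0))) \<le> 0"
        using mx[OF that(1), of x] that(2) by (simp add: M)
      then have "(t - t0)\<^sup>2 + (1 - cos (x - x0)) \<le> 0"
        using \<kappa>(1) by (simp add: mult_le_0_iff)
      then have "(t - t0)\<^sup>2 = 0" "cos (x - x0) = 1"
        using zero_le_power2[of "t - t0"] cos_le_one[of "x - x0"] by linarith+
      moreover from this(2) obtain k :: int where "x - x0 = of_int k * 2 * pi"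
        unfolding cos_one_2pi_int by blast
      ultimately show ?thesis by (auto intro!: exI[of _ k] simp: algebra_simps)
    qed
  qed
  moreover have "\<sigma> * dyson_op \<phi> t0 x0 = pen' t0 - \<kappa> * v"
    unfolding \<phi>_def v_def dyson_op_perturbed_profile[OF z0 smooth pen(1) t0] by (rule \<sigma>2)
  ultimately show False using \<kappa>(2) by simp
qed

text \<open>Stated for a general extended-real \<open>E\<close> to cover the upper envelopes of both \<open>F\<close> and \<open>- F\<close>.\<close>

lemma envelope_plus_profile_usc:
  fixes E :: "real \<Rightarrow> real \<Rightarrow> ereal"
  assumes z0: "0 < Im z0"
    and fin: "\<And>t x. 0 < t \<Longrightarrow> \<bar>E t x\<bar> \<noteq> \<infinity>"
    and usc: "\<And>t x c. E t x < c \<Longrightarrow> \<forall>\<^sub>F p in nhds (t, x). E (fst p) (snd p) < c"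
    and p: "0 < fst p"
    and c: "real_of_ereal (E (fst p) (snd p)) + s * profile z0 C (fst p) (snd p) < c"
  shows "\<forall>\<^sub>F q in nhds p. real_of_ereal (E (fst q) (snd q)) + s * profile z0 C (fst q) (snd q) < c"
proof -
  let ?e = "\<lambda>q. real_of_ereal (E (fst q) (snd q))"
  let ?g = "\<lambda>q. s * profile z0 C (fst q) (snd q)"
  define \<epsilon> where "\<epsilon> = (c - (?e p + ?g p)) / 2"
  have \<epsilon>: "0 < \<epsilon>" using c by (simp add: \<epsilon>_def)
  have "E (fst p) (snd p) < ereal (?e p + \<epsilon>)"
    using \<epsilon> fin[OF p, of "snd p"] by (cases "E (fst p) (snd p)") auto
  from usc[OF this] have 1: "\<forall>\<^sub>F q in nhds p. E (fst q) (snd q) < ereal (?e p + \<epsilon>)" by simp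
  have "open ({0::real<..} \<times> (UNIV :: real set))" by (intro open_Times) auto
  then have 2: "\<forall>\<^sub>F q in nhds p. q \<in> {0<..} \<times> UNIV"
    using p by (intro eventually_nhds_in_open) (auto simp: mem_Times_iff)
  have "((\<lambda>q. profile z0 C (fst q) (snd q)) has_derivative
    (\<lambda>(a, b). a * - (Re (velocity (fst p) (of_real (snd p) + z0)) * Im (velocity (fst p) (of_real (snd p) + z0)))
      + b * Re (velocity (fst p) (of_real (snd p) + z0)))) (at p)"
    using profile_has_derivative[OF p z0, of C "snd p"] by simp
  then have "isCont ?g p" by (intro continuous_intros) (rule has_derivative_continuous)
  then have "(?g \<longlongrightarrow> ?g p) (nhds p)"
    unfolding isCont_def by (subst (asm) tendsto_at_iff_tendsto_nhds)
  then have 3: "\<forall>\<^sub>F q in nhds p. ?g q < ?g p + \<epsilon>"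
    using \<epsilon> by (intro order_tendstoD(2)) auto
  from 1 2 3 show ?thesis
  proof eventually_elim
    case (elim q)
    have "\<bar>E (fst q) (snd q)\<bar> \<noteq> \<infinity>" using elim(2) by (intro fin) (simp add: mem_Times_iff)
    then have "?e q < ?e p + \<epsilon>" using elim(1) by (cases "E (fst q) (snd q)") auto
    then show ?case using elim(3) by (simp add: \<epsilon>_def field_simps)
  qed
qed

lemma usc_env_le_profile:
  assumes F: "viscosity_solution F" "\<And>t x. 0 \<le> t \<Longrightarrow> F t (x + 2 * pi) = F t x + 1"
    and z0: "0 < Im z0"
    and init: "0 < \<tau>" "\<And>t x. 0 < t \<Longrightarrow> t < \<tau> \<Longrightarrow> usc_env F t x \<le> ereal (profile z0 C t x)"
    and t: "0 < t"
  shows "usc_env F t x \<le> ereal (profile z0 C t x)"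
proof -
  have fin: "\<bar>usc_env F t x\<bar> \<noteq> \<infinity>" if "0 < t" for t x
    using F(1) that by (simp add: viscosity_solution_def)
  define e where "e = (\<lambda>t x. real_of_ereal (usc_env F t x))"
  have e: "usc_env F t x = ereal (e t x)" if "0 < t" for t x
    using fin[OF that] by (simp add: e_def ereal_real')
  define D where "D = (\<lambda>p. e (fst p) (snd p) + (- 1) * profile z0 C (fst p) (snd p))"
  have "D (t, x) \<le> 0"
  proof (rule no_positive_excess[OF z0, of 1 D \<tau>])
    show "\<forall>\<^sub>F q in nhds p. D q < c" if "0 < fst p" "D p < c" for p c
      unfolding D_def e_def
    proof (rule envelope_plus_profile_usc[OF z0])
      show "\<bar>usc_env F t x\<bar> \<noteq> \<infinity>" if "0 < t" for t x by (rule fin[OF that])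
    qed (use that usc_env_upper_semicontinuous in \<open>simp_all add: D_def e_def\<close>)
    show "D (t, x + 2 * pi) = D (t, x)" if "0 < t" for t x
      using usc_env_periodic[where F = F and c = 1 and x = x, OF F(2) that] profile_periodic[of t z0 C x] that z0
      by (simp add: D_def e)
    show "D (t, x) \<le> 0" if "0 < t" "t < \<tau>" for t x
      using init(2)[OF that] that by (simp add: D_def e)
    fix \<phi> t0 x0 M
    assume a: "test_function \<phi>" "0 < t0" "M = (\<lambda>t x. D (t, x) - 1 * (\<phi> t x - profile z0 C t x))"
      "\<And>t x. 0 < t \<Longrightarrow> M t x \<le> M t0 x0"
      "\<And>t x. 0 < t \<Longrightarrow> M t x = M t0 x0 \<Longrightarrow> t = t0 \<and> (\<exists>k::int. x = x0 + 2 * pi * of_int k)"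
    have "usc_env F t x - ereal (\<phi> t x) = ereal (M t x)" if "0 < t" for t x
      using that by (simp add: e a(3) D_def)
    then have "strict_global_max (\<lambda>t x. usc_env F t x - ereal (\<phi> t x)) t0 x0"
      using a(2,4,5) by (simp add: strict_global_max_def)
    then show "1 * dyson_op \<phi> t0 x0 \<le> 0"
      using F(1) a(1) by (simp add: viscosity_solution_def)
  qed (use init(1) t in auto)
  then show ?thesis using e[OF t] by (simp add: D_def)
qed

lemma profile_le_lsc_env:
  assumes F: "viscosity_solution F" "\<And>t x. 0 \<le> t \<Longrightarrow> F t (x + 2 * pi) = F t x + 1"
    and z0: "0 < Im z0"
    and init: "0 < \<tau>" "\<And>t x. 0 < t \<Longrightarrow> t < \<tau> \<Longrightarrow> ereal (profile z0 C t x) \<le> lsc_env F t x"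
    and t: "0 < t"
  shows "ereal (profile z0 C t x) \<le> lsc_env F t x"
proof -
  let ?N = "\<lambda>t x. - F t x"
  have fin: "\<bar>usc_env ?N t x\<bar> \<noteq> \<infinity>" if "0 < t" for t x
    using F(1) that by (auto simp: viscosity_solution_def lsc_env_eq_usc_env)
  define e where "e = (\<lambda>t x. real_of_ereal (usc_env ?N t x))"
  have e: "lsc_env F t x = ereal (- e t x)" if "0 < t" for t x
    using fin[OF that, of x] by (cases "usc_env ?N t x") (auto simp: e_def lsc_env_eq_usc_env)
  have per: "lsc_env F t (x + 2 * pi) = lsc_env F t x + 1" if "0 < t" for t x
  proof -
    have "usc_env ?N t (x + 2 * pi) = usc_env ?N t x + ereal (- 1)"
      by (rule usc_env_periodic[OF _ that]) (simp add: F(2))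
    then show ?thesis using fin[OF that, of x]
      by (cases "usc_env ?N t x") (auto simp: lsc_env_eq_usc_env one_ereal_def)
  qed
  define D where "D = (\<lambda>p. e (fst p) (snd p) + 1 * profile z0 C (fst p) (snd p))"
  have "D (t, x) \<le> 0"
  proof (rule no_positive_excess[OF z0, of "- 1" D \<tau>])
    show "\<forall>\<^sub>F q in nhds p. D q < c" if "0 < fst p" "D p < c" for p c
      unfolding D_def e_def
    proof (rule envelope_plus_profile_usc[OF z0])
      show "\<bar>usc_env ?N t x\<bar> \<noteq> \<infinity>" if "0 < t" for t x by (rule fin[OF that])
    qed (use that usc_env_upper_semicontinuous in \<open>simp_all add: D_def e_def\<close>)
    show "D (t, x + 2 * pi) = D (t, x)" if "0 < t" for t x
      using per[OF that, of x] profile_periodic[of t z0 C x] that z0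
      by (simp add: D_def e one_ereal_def)
    show "D (t, x) \<le> 0" if "0 < t" "t < \<tau>" for t x
      using init(2)[OF that, of x] that by (simp add: D_def e)
    fix \<phi> t0 x0 M
    assume a: "test_function \<phi>" "0 < t0" "M = (\<lambda>t x. D (t, x) - - 1 * (\<phi> t x - profile z0 C t x))"
      "\<And>t x. 0 < t \<Longrightarrow> M t x \<le> M t0 x0"
      "\<And>t x. 0 < t \<Longrightarrow> M t x = M t0 x0 \<Longrightarrow> t = t0 \<and> (\<exists>k::int. x = x0 + 2 * pi * of_int k)"
    have "lsc_env F t x - ereal (\<phi> t x) = ereal (- M t x)" if "0 < t" for t x
      using that by (simp add: e a(3) D_def)
    then have "strict_global_min (\<lambda>t x. lsc_env F t x - ereal (\<phi> t x)) t0 x0"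
      using a(2,4,5) by (simp add: strict_global_min_def)
    then show "- 1 * dyson_op \<phi> t0 x0 \<le> 0"
      using F(1) a(1) by (simp add: viscosity_solution_def)
  qed (use init(1) t in auto)
  then show ?thesis using e[OF t] by (simp add: D_def)
qed

end

section \<open>Approximation of the initial distribution function\<close>

lemma quasi_periodic_int:
  fixes f :: "real \<Rightarrow> real"
  assumes "\<And>x. f (x + 2 * pi) = f x + 1"
  shows "f (x + 2 * pi * of_int k) = f x + of_int k"
proof (induction k rule: int_induct[where k = 0])
  case (step1 i)
  then show ?case using assms[of "x + 2 * pi * of_int i"] by (simp add: algebra_simps)
next
  case (step2 i)
  then show ?case using assms[of "x + 2 * pi * of_int (i - 1)"] by (simp add: algebra_simps)
qed simp

lemma period_representative:
  fixes x :: real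
  obtains y k where "0 \<le> y" "y < 2 * pi" "x = y + 2 * pi * of_int k"
proof
  define k where "k = \<lfloor>x / (2 * pi)\<rfloor>"
  have "of_int k \<le> x / (2 * pi)" "x / (2 * pi) < of_int k + 1" by (auto simp: k_def)
  then show "0 \<le> x - 2 * pi * of_int k" "x - 2 * pi * of_int k < 2 * pi"
    by (auto simp: le_divide_eq divide_less_eq algebra_simps)
  show "x = x - 2 * pi * of_int k + 2 * pi * of_int k" by simp
qed

lemma atom_primitive_boundary:
  assumes a: "0 < a" "a < 2 * pi"
  shows "Re (atom_primitive (of_real a)) = 1 / 2" "isCont atom_primitive (of_real a)"
proof -
  define r \<theta> where "r = 2 * sin (a / 2)" and "\<theta> = (a - pi) / 2"
  have r: "0 < r" unfolding r_def using a by (simp add: sin_gt_zero)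
  have "cos a < 1" using a cos_monotone_0_pi[of 0 a] cos_monotone_0_pi[of 0 "2 * pi - a"]
    by (cases "a \<le> pi") auto
  then have "0 < Re (1 - exp (\<i> * of_real a))" by (simp add: Re_exp)
  then have n: "1 - exp (\<i> * complex_of_real a) \<notin> \<real>\<^sub>\<le>\<^sub>0"
    by (auto simp: complex_nonpos_Reals_iff)
  have th: "\<theta> = a / 2 - pi / 2" by (simp add: \<theta>_def field_simps)
  have cs: "cos \<theta> = sin (a / 2)" "sin \<theta> = - cos (a / 2)"
    unfolding th by (simp_all add: cos_diff sin_diff)
  have dbl: "cos a = 1 - 2 * (sin (a / 2))\<^sup>2" "sin a = 2 * sin (a / 2) * cos (a / 2)"
    using cos_double_sin[of "a / 2"] sin_double[of "a / 2"] by simp_all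
  have "Ln (1 - exp (\<i> * of_real a)) = of_real (ln r) + \<i> * of_real \<theta>"
  proof (rule Ln_unique)
    show "exp (of_real (ln r) + \<i> * of_real \<theta>) = 1 - exp (\<i> * complex_of_real a)"
      using r by (simp add: complex_eq_iff Re_exp Im_exp cs dbl) (simp add: r_def power2_eq_square)
  qed (use a in \<open>auto simp: \<theta>_def\<close>)
  then have "Im (Ln (1 - exp (\<i> * of_real a))) = \<theta>" by simp
  moreover have "2 * complex_of_real pi = of_real (2 * pi)" by simp
  then have "Re (atom_primitive (of_real a)) = (a - 2 * Im (Ln (1 - exp (\<i> * of_real a)))) / (2 * pi)"
    unfolding atom_primitive_def by (simp only: Re_divide_of_real) simp
  ultimately have "Re (atom_primitive (of_real a)) = (a - 2 * \<theta>) / (2 * pi)" by simp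
  also have "a - 2 * \<theta> = pi" by (simp add: \<theta>_def field_simps)
  finally show "Re (atom_primitive (of_real a)) = 1 / 2" by simp
  show "isCont atom_primitive (of_real a)"
    unfolding atom_primitive_def[abs_def]
    by (intro continuous_intros n) auto
qed

text \<open>As the height tends to \<open>0\<close>, the real part of \<open>atom_primitive\<close> tends to \<open>1 / 2\<close> on the open interval from
  \<open>0\<close> to \<open>2 * pi\<close>. By monotonicity and quasi-periodicity it is enough to have this at the two points \<open>a\<close>
  and \<open>2 * pi - a\<close>.\<close>

lemma atom_primitive_near_floor:
  fixes a b :: real
  assumes a: "0 < a" "a < pi" and b: "0 < b"
  obtains h where "0 < h"
    "\<And>x. real_of_int \<lfloor>(x - a) / (2 * pi)\<rfloor> - b \<le> Re (atom_primitive (of_real x + \<i> * of_real h)) - 1 / 2"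
    "\<And>x. Re (atom_primitive (of_real x + \<i> * of_real h)) - 1 / 2 \<le> real_of_int \<lfloor>(x + a) / (2 * pi)\<rfloor> + b"
proof -
  interpret atom: herglotz atom_kernel atom_primitive by (rule herglotz_atom)
  have near: "\<forall>\<^sub>F h in at_right 0. \<bar>Re (atom_primitive (of_real x + \<i> * of_real h)) - 1 / 2\<bar> < b"
    if x: "0 < x" "x < 2 * pi" for x
  proof -
    have "((\<lambda>h. of_real x + \<i> * complex_of_real h) \<longlongrightarrow> of_real x + \<i> * complex_of_real 0) (at_right 0)"
      by (intro tendsto_intros)
    then have "((\<lambda>h. of_real x + \<i> * complex_of_real h) \<longlongrightarrow> of_real x) (at_right 0)" by simp
    from isCont_tendsto_compose[OF atom_primitive_boundary(2)[OF x] this]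
    have "((\<lambda>h. Re (atom_primitive (of_real x + \<i> * of_real h))) \<longlongrightarrow> 1 / 2) (at_right 0)"
      using tendsto_Re atom_primitive_boundary(1)[OF x] by metis
    from tendstoD[OF this b] show ?thesis by (simp add: dist_real_def)
  qed
  have "\<forall>\<^sub>F h in at_right (0::real). 0 < h" by (rule eventually_at_right_less)
  moreover have "\<forall>\<^sub>F h in at_right 0. \<bar>Re (atom_primitive (of_real a + \<i> * of_real h)) - 1 / 2\<bar> < b"
    using a by (intro near) auto
  moreover have "\<forall>\<^sub>F h in at_right 0. \<bar>Re (atom_primitive (of_real (2 * pi - a) + \<i> * of_real h)) - 1 / 2\<bar> < b"
    using a by (intro near) auto
  ultimately have "\<forall>\<^sub>F h in at_right 0. 0 < h \<and> \<bar>Re (atom_primitive (of_real a + \<i> * of_real h)) - 1 / 2\<bar> < b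
      \<and> \<bar>Re (atom_primitive (of_real (2 * pi - a) + \<i> * of_real h)) - 1 / 2\<bar> < b"
    by eventually_elim auto
  then obtain h where h: "0 < h" "\<bar>Re (atom_primitive (of_real a + \<i> * of_real h)) - 1 / 2\<bar> < b"
      "\<bar>Re (atom_primitive (of_real (2 * pi - a) + \<i> * of_real h)) - 1 / 2\<bar> < b"
    using eventually_happens[of _ "at_right (0::real)"] by auto
  define s where "s = (\<lambda>x. Re (atom_primitive (of_real x + \<i> * of_real h)))"
  have per: "s (x + 2 * pi) = s x + 1" for x
    using atom.P0_periodic[of "of_real x + \<i> * of_real h"] h(1) by (simp add: s_def algebra_simps)
  have "((\<lambda>x. Re (atom_primitive (of_real x + \<i> * of_real h))) has_real_derivative
      Re (atom_kernel (of_real x + \<i> * of_real h))) (at x)" for x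
  proof -
    have "((\<lambda>x. of_real x + \<i> * of_real h) has_vector_derivative 1) (at x)"
      by (auto intro!: derivative_eq_intros simp: has_vector_derivative_def scaleR_conv_of_real fun_eq_iff)
    from field_vector_diff_chain_at[OF this atom.P0_deriv] h(1)
    have "((\<lambda>x. atom_primitive (of_real x + \<i> * of_real h)) has_vector_derivative
        atom_kernel (of_real x + \<i> * of_real h)) (at x)" by (simp add: o_def)
    then show ?thesis
      using has_vector_derivative_def has_derivative_Re has_field_derivative_def
      by (auto simp: has_vector_derivative_def has_field_derivative_def mult_commute_abs dest!: has_derivative_Re)
  qed
  moreover have "0 \<le> Re (atom_kernel (of_real x + \<i> * of_real h))" for x
    using Re_atom_kernel_pos[of "of_real x + \<i> * of_real h"] h(1) by simp
  ultimately have mono: "s x \<le> s y" if "x \<le> y" for x y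
    unfolding s_def using DERIV_nonneg_imp_nondecreasing[OF that] by blast
  show ?thesis
  proof (rule that[OF h(1)])
    fix x
    show "real_of_int \<lfloor>(x - a) / (2 * pi)\<rfloor> - b \<le> Re (atom_primitive (of_real x + \<i> * of_real h)) - 1 / 2"
    proof -
      define k where "k = \<lfloor>(x - a) / (2 * pi)\<rfloor>"
      have "of_int k \<le> (x - a) / (2 * pi)" by (simp add: k_def)
      then have "a + 2 * pi * of_int k \<le> x" by (simp add: le_divide_eq mult.commute)
      from mono[OF this] have "s a + of_int k \<le> s x" by (simp add: quasi_periodic_int[of s, OF per])
      then show ?thesis using h(2) by (simp add: k_def s_def)
    qed
    show "Re (atom_primitive (of_real x + \<i> * of_real h)) - 1 / 2 \<le> real_of_int \<lfloor>(x + a) / (2 * pi)\<rfloor> + b"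
    proof -
      define k where "k = \<lfloor>(x + a) / (2 * pi)\<rfloor>"
      have "(x + a) / (2 * pi) < of_int k + 1" by (simp add: k_def)
      then have "x \<le> (2 * pi - a) + 2 * pi * of_int k" by (simp add: divide_less_eq algebra_simps)
      from mono[OF this] have "s x \<le> s (2 * pi - a) + of_int k" by (simp add: quasi_periodic_int[of s, OF per])
      then show ?thesis using h(3) by (simp add: k_def s_def)
    qed
  qed
qed

text \<open>The distribution function of \<open>n\<close> atoms on an equidistant grid, each carrying the mass that \<open>F0\<close> gives to
  the grid cell on its right; on that cell the sum takes the value of \<open>F0\<close> at the right end point.\<close>

lemma step_function_between:
  fixes F0 :: "real \<Rightarrow> real" and n :: nat
  assumes mono: "mono F0" and per: "\<And>x. F0 (x + 2 * pi) = F0 x + 1" and n: "0 < n"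
  defines "\<delta> \<equiv> 2 * pi / n"
  defines "S \<equiv> \<lambda>x. F0 0 + 1 + (\<Sum>i<n. (F0 (\<delta> * Suc i) - F0 (\<delta> * i)) * real_of_int \<lfloor>(x - \<delta> * i) / (2 * pi)\<rfloor>)"
  shows "F0 x \<le> S x" "S x \<le> F0 (x + \<delta>)"
proof -
  define c where "c = (\<lambda>i::nat. F0 (\<delta> * Suc i) - F0 (\<delta> * i))"
  have \<delta>: "0 < \<delta>" "\<delta> * n = 2 * pi" using n by (auto simp: \<delta>_def)
  have tel: "(\<Sum>i\<in>{j..<n}. c i) = F0 (\<delta> * n) - F0 (\<delta> * j)" if "j \<le> n" for j
    unfolding c_def using sum_Suc_diff'[OF that, of "\<lambda>i. F0 (\<delta> * i)"] by simp
  have F2: "F0 (2 * pi) = F0 0 + 1" using per[of 0] by simp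
  have sumc: "sum c {..<n} = 1" using tel[of 0] F2 by (simp add: \<delta>(2) atLeast0LessThan)
  have S: "S x = F0 0 + 1 + (\<Sum>i<n. c i * real_of_int \<lfloor>(x - \<delta> * i) / (2 * pi)\<rfloor>)" for x
    by (simp add: S_def c_def)
  have Sper: "S (x + 2 * pi) = S x + 1" for x
  proof -
    have "(x + 2 * pi - \<delta> * i) / (2 * pi) = (x - \<delta> * i) / (2 * pi) + 1" for i :: nat by (simp add: field_simps)
    then show ?thesis by (simp add: S ring_distribs sum.distrib sumc)
  qed
  have base: "F0 y \<le> S y \<and> S y \<le> F0 (y + \<delta>)" if y: "0 \<le> y" "y < 2 * pi" for y
  proof -
    define j where "j = nat \<lfloor>y / \<delta>\<rfloor>"
    have "0 \<le> y / \<delta>" using y \<delta> by simp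
    then have "real j \<le> y / \<delta>" "y / \<delta> < real j + 1" by (auto simp: j_def)
    then have j: "\<delta> * j \<le> y" "y < \<delta> * Suc j" using \<delta> by (auto simp: field_simps)
    have "\<delta> * j < \<delta> * n" using j y \<delta> by linarith
    then have jn: "j < n" using \<delta>(1) by simp
    have fl: "\<lfloor>(y - \<delta> * i) / (2 * pi)\<rfloor> = (if i \<le> j then 0 else - 1)" if "i < n" for i
    proof (cases "i \<le> j")
      case True
      then have "\<delta> * i \<le> \<delta> * j" using \<delta> by simp
      moreover have "0 \<le> \<delta> * i" using \<delta> by simp
      ultimately have "0 \<le> (y - \<delta> * i) / (2 * pi)" "(y - \<delta> * i) / (2 * pi) < 1" using j y by auto
      then show ?thesis using True by (simp add: floor_eq_iff)
    next
      case False
      then have "\<delta> * Suc j \<le> \<delta> * i" using \<delta> by (intro mult_left_mono) auto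
      moreover have "\<delta> * i < 2 * pi" using that \<delta> by (metis mult_less_cancel_left_pos of_nat_less_iff)
      ultimately have "- 1 \<le> (y - \<delta> * i) / (2 * pi)" "(y - \<delta> * i) / (2 * pi) < 0"
        using j y by (auto simp: le_divide_eq divide_less_eq)
      then show ?thesis using False by (simp add: floor_eq_iff)
    qed
    have "(\<Sum>i<n. c i * real_of_int \<lfloor>(y - \<delta> * i) / (2 * pi)\<rfloor>) = (\<Sum>i<n. if i \<le> j then 0 else - c i)"
      by (intro sum.cong refl) (auto simp: fl)
    also have "\<dots> = - (\<Sum>i\<in>{Suc j..<n}. c i)"
    proof -
      have "(\<Sum>i<n. if i \<le> j then 0 else - c i) = (\<Sum>i\<in>{Suc j..<n}. - c i)"
        by (rule sum.mono_neutral_cong_right) auto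
      then show ?thesis by (simp add: sum_negf)
    qed
    also have "\<dots> = F0 (\<delta> * Suc j) - F0 (2 * pi)"
      using tel[of "Suc j"] jn by (simp add: \<delta>(2))
    finally have "S y = F0 (\<delta> * Suc j)" by (simp add: S F2)
    moreover have "\<delta> * Suc j \<le> y + \<delta>" using j by (simp add: algebra_simps)
    ultimately show ?thesis using j monoD[OF mono] by (simp add: less_imp_le)
  qed
  obtain y k where y: "0 \<le> y" "y < 2 * pi" "x = y + 2 * pi * of_int k" by (rule period_representative)
  have "F0 (x + \<delta>) = F0 (y + \<delta>) + of_int k"
    using quasi_periodic_int[of F0, OF per, of "y + \<delta>" k] y(3) by (simp add: algebra_simps)
  then show "F0 x \<le> S x" "S x \<le> F0 (x + \<delta>)"
    using base[OF y(1,2)] quasi_periodic_int[of F0, OF per] quasi_periodic_int[of S, OF Sper] y(3) by auto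
qed

text \<open>Spreading the mass over a grid costs one grid length horizontally; raising the atoms to the height \<open>h\<close> costs
  \<open>a\<close> horizontally and \<open>e\<close> vertically.\<close>

lemma initial_approximation:
  fixes F0 :: "real \<Rightarrow> real"
  assumes mono: "mono F0" and per: "\<And>x. F0 (x + 2 * pi) = F0 x + 1" and e: "0 < e"
  obtains f0 P0 h where "herglotz f0 P0" "0 < h"
    "\<And>x. F0 (x - e) - e \<le> Re (P0 (of_real x + \<i> * of_real h))"
    "\<And>x. Re (P0 (of_real x + \<i> * of_real h)) \<le> F0 (x + e) + e"
proof -
  \<comment> \<open>The cut-off at \<open>1\<close> keeps \<open>a\<close> below \<open>pi\<close>.\<close>
  define a where "a = min (e / 2) 1"
  have a: "0 < a" "a < pi" "a \<le> e / 2" using e pi_gt3 by (auto simp: a_def)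
  obtain n :: nat where n0: "4 * pi / e < real n" using reals_Archimedean2 by blast
  have "0 < 4 * pi / e" using e by simp
  then have n: "0 < n" using n0 by (cases n) auto
  define \<delta> where "\<delta> = 2 * pi / n"
  have \<delta>: "0 < \<delta>" "\<delta> \<le> e / 2" using n0 n e by (auto simp: \<delta>_def field_simps)
  define c where "c = (\<lambda>i::nat. F0 (\<delta> * Suc i) - F0 (\<delta> * i))"
  define S where "S = (\<lambda>x. F0 0 + 1 + (\<Sum>i<n. c i * real_of_int \<lfloor>(x - \<delta> * i) / (2 * pi)\<rfloor>))"
  have c: "0 \<le> c i" for i
    using monoD[OF mono, of "\<delta> * i" "\<delta> * Suc i"] \<delta> by (simp add: c_def)
  have "sum c {..<n} = F0 (\<delta> * n) - F0 (\<delta> * 0)"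
    unfolding c_def using sum_lessThan_telescope[of "\<lambda>i. F0 (\<delta> * i)" n] by simp
  also have "\<dots> = 1" using per[of 0] n by (simp add: \<delta>_def)
  finally have sumc: "sum c {..<n} = 1" .
  have S: "F0 x \<le> S x" "S x \<le> F0 (x + \<delta>)" for x
    using step_function_between[OF mono per n, of x] by (auto simp: S_def c_def \<delta>_def)
  obtain h where h: "0 < h"
    "\<And>x. real_of_int \<lfloor>(x - a) / (2 * pi)\<rfloor> - e \<le> Re (atom_primitive (of_real x + \<i> * of_real h)) - 1 / 2"
    "\<And>x. Re (atom_primitive (of_real x + \<i> * of_real h)) - 1 / 2 \<le> real_of_int \<lfloor>(x + a) / (2 * pi)\<rfloor> + e"
    using atom_primitive_near_floor[OF a(1,2) e] by metis
  define f0 where "f0 = (\<lambda>z. \<Sum>i<n. of_real (c i) * atom_kernel (z - of_real (\<delta> * i)))"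
  define P0 where "P0 = (\<lambda>z. (\<Sum>i<n. of_real (c i) * atom_primitive (z - of_real (\<delta> * i))) + of_real (F0 0 + 1 - 1 / 2))"
  have hg: "herglotz f0 P0" unfolding f0_def P0_def
    by (rule herglotz_combination[where y = "\<lambda>i. \<delta> * real i"]) (auto intro: c sumc herglotz_atom)
  have ReP: "Re (P0 (of_real x + \<i> * of_real h))
      = F0 0 + 1 + (\<Sum>i<n. c i * (Re (atom_primitive (of_real (x - \<delta> * i) + \<i> * of_real h)) - 1 / 2))" for x
  proof -
    have "of_real x + \<i> * of_real h - of_real (\<delta> * i) = of_real (x - \<delta> * i) + \<i> * complex_of_real h" for i :: nat
      by simp
    note shift = this
    have "Re (P0 (of_real x + \<i> * of_real h))
      = (\<Sum>i<n. c i * Re (atom_primitive (of_real (x - \<delta> * i) + \<i> * of_real h))) + (F0 0 + 1 - 1 / 2)"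
      unfolding P0_def shift by simp
    then show ?thesis
      by (simp add: right_diff_distrib sum_subtractf sumc flip: sum_divide_distrib)
  qed
  have sc: "(\<Sum>i<n. c i * (r i + e)) = (\<Sum>i<n. c i * r i) + e" "(\<Sum>i<n. c i * (r i - e)) = (\<Sum>i<n. c i * r i) - e" for r
    by (simp_all add: ring_distribs sum.distrib sum_subtractf sumc flip: sum_distrib_right)
  show ?thesis
  proof (rule that[OF hg h(1)])
    fix x
    have sw: "x - a - \<delta> * i = x - \<delta> * i - a" "x + a - \<delta> * i = x - \<delta> * i + a" for i :: nat
      by simp_all
    have "F0 (x - e) \<le> S (x - a)"
      using S(1)[of "x - a"] monoD[OF mono, of "x - e" "x - a"] a e by linarith
    also have "S (x - a) - e = F0 0 + 1 + (\<Sum>i<n. c i * (real_of_int \<lfloor>(x - \<delta> * i - a) / (2 * pi)\<rfloor> - e))"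
      unfolding S_def sw sc by simp
    also have "\<dots> \<le> Re (P0 (of_real x + \<i> * of_real h))"
      unfolding ReP by (intro add_left_mono sum_mono mult_left_mono c h)
    finally show "F0 (x - e) - e \<le> Re (P0 (of_real x + \<i> * of_real h))" by simp
    have "Re (P0 (of_real x + \<i> * of_real h)) \<le> F0 0 + 1 + (\<Sum>i<n. c i * (real_of_int \<lfloor>(x - \<delta> * i + a) / (2 * pi)\<rfloor> + e))"
      unfolding ReP by (intro add_left_mono sum_mono mult_left_mono c h)
    also have "\<dots> = S (x + a) + e"
      unfolding S_def sw sc by simp
    also have "S (x + a) \<le> F0 (x + e)"
      using S(2)[of "x + a"] monoD[OF mono, of "x + a + \<delta>" "x + e"] a \<delta> by linarith
    finally show "Re (P0 (of_real x + \<i> * of_real h)) \<le> F0 (x + e) + e" by simp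
  qed
qed

text \<open>Pointwise convergence at continuity points is turned into a uniform statement by monotonicity. Continuity
  points are dense, so each cell of a fine grid contains one; finitely many of them control a whole period.\<close>

lemma initial_layer:
  fixes F :: "real \<Rightarrow> real \<Rightarrow> real"
  assumes mono: "\<And>t. 0 \<le> t \<Longrightarrow> mono (F t)" and per: "\<And>t x. 0 \<le> t \<Longrightarrow> F t (x + 2 * pi) = F t x + 1"
    and lim: "\<And>x. isCont (F 0) x \<Longrightarrow> ((\<lambda>t. F t x) \<longlongrightarrow> F 0 x) (at_right 0)" and e: "0 < e"
  obtains \<tau> where "0 < \<tau>"
    "\<And>t x. 0 < t \<Longrightarrow> t < \<tau> \<Longrightarrow> F 0 (x - e) - e \<le> F t x \<and> F t x \<le> F 0 (x + e) + e"
proof -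
  define \<delta> where "\<delta> = e / 2"
  have \<delta>: "0 < \<delta>" using e by (simp add: \<delta>_def)
  have "\<exists>p. \<delta> * of_int j < p \<and> p < \<delta> * (of_int j + 1) \<and> isCont (F 0) p" for j :: int
    using open_minus_countable[OF mono_ctble_discont[OF mono[of 0]], of "{\<delta> * of_int j<..<\<delta> * (of_int j + 1)}"] \<delta>
    by auto
  then obtain p where p: "\<And>j::int. \<delta> * of_int j < p j" "\<And>j. p j < \<delta> * (of_int j + 1)" "\<And>j. isCont (F 0) (p j)"
    by metis
  define N where "N = \<lceil>2 * pi / \<delta>\<rceil>"
  have "\<forall>\<^sub>F t in at_right 0. \<forall>j\<in>{- 1..N}. dist (F t (p j)) (F 0 (p j)) < e"
    using tendstoD[OF lim[OF p(3)] e] by (intro eventually_ball_finite) auto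
  then obtain \<tau> where \<tau>: "0 < \<tau>"
    "\<And>t j. 0 < t \<Longrightarrow> t < \<tau> \<Longrightarrow> j \<in> {- 1..N} \<Longrightarrow> dist (F t (p j)) (F 0 (p j)) < e"
    unfolding eventually_at_right_field by auto
  show ?thesis
  proof (rule that[OF \<tau>(1)])
    fix t x assume t: "0 < t" "t < \<tau>"
    obtain y k where y: "0 \<le> y" "y < 2 * pi" "x = y + 2 * pi * of_int k" by (rule period_representative)
    define j where "j = \<lfloor>y / \<delta>\<rfloor>"
    have "of_int j \<le> y / \<delta>" "y / \<delta> < of_int j + 1" by (auto simp: j_def)
    then have j: "\<delta> * of_int j \<le> y" "y < \<delta> * (of_int j + 1)" using \<delta> by (auto simp: field_simps)
    have "0 \<le> j" using y \<delta> by (simp add: j_def)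
    moreover have "j + 1 \<le> N"
    proof -
      have "y / \<delta> < 2 * pi / \<delta>" using y \<delta> by (intro divide_strict_right_mono)
      then have "of_int j < 2 * pi / \<delta>" using \<open>of_int j \<le> y / \<delta>\<close> by linarith
      then show ?thesis by (simp add: N_def less_ceiling_iff add1_zle_eq)
    qed
    ultimately have jN: "j + 1 \<in> {- 1..N}" "j - 1 \<in> {- 1..N}" by auto
    have m: "F s u \<le> F s v" if "u \<le> v" "0 \<le> s" for s u v using monoD[OF mono[OF that(2)] that(1)] .
    have 1: "p (j + 1) \<le> y + e" "y \<le> p (j + 1)"
      using p(1)[of "j + 1"] p(2)[of "j + 1"] j by (auto simp: algebra_simps \<delta>_def)
    have 2: "y - e \<le> p (j - 1)" "p (j - 1) \<le> y"
      using p(1)[of "j - 1"] p(2)[of "j - 1"] j by (auto simp: algebra_simps \<delta>_def)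
    have "F t y \<le> F 0 (y + e) + e"
      using m[OF 1(2), of t] m[OF 1(1), of 0] \<tau>(2)[OF t jN(1)] t by (simp add: dist_real_def)
    moreover have "F 0 (y - e) - e \<le> F t y"
      using m[OF 2(2), of t] m[OF 2(1), of 0] \<tau>(2)[OF t jN(2)] t by (simp add: dist_real_def)
    moreover have "F s (y + d + 2 * pi * of_int k) = F s (y + d) + of_int k" if "0 \<le> s" for s d
      by (rule quasi_periodic_int) (rule per[OF that])
    from this[of t 0] this[of 0 e] this[of 0 "- e"]
    have "F t x = F t y + of_int k" "F 0 (x + e) = F 0 (y + e) + of_int k" "F 0 (x - e) = F 0 (y - e) + of_int k"
      using t y(3) by (auto simp: algebra_simps)
    ultimately show "F 0 (x - e) - e \<le> F t x \<and> F t x \<le> F 0 (x + e) + e" by simp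
  qed
qed

context herglotz
begin

lemma profile_increment:
  assumes t: "0 < t" and z0: "0 < Im z0"
  shows "\<bar>profile z0 C t x - profile z0 C t y - (x - y) / (2 * pi)\<bar> \<le> 2 / t * \<bar>x - y\<bar>"
proof -
  define W where "W = (\<lambda>x. profile z0 C t x - x / (2 * pi))"
  have "norm (W x - W y) \<le> 2 / t * norm (x - y)"
  proof (rule field_differentiable_bound[of UNIV W "\<lambda>x. Re (velocity t (of_real x + z0)) - 1 / (2 * pi)"])
    show "(W has_real_derivative Re (velocity t (of_real x + z0)) - 1 / (2 * pi)) (at x within UNIV)" for x
      unfolding W_def by (auto intro!: derivative_eq_intros profile_dx t z0)
    show "norm (Re (velocity t (of_real x + z0)) - 1 / (2 * pi)) \<le> 2 / t" for x
      using density_bounds(2)[OF t, of "of_real x + z0"] z0 by simp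
  qed auto
  then show ?thesis by (simp add: W_def diff_divide_distrib algebra_simps)
qed

lemma profile_shift: "profile (of_real s + z0) C t x = profile z0 0 t (x + s) + C"
  by (simp add: profile_def algebra_simps)

end

lemma usc_env_le:
  assumes "\<forall>\<^sub>F p in nhds (t, x). F (fst p) (snd p) \<le> c"
  shows "usc_env F t x \<le> ereal c"
  unfolding usc_env_def using assms by (intro Limsup_bounded) (auto elim: eventually_mono)

text \<open>The profiles are shifted by \<open>3 * e\<close> in both directions, because three errors of size \<open>e\<close> accumulate in each:
  horizontally from the initial approximation, the initial layer and the passage to the envelope; vertically from the initial
  approximation, the initial layer and the change of the profile between time \<open>0\<close> and a small time.\<close>

lemma integrated_solution_increment:
  assumes F: "integrated_solution u F" and t: "0 < t" and xy: "y \<le> x"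
  shows "\<bar>F t x - F t y - (x - y) / (2 * pi)\<bar> \<le> 2 / t * (x - y)"
proof -
  have mono: "mono (F t)" and per: "F t (x + 2 * pi) = F t x + 1" if "0 \<le> t" for t x
    using F that by (auto simp: integrated_solution_def)
  have lim: "((\<lambda>t. F t x) \<longlongrightarrow> F 0 x) (at_right 0)" if "isCont (F 0) x" for x
    using F that by (auto simp: integrated_solution_def)
  have vis: "viscosity_solution F" using F by (simp add: integrated_solution_def)
  have main: "\<bar>F t x - F t y - (x - y) / (2 * pi)\<bar> \<le> 2 / t * (x - y) + e * (6 * (1 / (2 * pi) + 2 / t) + 6)"
    if e: "0 < e" for e
  proof -
    have m0: "F 0 a \<le> F 0 b" if "a \<le> b" for a b using monoD[OF mono[of 0] that] by simp
    obtain f0 P0 h where hg: "herglotz f0 P0" and h: "0 < h"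
      and low: "\<And>x. F 0 (x - e) - e \<le> Re (P0 (of_real x + \<i> * of_real h))"
      and upp: "\<And>x. Re (P0 (of_real x + \<i> * of_real h)) \<le> F 0 (x + e) + e"
      using initial_approximation[OF mono[of 0] per[of 0] e] by auto
    interpret herglotz f0 P0 by (rule hg)
    obtain \<tau>1 where \<tau>1: "0 < \<tau>1"
      "\<And>t x. 0 < t \<Longrightarrow> t < \<tau>1 \<Longrightarrow> F 0 (x - e) - e \<le> F t x \<and> F t x \<le> F 0 (x + e) + e"
      using initial_layer[OF mono per lim e] by metis
    define B where "B = f0_bound h"
    have B: "0 < B" using f0_bound_pos[OF h] by (simp add: B_def)
    \<comment> \<open>Up to this time the profile differs from its initial value by at most \<open>2 * \<tau> * B\<^sup>2 \<le> e\<close>.\<close>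
    define \<tau> where "\<tau> = min \<tau>1 (e / (2 * B\<^sup>2))"
    have \<tau>: "0 < \<tau>" "\<tau> \<le> \<tau>1" "\<tau> \<le> e / (2 * B\<^sup>2)" using \<tau>1 e B by (auto simp: \<tau>_def)
    define V where "V = profile (\<i> * of_real h) 0"
    have init: "\<bar>V s x - Re (P0 (of_real x + \<i> * of_real h))\<bar> \<le> e" if "0 < s" "s < \<tau>" for s x
    proof -
      have "\<bar>V s x - Re (P0 (of_real x + \<i> * of_real h))\<bar>
          \<le> norm (potential s (of_real x + \<i> * of_real h) - P0 (of_real x + \<i> * of_real h))"
        unfolding V_def profile_def using abs_Re_le_cmod[of "potential s (of_real x + \<i> * of_real h) - P0 (of_real x + \<i> * of_real h)"] by simp
      also have "\<dots> \<le> 2 * s * B\<^sup>2" unfolding B_def using that h by (intro potential_near_initial) auto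
      also have "\<dots> \<le> e"
      proof -
        have "s \<le> e / (2 * B\<^sup>2)" using that \<tau> by simp
        then show ?thesis using B by (simp add: field_simps)
      qed
      finally show ?thesis .
    qed
    have nb: "\<forall>\<^sub>F p in nhds (s, w). 0 < fst p \<and> fst p < \<tau> \<and> w - e < snd p \<and> snd p < w + e"
      if "0 < s" "s < \<tau>" for s w :: real
    proof -
      have "open ({0<..<\<tau>} \<times> {w - e<..<w + e})" by (intro open_Times) auto
      then have "\<forall>\<^sub>F p in nhds (s, w). p \<in> {0<..<\<tau>} \<times> {w - e<..<w + e}"
        using that e by (intro eventually_nhds_in_open) auto
      then show ?thesis by eventually_elim (auto simp: mem_Times_iff)
    qed
    have up: "usc_env F s w \<le> ereal (profile (of_real (3 * e) + \<i> * of_real h) (3 * e) s w)" if "0 < s" for s w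
    proof (rule usc_env_le_profile[OF vis per _ \<tau>(1) _ that])
      show "0 < Im (of_real (3 * e) + \<i> * of_real h)" using h by simp
      fix s w :: real assume s: "0 < s" "s < \<tau>"
      have "\<forall>\<^sub>F p in nhds (s, w). F (fst p) (snd p) \<le> F 0 (w + 2 * e) + e"
        using nb[OF s, of w]
      proof eventually_elim
        case (elim p)
        then have "F (fst p) (snd p) \<le> F 0 (snd p + e) + e" using \<tau>1(2)[of "fst p" "snd p"] \<tau> by simp
        also have "F 0 (snd p + e) \<le> F 0 (w + 2 * e)" using elim by (intro m0) auto
        finally show ?case by simp
      qed
      then have "usc_env F s w \<le> ereal (F 0 (w + 2 * e) + e)" by (rule usc_env_le)
      also have "F 0 (w + 2 * e) + e \<le> profile (of_real (3 * e) + \<i> * of_real h) (3 * e) s w"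
        using low[of "w + 3 * e"] init[OF s, of "w + 3 * e"] unfolding profile_shift by (simp add: V_def algebra_simps)
      finally show "usc_env F s w \<le> ereal (profile (of_real (3 * e) + \<i> * of_real h) (3 * e) s w)" by simp
    qed
    have lo: "ereal (profile (of_real (- 3 * e) + \<i> * of_real h) (- 3 * e) s w) \<le> lsc_env F s w" if "0 < s" for s w
    proof (rule profile_le_lsc_env[OF vis per _ \<tau>(1) _ that])
      show "0 < Im (of_real (- 3 * e) + \<i> * of_real h)" using h by simp
      fix s w :: real assume s: "0 < s" "s < \<tau>"
      have "\<forall>\<^sub>F p in nhds (s, w). - F (fst p) (snd p) \<le> - (F 0 (w - 2 * e) - e)"
        using nb[OF s, of w]
      proof eventually_elim
        case (elim p)
        then have "F 0 (snd p - e) - e \<le> F (fst p) (snd p)" using \<tau>1(2)[of "fst p" "snd p"] \<tau> by simp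
        moreover have "F 0 (w - 2 * e) \<le> F 0 (snd p - e)" using elim by (intro m0) auto
        ultimately show ?case by simp
      qed
      then have "usc_env (\<lambda>t x. - F t x) s w \<le> ereal (- (F 0 (w - 2 * e) - e))" by (rule usc_env_le)
      then have "ereal (F 0 (w - 2 * e) - e) \<le> lsc_env F s w"
        unfolding lsc_env_eq_usc_env by (metis ereal_minus_le_minus ereal_uminus_uminus uminus_ereal.simps(1))
      moreover have "profile (of_real (- 3 * e) + \<i> * of_real h) (- 3 * e) s w \<le> F 0 (w - 2 * e) - e"
        using upp[of "w - 3 * e"] init[OF s, of "w - 3 * e"] unfolding profile_shift by (simp add: V_def algebra_simps)
      ultimately show "ereal (profile (of_real (- 3 * e) + \<i> * of_real h) (- 3 * e) s w) \<le> lsc_env F s w"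
        by (meson ereal_less_eq(3) order_trans)
    qed
    have sandwich: "V t (w - 3 * e) - 3 * e \<le> F t w \<and> F t w \<le> V t (w + 3 * e) + 3 * e" for w
    proof -
      have "ereal (F t w) \<le> ereal (V t (w + 3 * e) + 3 * e)"
        using order_trans[OF le_usc_env up[OF t, of w]] unfolding profile_shift by (simp add: V_def)
      moreover have "ereal (- F t w) \<le> usc_env (\<lambda>t x. - F t x) t w" by (rule le_usc_env[of "\<lambda>t x. - F t x"])
      then have "lsc_env F t w \<le> ereal (F t w)"
        unfolding lsc_env_eq_usc_env by (metis ereal_minus_le_minus ereal_uminus_uminus uminus_ereal.simps(1))
      from order_trans[OF lo[OF t, of w] this]
      have "ereal (V t (w - 3 * e) - 3 * e) \<le> ereal (F t w)"
        unfolding profile_shift by (simp add: V_def)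
      ultimately show ?thesis by simp
    qed
    have inc: "\<bar>V t v - V t w - (v - w) / (2 * pi)\<bar> \<le> 2 / t * \<bar>v - w\<bar>" for v w
      unfolding V_def using h by (intro profile_increment t) auto
    have t2: "0 < 2 / t" using t by simp
    have A: "F t x - F t y - (x - y) / (2 * pi) \<le> 2 / t * (x - y + 6 * e) + 6 * e / (2 * pi) + 6 * e"
    proof -
      have "(x + 3 * e - (y - 3 * e)) / (2 * pi) = (x - y) / (2 * pi) + 6 * e / (2 * pi)" by (simp add: field_simps)
      moreover have "2 / t * \<bar>x + 3 * e - (y - 3 * e)\<bar> = 2 / t * (x - y + 6 * e)"
        using xy e by simp
      ultimately show ?thesis
        using sandwich[of x] sandwich[of y] inc[of "x + 3 * e" "y - 3 * e"]
        by linarith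
    qed
    have A': "- (2 / t * (x - y + 6 * e) + 6 * e / (2 * pi) + 6 * e) \<le> F t x - F t y - (x - y) / (2 * pi)"
    proof -
      have "(x - 3 * e - (y + 3 * e)) / (2 * pi) = (x - y) / (2 * pi) - 6 * e / (2 * pi)" by (simp add: field_simps)
      moreover have "2 / t * \<bar>x - 3 * e - (y + 3 * e)\<bar> \<le> 2 / t * (x - y + 6 * e)"
        using xy e t2 by (intro mult_left_mono) auto
      ultimately show ?thesis
        using sandwich[of x] sandwich[of y] inc[of "x - 3 * e" "y + 3 * e"]
        by linarith
    qed
    have "2 / t * (x - y + 6 * e) + 6 * e / (2 * pi) + 6 * e \<le> 2 / t * (x - y) + e * (6 * (1 / (2 * pi) + 2 / t) + 6)"
      by (simp add: algebra_simps add_divide_distrib diff_divide_distrib)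
    then show ?thesis using A A' by linarith
  qed
  define K where "K = 6 * (1 / (2 * pi) + 2 / t) + 6"
  have K: "0 < K" using t by (simp add: K_def add_pos_pos)
  show ?thesis
  proof (rule field_le_epsilon)
    fix e :: real assume "0 < e"
    then have "0 < e / K" using K by simp
    from main[OF this, folded K_def]
    show "\<bar>F t x - F t y - (x - y) / (2 * pi)\<bar> \<le> 2 / t * (x - y) + e"
      using K by simp
  qed
qed

section \<open>From increments to densities\<close>

lemma interval_measure_eqI:
  assumes F: "mono F" "\<And>x. continuous (at_right x) F" and sN: "sets N = sets borel"
    and eq: "\<And>a b. a \<le> b \<Longrightarrow> emeasure N {a<..b} = emeasure (interval_measure F) {a<..b}"
  shows "interval_measure F = N"
proof -
  let ?E = "range (\<lambda>(a, b). {a<..b::real})"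
  show ?thesis
  proof (rule measure_eqI_generator_eq[where \<Omega> = UNIV and E = ?E and A = "\<lambda>i. {- real i<..real i}"])
    show "Int_stable ?E"
    proof (rule Int_stableI)
      fix X Y assume "X \<in> ?E" "Y \<in> ?E"
      then obtain a b c d where "X = {a<..b}" "Y = {c<..d}" by auto
      then have "X \<inter> Y = {max a c<..min b d}" by auto
      then show "X \<inter> Y \<in> ?E" by auto
    qed
    show "sets (interval_measure F) = sigma_sets UNIV ?E"
      by (subst sets_interval_measure) (subst borel_sigma_sets_Ioc, simp)
    show "sets N = sigma_sets UNIV ?E"
      unfolding sN by (subst borel_sigma_sets_Ioc) simp
    fix X assume "X \<in> ?E"
    then obtain a b where X: "X = {a<..b}" by auto
    show "emeasure (interval_measure F) X = emeasure N X"
      by (cases "a \<le> b") (simp_all add: X eq)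
  next
    have "\<exists>i. - real i < x \<and> x \<le> real i" for x :: real
    proof -
      obtain i :: nat where "\<bar>x\<bar> < real i" using reals_Archimedean2 by blast
      then show ?thesis by (intro exI[of _ i]) auto
    qed
    then show "(\<Union>i. {- real i<..real i}) = UNIV" by auto
    show "emeasure (interval_measure F) {- real i<..real i} \<noteq> \<infinity>" for i
      by (subst emeasure_interval_measure_Ioc) (use monoD[OF F(1)] F(2) in auto)
  qed auto
qed

lemma interval_measure_add:
  assumes mF: "mono F" "\<And>x. continuous (at_right x) F" and mG: "mono G" "\<And>x. continuous (at_right x) G"
    and A: "A \<in> sets borel"
  shows "emeasure (interval_measure (\<lambda>x. F x + G x)) A
    = emeasure (interval_measure F) A + emeasure (interval_measure G) A"
proof -
  define N where "N = measure_of UNIV (sets borel)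
    (\<lambda>A. emeasure (interval_measure F) A + emeasure (interval_measure G) A)"
  have sN: "sets N = sets borel"
    by (simp add: N_def) (metis sets.sigma_sets_eq space_borel)
  have eN: "emeasure N A = emeasure (interval_measure F) A + emeasure (interval_measure G) A"
    if "A \<in> sets borel" for A
  proof (rule emeasure_measure_of[OF N_def])
    show "countably_additive (sets N) (\<lambda>A. emeasure (interval_measure F) A + emeasure (interval_measure G) A)"
      unfolding countably_additive_def sN
      by (auto simp: suminf_add[symmetric] suminf_emeasure)
  qed (use that sN in \<open>auto simp: positive_def\<close>)
  have FG: "mono (\<lambda>x. F x + G x)" "\<And>x. continuous (at_right x) (\<lambda>x. F x + G x)"
    using mF mG by (auto intro!: continuous_intros add_mono simp: mono_def)
  have Ioc: "emeasure N {a<..b} = emeasure (interval_measure (\<lambda>x. F x + G x)) {a<..b}"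
    if ab: "a \<le> b" for a b
  proof -
    have "F a \<le> F b" "G a \<le> G b" using mF(1) mG(1) ab by (auto dest: monoD)
    moreover have "emeasure (interval_measure H) {a<..b} = ennreal (H b - H a)"
      if "mono H" "\<And>x. continuous (at_right x) H" for H
      by (rule emeasure_interval_measure_Ioc[OF ab]) (use that in \<open>auto dest: monoD\<close>)
    note this[OF mF] this[OF mG] this[OF FG]
    ultimately show ?thesis
      by (simp add: eN ennreal_plus[symmetric] algebra_simps del: ennreal_plus)
  qed
  have "interval_measure (\<lambda>x. F x + G x) = N"
    by (rule interval_measure_eqI[OF FG sN Ioc])
  then show ?thesis using eN[OF A] by simp
qed

lemma interval_measure_mono:
  assumes "mono F" "\<And>x. continuous (at_right x) F" "\<And>x. continuous (at_right x) G"
    and inc: "\<And>x y. x \<le> y \<Longrightarrow> F y - F x \<le> G y - G x" and A: "A \<in> sets borel"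
  shows "emeasure (interval_measure F) A \<le> emeasure (interval_measure G) A"
proof -
  have "mono (\<lambda>x. G x - F x)" using inc by (auto simp: mono_def algebra_simps)
  moreover have "continuous (at_right x) (\<lambda>x. G x - F x)" for x
    by (intro continuous_intros assms)
  ultimately have "emeasure (interval_measure (\<lambda>x. F x + (G x - F x))) A
    = emeasure (interval_measure F) A + emeasure (interval_measure (\<lambda>x. G x - F x)) A"
    by (intro interval_measure_add assms)
  then show ?thesis by simp
qed

lemma interval_measure_linear:
  assumes c: "0 \<le> c" and A: "A \<in> sets borel"
  shows "emeasure (interval_measure (\<lambda>x. c * x)) A = ennreal c * emeasure lborel A"
proof -
  have mono: "mono (\<lambda>x. c * x)" using c by (auto simp: mono_def mult_left_mono)
  have cont: "continuous (at_right x) (\<lambda>x. c * x)" for x by (intro continuous_intros)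
  have "interval_measure (\<lambda>x. c * x) = scale_measure (ennreal c) lborel"
  proof (rule interval_measure_eqI[OF mono cont])
    fix a b :: real assume "a \<le> b"
    then show "emeasure (scale_measure (ennreal c) lborel) {a<..b} = emeasure (interval_measure (\<lambda>x. c * x)) {a<..b}"
      using c by (subst emeasure_interval_measure_Ioc)
        (auto intro!: cont mult_left_mono simp: ennreal_mult right_diff_distrib[symmetric])
  qed simp
  then show ?thesis using A by simp
qed

lemma to_torus_measurable: "to_torus \<in> borel \<rightarrow>\<^sub>M borel"
  by (rule borel_measurableI) (simp add: open_torus_def[symmetric] borel_open flip: open_torus_def)

lemma emeasure_torus_distr:
  assumes "sets \<nu> = sets borel" "B \<in> sets borel"
  shows "emeasure (distr (restrict_space \<nu> {0..<2 * pi}) borel to_torus) B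
    = emeasure \<nu> (to_torus -` B \<inter> {0..<2 * pi})"
proof -
  have sp: "space \<nu> = UNIV" using sets_eq_imp_space_eq[OF assms(1)] by simp
  have m: "to_torus \<in> restrict_space \<nu> {0..<2 * pi} \<rightarrow>\<^sub>M borel"
    using to_torus_measurable assms(1) by (intro measurable_restrict_space1) (simp cong: measurable_cong_sets)
  have "emeasure (distr (restrict_space \<nu> {0..<2 * pi}) borel to_torus) B
    = emeasure (restrict_space \<nu> {0..<2 * pi}) (to_torus -` B \<inter> {0..<2 * pi})"
    using m assms(2) by (simp add: emeasure_distr space_restrict_space sp)
  also have "\<dots> = emeasure \<nu> (to_torus -` B \<inter> {0..<2 * pi})"
    by (rule emeasure_restrict_space) (use sp assms(1) in auto)
  finally show ?thesis .
qed

lemma torus_lebesgue_facts: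
  shows sets_torus_lebesgue: "sets torus_lebesgue = sets borel"
    and finite_torus_lebesgue: "finite_measure torus_lebesgue"
    and torus_lebesgue_nonzero: "emeasure torus_lebesgue (space torus_lebesgue) \<noteq> 0"
proof -
  show "sets torus_lebesgue = sets borel" by (simp add: torus_lebesgue_def)
  have "emeasure torus_lebesgue (space torus_lebesgue) = ennreal (2 * pi)"
    using emeasure_torus_distr[of lborel UNIV] by (simp add: torus_lebesgue_def space_distr)
  then show "emeasure torus_lebesgue (space torus_lebesgue) \<noteq> 0" "finite_measure torus_lebesgue"
    using pi_gt_zero by (auto intro!: finite_measureI simp: ennreal_eq_0_iff simp del: pi_gt_zero)
qed

text \<open>A bound of the measure by a multiple of \<open>L\<close> on the set where the density violates the corresponding bound forces
  that set to be null. The upper bound also provides absolute continuity.\<close>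

lemma RN_deriv_bounds:
  assumes L: "finite_measure L" and s: "sets N = sets L"
    and up: "\<And>B. B \<in> sets L \<Longrightarrow> emeasure N B \<le> ennreal M * emeasure L B"
    and lo: "\<And>B. B \<in> sets L \<Longrightarrow> ennreal m * emeasure L B \<le> emeasure N B"
  shows "AE x in L. RN_deriv L N x \<le> ennreal M" "AE x in L. ennreal m \<le> RN_deriv L N x"
proof -
  interpret finite_measure L by (rule L)
  let ?d = "RN_deriv L N"
  have ac: "absolutely_continuous L N"
    unfolding absolutely_continuous_def
  proof
    fix B assume B: "B \<in> null_sets L"
    then have "emeasure N B \<le> ennreal M * 0" using up[of B] by (auto simp: null_sets_def)
    then show "B \<in> null_sets N" using B s by (auto simp: null_sets_def)
  qed
  have N: "density L ?d = N" by (rule density_RN_deriv[OF ac s])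
  have d[measurable]: "?d \<in> borel_measurable L" by simp
  have dN: "emeasure N B = (\<integral>\<^sup>+x. ?d x * indicator B x \<partial>L)" if "B \<in> sets L" for B
    using that by (subst N[symmetric]) (simp add: emeasure_density)
  have cL: "ennreal c * emeasure L B = (\<integral>\<^sup>+x. ennreal c * indicator B x \<partial>L)" if "B \<in> sets L" for c B
    using that by (simp add: nn_integral_cmult_indicator)
  have finL: "emeasure L B \<noteq> \<infinity>" for B by (simp add: emeasure_eq_measure)
  have finc: "(\<integral>\<^sup>+x. ennreal c * indicator B x \<partial>L) \<noteq> \<infinity>" if "B \<in> sets L" for c B
    using finL[of B] by (simp add: cL[OF that, symmetric] ennreal_mult_eq_top_iff)
  have cfin: "ennreal c * emeasure L B < \<infinity>" for c B
    using finL[of B] by (simp add: ennreal_mult_eq_top_iff less_top[symmetric])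
  have Nfin: "emeasure N B < \<infinity>" if "B \<in> sets L" for B
    by (rule le_less_trans[OF up[OF that] cfin])
  have finN: "(\<integral>\<^sup>+x. ?d x * indicator B x \<partial>L) \<noteq> \<infinity>" if "B \<in> sets L" for B
    using Nfin[OF that] by (simp add: dN[OF that, symmetric])
  define B where "B = {x \<in> space L. ennreal M < ?d x}"
  have B: "B \<in> sets L" unfolding B_def by measurable
  have "(\<integral>\<^sup>+x. ?d x * indicator B x - ennreal M * indicator B x \<partial>L)
      = emeasure N B - ennreal M * emeasure L B"
    unfolding dN[OF B] cL[OF B]
    by (rule nn_integral_diff) (use B finc in \<open>auto simp: B_def split: split_indicator\<close>)
  also have "\<dots> = 0" using up[OF B] Nfin[OF B] by (simp add: diff_eq_0_iff_ennreal)
  finally have "AE x in L. ?d x * indicator B x - ennreal M * indicator B x = 0"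
    using B by (subst (asm) nn_integral_0_iff_AE) auto
  then show "AE x in L. ?d x \<le> ennreal M"
  proof (rule AE_mp, intro AE_I2 impI)
    fix x assume x: "x \<in> space L" "?d x * indicator B x - ennreal M * indicator B x = 0"
    show "?d x \<le> ennreal M"
    proof (rule ccontr)
      assume "\<not> ?d x \<le> ennreal M"
      then have "ennreal M < ?d x" "x \<in> B" using x by (auto simp: B_def)
      then show False using x(2) by (auto simp: diff_eq_0_iff_ennreal)
    qed
  qed
  define C where "C = {x \<in> space L. ?d x < ennreal m}"
  have C: "C \<in> sets L" unfolding C_def by measurable
  have "(\<integral>\<^sup>+x. ennreal m * indicator C x - ?d x * indicator C x \<partial>L)
      = ennreal m * emeasure L C - emeasure N C"
    unfolding dN[OF C] cL[OF C]
    by (rule nn_integral_diff) (use C finN in \<open>auto simp: C_def split: split_indicator\<close>)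
  also have "\<dots> = 0" using lo[OF C] cfin[of m C] by (simp add: diff_eq_0_iff_ennreal)
  finally have "AE x in L. ennreal m * indicator C x - ?d x * indicator C x = 0"
    using C by (subst (asm) nn_integral_0_iff_AE) auto
  then show "AE x in L. ennreal m \<le> ?d x"
  proof (rule AE_mp, intro AE_I2 impI)
    fix x assume x: "x \<in> space L" "ennreal m * indicator C x - ?d x * indicator C x = 0"
    show "ennreal m \<le> ?d x"
    proof (rule ccontr)
      assume "\<not> ennreal m \<le> ?d x"
      then have "?d x < ennreal m" "x \<in> C" using x by (auto simp: C_def)
      then show False using x(2) by (auto simp: diff_eq_0_iff_ennreal)
    qed
  qed
qed

text \<open>Two-sided bounds on the increments of \<open>F\<close> give two-sided bounds of the measure by multiples of Lebesgue measure.
  The lower factor \<open>m\<close> is truncated at \<open>0\<close>, where the monotonicity of \<open>F\<close> takes over.\<close>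

lemma torus_density_near_uniform:
  assumes F: "mono F" "\<And>x. continuous (at_right x) F"
    and lift: "periodic_lift \<mu> (interval_measure F)"
    and e: "0 \<le> e"
    and inc: "\<And>x y. y \<le> x \<Longrightarrow> \<bar>F x - F y - (x - y) / (2 * pi)\<bar> \<le> e * (x - y)"
  shows "AE \<theta> in torus_lebesgue. \<bar>torus_density \<mu> \<theta> - 1 / (2 * pi)\<bar> \<le> e"
proof -
  define m M where "m = max 0 (1 / (2 * pi) - e)" and "M = 1 / (2 * pi) + e"
  have m0: "0 \<le> m" "0 \<le> M" using e by (auto simp: m_def M_def)
  have \<mu>: "\<mu> = distr (restrict_space (interval_measure F) {0..<2 * pi}) borel to_torus"
    using lift unfolding periodic_lift_def by (metis add_0)
  have pre: "to_torus -` B \<inter> {0..<2 * pi} \<in> sets borel" if "B \<in> sets borel" for B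
    using measurable_sets[OF to_torus_measurable that] by auto
  have linc: "F x - F y \<le> M * x - M * y" "m * x - m * y \<le> F x - F y" if "y \<le> x" for x y
  proof -
    have i: "(x - y) / (2 * pi) - e * (x - y) \<le> F x - F y" "F x - F y \<le> (x - y) / (2 * pi) + e * (x - y)"
      using inc[OF that] by (auto simp: abs_le_iff)
    show "F x - F y \<le> M * x - M * y" using i(2) by (simp add: M_def algebra_simps diff_divide_distrib)
    show "m * x - m * y \<le> F x - F y"
    proof (cases "0 \<le> 1 / (2 * pi) - e")
      case True
      then show ?thesis using i(1) by (simp add: m_def algebra_simps diff_divide_distrib)
    next
      case False
      then show ?thesis using monoD[OF F(1) that] by (simp add: m_def)
    qed
  qed
  have c: "continuous (at_right x) (\<lambda>x. k * x)" for k x :: real by (intro continuous_intros)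
  have up: "emeasure \<mu> B \<le> ennreal M * emeasure torus_lebesgue B" if B: "B \<in> sets borel" for B
    unfolding \<mu> torus_lebesgue_def using B m0
    by (simp add: emeasure_torus_distr interval_measure_linear[OF _ pre[OF B], symmetric])
      (intro interval_measure_mono F c linc pre)
  have lo: "ennreal m * emeasure torus_lebesgue B \<le> emeasure \<mu> B" if B: "B \<in> sets borel" for B
    unfolding \<mu> torus_lebesgue_def using B m0
    by (simp add: emeasure_torus_distr interval_measure_linear[OF _ pre[OF B], symmetric])
      (intro interval_measure_mono F c linc pre, auto simp: mono_def mult_left_mono)
  have "sets \<mu> = sets torus_lebesgue" by (simp add: \<mu> sets_torus_lebesgue)
  from RN_deriv_bounds[OF finite_torus_lebesgue this, of M m]
  have "AE \<theta> in torus_lebesgue. RN_deriv torus_lebesgue \<mu> \<theta> \<le> ennreal M"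
    "AE \<theta> in torus_lebesgue. ennreal m \<le> RN_deriv torus_lebesgue \<mu> \<theta>"
    using up lo by (auto simp: sets_torus_lebesgue)
  then show ?thesis
  proof eventually_elim
    case (elim \<theta>)
    have "RN_deriv torus_lebesgue \<mu> \<theta> < \<top>" using elim(1) by (meson ennreal_less_top le_less_trans)
    then have r: "RN_deriv torus_lebesgue \<mu> \<theta> = ennreal (torus_density \<mu> \<theta>)"
      by (simp add: torus_density_def)
    have nn: "0 \<le> torus_density \<mu> \<theta>" by (simp add: torus_density_def)
    have "torus_density \<mu> \<theta> \<le> M" "m \<le> torus_density \<mu> \<theta>"
      using elim m0 nn by (simp_all add: r)
    then show ?case by (auto simp: m_def M_def)
  qed
qed

lemma torus_density_measurable [measurable]: "torus_density \<mu> \<in> borel_measurable torus_lebesgue"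
  unfolding torus_density_def[abs_def] by measurable

text \<open>For \<open>t > 0\<close> the density is within \<open>2 / t\<close> of the uniform one; at \<open>t = 8 * pi\<close> this leaves a
  lower bound of \<open>1 / (4 * pi)\<close>.\<close>

theorem corollary3p2:
  fixes u\<^sub>0 :: "torus measure" and u :: "real \<Rightarrow> torus measure"
  assumes "u\<^sub>0 \<in> torus_probs"
    and "dyson_solution u\<^sub>0 u"
  shows "(\<exists>t>0. ess_min (torus_density (u t)) > 0) \<and>
    ((\<lambda>t. Linf_norm (\<lambda>\<theta>. torus_density (u t) \<theta> - 1 / (2 * pi))) \<longlongrightarrow> 0) at_top"
proof -
  from assms(2) obtain F where F: "integrated_solution u F" unfolding dyson_solution_def by blast
  have near: "AE \<theta> in torus_lebesgue. \<bar>torus_density (u t) \<theta> - 1 / (2 * pi)\<bar> \<le> 2 / t" if t: "0 < t" for t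
  proof (rule torus_density_near_uniform)
    show "mono (F t)" "continuous (at_right x) (F t)" "periodic_lift (u t) (interval_measure (F t))" for x
      using F t by (auto simp: integrated_solution_def)
    show "\<bar>F t x - F t y - (x - y) / (2 * pi)\<bar> \<le> 2 / t * (x - y)" if "y \<le> x" for x y
      by (rule integrated_solution_increment[OF F t that])
  qed (use t in simp)
  have "ess_min (torus_density (u (8 * pi))) > 0"
  proof -
    have "esssup torus_lebesgue (\<lambda>\<theta>. - ereal (torus_density (u (8 * pi)) \<theta>)) \<le> ereal (- (1 / (4 * pi)))"
    proof (rule esssup_I)
      have eq: "1 / (2 * pi) = 2 / (8 * pi) + 1 / (4 * pi)" by (simp add: field_simps)
      have "AE \<theta> in torus_lebesgue. \<bar>torus_density (u (8 * pi)) \<theta> - 1 / (2 * pi)\<bar> \<le> 2 / (8 * pi)"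
        by (rule near) simp
      then show "AE \<theta> in torus_lebesgue. - ereal (torus_density (u (8 * pi)) \<theta>) \<le> ereal (- (1 / (4 * pi)))"
      proof eventually_elim
        case (elim \<theta>)
        then have "1 / (4 * pi) \<le> torus_density (u (8 * pi)) \<theta>" using eq by linarith
        then show ?case by simp
      qed
    qed measurable
    then have "ereal (1 / (4 * pi)) \<le> ess_min (torus_density (u (8 * pi)))"
      unfolding ess_min_def by (metis ereal_minus_le_minus ereal_uminus_uminus uminus_ereal.simps(1))
    moreover have "(0 :: ereal) < ereal (1 / (4 * pi))" by simp
    ultimately show ?thesis by (rule less_le_trans[rotated])
  qed
  moreover have "((\<lambda>t. Linf_norm (\<lambda>\<theta>. torus_density (u t) \<theta> - 1 / (2 * pi))) \<longlongrightarrow> 0) at_top"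
  proof (rule tendsto_sandwich)
    show "\<forall>\<^sub>F t in at_top. 0 \<le> Linf_norm (\<lambda>\<theta>. torus_density (u t) \<theta> - 1 / (2 * pi))"
    proof (rule always_eventually, rule allI)
      fix t
      have "0 = esssup torus_lebesgue (\<lambda>_. 0 :: ereal)"
        using esssup_const[OF torus_lebesgue_nonzero, of "0 :: ereal"] by simp
      also have "\<dots> \<le> Linf_norm (\<lambda>\<theta>. torus_density (u t) \<theta> - 1 / (2 * pi))"
        unfolding Linf_norm_def by (rule esssup_mono) auto
      finally show "0 \<le> Linf_norm (\<lambda>\<theta>. torus_density (u t) \<theta> - 1 / (2 * pi))" .
    qed
    show "\<forall>\<^sub>F t in at_top. Linf_norm (\<lambda>\<theta>. torus_density (u t) \<theta> - 1 / (2 * pi)) \<le> ereal (2 / t)"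
      using eventually_gt_at_top[of 0]
    proof eventually_elim
      case (elim t)
      show ?case unfolding Linf_norm_def
        by (rule esssup_I) (use near[OF elim] in auto)
    qed
    have "((\<lambda>t::real. 2 / t) \<longlongrightarrow> 0) at_top"
      by (intro tendsto_divide_0[OF tendsto_const] filterlim_at_top_imp_at_infinity filterlim_ident)
    then show "((\<lambda>t. ereal (2 / t)) \<longlongrightarrow> 0) at_top"
      by (simp add: zero_ereal_def)
  qed (rule tendsto_const)
  ultimately show ?thesis by (intro conjI exI[of _ "8 * pi"]) auto
qed

end
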